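(* Let $P$ be a polygonal domain in the plane with $n$ vertices, let $\phi$ be the smallest internal angle of $P$, let $0<\alpha\le\sin\tfrac{\phi}{2}$, and let $g\in P$. Then the $\alpha$-robust visibility region $\mathrm{Vis}_\alpha(g)$ can be computed in polynomial time.
   Context: A polygonal domain $P$ is a (closed) polygon in the plane, possibly with holes; $n$ is its total number of vertices. Two points of $P$ see each other if the line segment between them is contained in $P$. $D(p,r)$ denotes the disk of radius $r$ centered at $p$. A point $g\in P$ $\alpha$-robustly guards a point $p\in P$ if $p$ sees every point of $D(g,\alpha\|p-g\|)$. $\mathrm{Vis}_\alpha(g)$ is the set of points of $P$ that are $\alpha$-robustly guarded by $g$. *)

theory Defs
  imports
    "HOL-Complex_Analysis.Contour_Integration"
    "HOL-Computational_Algebra.Polynomial"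
begin

section \<open>Polygonal domains\<close>

text \<open>The plane is the type \<^typ>\<open>complex\<close>.\<close>

text \<open>Concatenation of a nonempty list of paths.\<close>

fun join_list :: "(real \<Rightarrow> complex) list \<Rightarrow> real \<Rightarrow> complex" where
  "join_list [] = linepath 0 0"
| "join_list [p] = p"
| "join_list (p # q # ps) = p +++ join_list (q # ps)"

definition closed_region :: "(real \<Rightarrow> complex) \<Rightarrow> complex set" where
  "closed_region \<gamma> = path_image \<gamma> \<union> inside (path_image \<gamma>)"

definition closed_polyline :: "complex list \<Rightarrow> real \<Rightarrow> complex" where
  "closed_polyline vs = join_list (map2 linepath vs (rotate1 vs))"

text \<open>A simple polygon is given by its vertices in cyclic order; either orientation is allowed.\<close>

definition simple_polygon :: "complex list \<Rightarrow> bool" where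
  "simple_polygon vs \<longleftrightarrow> 3 \<le> length vs \<and> simple_path (closed_polyline vs)"

datatype polydom = Polydom (outer: "complex list") (holes: "complex list list")

definition vertices :: "polydom \<Rightarrow> complex list" where
  "vertices P = concat (outer P # holes P)"

definition num_vertices :: "polydom \<Rightarrow> nat" where
  "num_vertices P = length (vertices P)"

text \<open>The holes are open: their boundary curves belong to the domain.\<close>

definition region :: "polydom \<Rightarrow> complex set" where
  "region P = closed_region (closed_polyline (outer P))
     - (\<Union>h\<in>set (holes P). inside (path_image (closed_polyline h)))"

text \<open>No two boundary curves touch each other.\<close>

definition polygonal_domain :: "polydom \<Rightarrow> bool" where
  "polygonal_domain P \<longleftrightarrow>
     simple_polygon (outer P) \<and>
     (\<forall>h\<in>set (holes P). simple_polygon h \<and>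
        closed_region (closed_polyline h) \<subseteq> inside (path_image (closed_polyline (outer P)))) \<and>
     (\<forall>i<length (holes P). \<forall>j<length (holes P). i \<noteq> j \<longrightarrow>
        closed_region (closed_polyline (holes P ! i)) \<inter>
        closed_region (closed_polyline (holes P ! j)) = {})"

text \<open>The angle of the sector that \<open>S\<close> occupies near \<open>v\<close>, that is, the total measure of the
  directions in which one can leave \<open>v\<close> while staying in \<open>S\<close>. At a vertex of a polygonal domain
  this is the angle between the two incident edges measured through the domain; in particular
  it exceeds \<open>pi\<close> at a reflex vertex.\<close>

definition internal_angle :: "complex set \<Rightarrow> complex \<Rightarrow> real" where
  "internal_angle S v =
     measure lebesgue {t \<in> {0..<2 * pi}. \<forall>\<^sub>F e in at_right 0. v + of_real e * cis t \<in> S}"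

definition smallest_angle :: "polydom \<Rightarrow> real" where
  "smallest_angle P = Min (internal_angle (region P) ` set (vertices P))"


section \<open>Robust visibility\<close>

definition sees :: "complex set \<Rightarrow> complex \<Rightarrow> complex \<Rightarrow> bool" where
  "sees S p q \<longleftrightarrow> closed_segment p q \<subseteq> S"

definition robustly_guards :: "complex set \<Rightarrow> real \<Rightarrow> complex \<Rightarrow> complex \<Rightarrow> bool" where
  "robustly_guards S \<alpha> g p \<longleftrightarrow> g \<in> S \<and> p \<in> S \<and> (\<forall>q\<in>cball g (\<alpha> * norm (p - g)). sees S p q)"

definition Vis :: "complex set \<Rightarrow> real \<Rightarrow> complex \<Rightarrow> complex set" where
  "Vis S \<alpha> g = {p \<in> S. robustly_guards S \<alpha> g p}"


section \<open>Boundary descriptions of planar regions\<close>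

text \<open>A region is described by a single point or by a simple closed curve that bounds it. The
  curve is a cyclic list of boundary pieces, each given by its starting point and its shape; it
  ends where the next piece starts. An arc carries the center of its circle.\<close>

datatype shape = Straight | Ccw complex | Cw complex

inductive traces :: "complex \<Rightarrow> shape \<Rightarrow> complex \<Rightarrow> (real \<Rightarrow> complex) \<Rightarrow> bool" where
  "traces a Straight b (linepath a b)"
| "\<lbrakk>0 < r; s < t; t \<le> s + 2 * pi; a = c + of_real r * cis s; b = c + of_real r * cis t\<rbrakk>
   \<Longrightarrow> traces a (Ccw c) b (part_circlepath c r s t)"
| "\<lbrakk>0 < r; t < s; s \<le> t + 2 * pi; a = c + of_real r * cis s; b = c + of_real r * cis t\<rbrakk>
   \<Longrightarrow> traces a (Cw c) b (part_circlepath c r s t)"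

datatype description = Point complex | Boundary "(complex \<times> shape) list"

fun describes :: "description \<Rightarrow> complex set \<Rightarrow> bool" where
  "describes (Point p) S \<longleftrightarrow> S = {p}"
| "describes (Boundary bs) S \<longleftrightarrow> bs \<noteq> [] \<and>
     (\<exists>ps. length ps = length bs \<and>
        (\<forall>i<length bs. traces (fst (bs ! i)) (snd (bs ! i))
                              (fst (bs ! (Suc i mod length bs))) (ps ! i)) \<and>
        simple_path (join_list ps) \<and>
        S = closed_region (join_list ps))"


section \<open>A real random access machine\<close>

text \<open>A structured programming language for the real RAM. Memory consists of named arrays of
  natural numbers and named arrays of real numbers, all unbounded. Array indices are natural
  numbers, whose only arithmetic is addition and truncated subtraction. Real arithmetic, including
  square roots, and comparisons are exact. Every operation has unit cost. There is no rounding or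
  other conversion from reals to naturals, and the only constants are natural numbers.

  Division by zero and square roots of negative numbers follow the conventions of HOL
  (\<^term>\<open>x / 0 = (0::real)\<close> and \<^term>\<open>sqrt (- x) = - sqrt x\<close>). They add no power, as a
  program can test for these cases.\<close>

type_synonym array_name = string

datatype nexp =
    NConst nat
  | NArr array_name nexp
  | NAdd nexp nexp
  | NSub nexp nexp

datatype rexp =
    RNat nexp
  | RArr array_name nexp
  | RAdd rexp rexp
  | RSub rexp rexp
  | RMul rexp rexp
  | RDiv rexp rexp
  | RSqrt rexp

datatype bexp =
    NLe nexp nexp
  | RLe rexp rexp
  | BNot bexp
  | BAnd bexp bexp

datatype com =
    Skip
  | NAssign array_name nexp nexp
  | RAssign array_name nexp rexp
  | Seq com com
  | Cond bexp com com
  | While bexp com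

record state =
  nats :: "array_name \<Rightarrow> nat \<Rightarrow> nat"
  reals :: "array_name \<Rightarrow> nat \<Rightarrow> real"

primrec nval :: "nexp \<Rightarrow> state \<Rightarrow> nat" where
  "nval (NConst c) s = c"
| "nval (NArr x e) s = nats s x (nval e s)"
| "nval (NAdd e f) s = nval e s + nval f s"
| "nval (NSub e f) s = nval e s - nval f s"

primrec rval :: "rexp \<Rightarrow> state \<Rightarrow> real" where
  "rval (RNat e) s = real (nval e s)"
| "rval (RArr x e) s = reals s x (nval e s)"
| "rval (RAdd e f) s = rval e s + rval f s"
| "rval (RSub e f) s = rval e s - rval f s"
| "rval (RMul e f) s = rval e s * rval f s"
| "rval (RDiv e f) s = rval e s / rval f s"
| "rval (RSqrt e) s = sqrt (rval e s)"

primrec bval :: "bexp \<Rightarrow> state \<Rightarrow> bool" where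
  "bval (NLe e f) s \<longleftrightarrow> nval e s \<le> nval f s"
| "bval (RLe e f) s \<longleftrightarrow> rval e s \<le> rval f s"
| "bval (BNot b) s \<longleftrightarrow> \<not> bval b s"
| "bval (BAnd b c) s \<longleftrightarrow> bval b s \<and> bval c s"

primrec ncost :: "nexp \<Rightarrow> nat" where
  "ncost (NConst c) = 1"
| "ncost (NArr x e) = 1 + ncost e"
| "ncost (NAdd e f) = 1 + ncost e + ncost f"
| "ncost (NSub e f) = 1 + ncost e + ncost f"

primrec rcost :: "rexp \<Rightarrow> nat" where
  "rcost (RNat e) = 1 + ncost e"
| "rcost (RArr x e) = 1 + ncost e"
| "rcost (RAdd e f) = 1 + rcost e + rcost f"
| "rcost (RSub e f) = 1 + rcost e + rcost f"
| "rcost (RMul e f) = 1 + rcost e + rcost f"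
| "rcost (RDiv e f) = 1 + rcost e + rcost f"
| "rcost (RSqrt e) = 1 + rcost e"

primrec bcost :: "bexp \<Rightarrow> nat" where
  "bcost (NLe e f) = 1 + ncost e + ncost f"
| "bcost (RLe e f) = 1 + rcost e + rcost f"
| "bcost (BNot b) = 1 + bcost b"
| "bcost (BAnd b c) = 1 + bcost b + bcost c"

definition nupd :: "array_name \<Rightarrow> nat \<Rightarrow> nat \<Rightarrow> state \<Rightarrow> state" where
  "nupd x i v s = s\<lparr>nats := (nats s)(x := (nats s x)(i := v))\<rparr>"

definition rupd :: "array_name \<Rightarrow> nat \<Rightarrow> real \<Rightarrow> state \<Rightarrow> state" where
  "rupd x i v s = s\<lparr>reals := (reals s)(x := (reals s x)(i := v))\<rparr>"

text \<open>\<open>exec c s t s'\<close>: started in state \<open>s\<close>, the program \<open>c\<close> terminates in state \<open>s'\<close> after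
  exactly \<open>t\<close> steps.\<close>

inductive exec :: "com \<Rightarrow> state \<Rightarrow> nat \<Rightarrow> state \<Rightarrow> bool" where
  Skip: "exec Skip s 1 s"
| NAssign: "exec (NAssign x e f) s (1 + ncost e + ncost f) (nupd x (nval e s) (nval f s) s)"
| RAssign: "exec (RAssign x e f) s (1 + ncost e + rcost f) (rupd x (nval e s) (rval f s) s)"
| Seq: "\<lbrakk>exec c s t s'; exec d s' u s''\<rbrakk> \<Longrightarrow> exec (Seq c d) s (t + u) s''"
| CondTrue: "\<lbrakk>bval b s; exec c s t s'\<rbrakk> \<Longrightarrow> exec (Cond b c d) s (1 + bcost b + t) s'"
| CondFalse: "\<lbrakk>\<not> bval b s; exec d s t s'\<rbrakk> \<Longrightarrow> exec (Cond b c d) s (1 + bcost b + t) s'"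
| WhileFalse: "\<not> bval b s \<Longrightarrow> exec (While b c) s (1 + bcost b) s"
| WhileTrue: "\<lbrakk>bval b s; exec c s t s'; exec (While b c) s' u s''\<rbrakk>
    \<Longrightarrow> exec (While b c) s (1 + bcost b + t + u) s''"

inductive_cases SkipE: "exec Skip s t s'"
inductive_cases NAssignE: "exec (NAssign x e f) s t s'"
inductive_cases RAssignE: "exec (RAssign x e f) s t s'"
inductive_cases SeqE: "exec (Seq c d) s t s'"
inductive_cases CondE: "exec (Cond b c d) s t s'"
inductive_cases WhileE: "exec (While b c) s t s'"

lemma exec_deterministic:
  "exec c s t s' \<Longrightarrow> exec c s u s'' \<Longrightarrow> u = t \<and> s'' = s'"
proof (induction arbitrary: u s'' rule: exec.induct)
  case Skip
  then show ?case by (rule SkipE) simp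
next
  case NAssign
  then show ?case by (rule NAssignE) simp
next
  case RAssign
  then show ?case by (rule RAssignE) simp
next
  case Seq
  from Seq.prems show ?case by (rule SeqE) (metis Seq.IH)
next
  case CondTrue
  from CondTrue.prems show ?case by (rule CondE) (auto simp: CondTrue.hyps dest!: CondTrue.IH)
next
  case CondFalse
  from CondFalse.prems show ?case by (rule CondE) (auto simp: CondFalse.hyps dest!: CondFalse.IH)
next
  case WhileFalse
  from WhileFalse.prems show ?case by (rule WhileE) (use WhileFalse.hyps in simp_all)
next
  case WhileTrue
  from WhileTrue.prems show ?case by (rule WhileE) (auto simp: WhileTrue.hyps dest!: WhileTrue.IH)
qed


section \<open>Input and output\<close>

definition nth0 :: "'a::zero list \<Rightarrow> nat \<Rightarrow> 'a" where
  "nth0 xs i = (if i < length xs then xs ! i else 0)"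

text \<open>The input lists the number of boundary curves, their numbers of vertices (outer boundary
  first), and the coordinates of all vertices, curve by curve. Everything else is 0.\<close>

definition input_state :: "polydom \<Rightarrow> real \<Rightarrow> complex \<Rightarrow> state" where
  "input_state P \<alpha> g = \<lparr>
     nats = (\<lambda>_ _. 0)
       (''curves'' := nth0 [1 + length (holes P)],
        ''lengths'' := nth0 (map length (outer P # holes P))),
     reals = (\<lambda>_ _. 0)
       (''vx'' := nth0 (map Re (vertices P)),
        ''vy'' := nth0 (map Im (vertices P)),
        ''alpha'' := nth0 [\<alpha>],
        ''gx'' := nth0 [Re g],
        ''gy'' := nth0 [Im g])\<rparr>"

text \<open>The output consists of the number \<open>k\<close> of boundary pieces, and for each piece its starting
  point, the kind of its shape, and the center in case of an arc; \<open>k = 0\<close> encodes a single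
  point.\<close>

definition output_shape :: "state \<Rightarrow> nat \<Rightarrow> shape" where
  "output_shape s i =
     (let c = Complex (reals s ''cx'' i) (reals s ''cy'' i) in
      if nats s ''kind'' i = 0 then Straight
      else if nats s ''kind'' i = 1 then Ccw c else Cw c)"

definition output_start :: "state \<Rightarrow> nat \<Rightarrow> complex" where
  "output_start s i = Complex (reals s ''px'' i) (reals s ''py'' i)"

definition computed :: "state \<Rightarrow> description" where
  "computed s =
     (let k = nats s ''pieces'' 0 in
      if k = 0 then Point (output_start s 0)
      else Boundary (map (\<lambda>i. (output_start s i, output_shape s i)) [0..<k]))"

end

theory Submission
  imports Defs "HOL-Library.Quadratic_Discriminant"
begin

text \<open>Place \<open>g\<close> at the origin. A point \<open>p\<close> is robustly guarded iff every disk with center \<open>y\<close> on the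
  segment from \<open>g\<close> to \<open>p\<close> and radius \<open>\<alpha> * norm (p - y)\<close> has no boundary point of the domain in its
  interior. For \<open>p = \<rho> *\<^sub>R u\<close> with a unit vector \<open>u\<close> this means that \<open>\<rho>\<close> is at most the minimum of the convex function
  \<open>s + norm (x - s *\<^sub>R u) / \<alpha>\<close> over \<open>s \<ge> 0\<close> and \<open>x\<close> on an edge. The minimum is attained at \<open>s = 0\<close>, at an
  endpoint of the edge or where \<open>x = s *\<^sub>R u\<close>, so the region is star-shaped, and its radial function is a
  minimum of finitely many functions whose graphs are circles about \<open>g\<close>, circles through \<open>g\<close>, or lines.
  With a point, the region also contains the hull of that point and its disk; hence the radial
  function is continuous and the boundary is a simple closed curve, unless \<open>g\<close> lies on an edge and
  the region is \<open>{g}\<close>.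

  Any two of the functions agree in directions whose cotangent solves a quadratic equation. The
  algorithm sorts all these cotangents, and finds the minimal function in each of the resulting
  sectors by testing one direction in it.\<close>

section \<open>Boundary curves and the region they bound\<close>

text \<open>The machine has square roots but no trigonometric functions. So directions are kept as
  vectors, a direction inside a sector is the sum of the two vectors that bound it, and angles occur
  only in the correctness proof. Between breakpoints the cross-multiplied difference of two radii
  keeps its sign, so a constraint that is minimal in one direction of a sector is minimal in the
  whole sector; at its two ends, where other constraints may become active, continuity of the radial
  function takes over. Topology is kept apart from arithmetic: a closed bounded set with connected
  complement is the region enclosed by any curve whose image is its frontier, so it suffices that
  the pieces run once around the radial graph. Whether \<open>g\<close> lies on an edge is never
  tested beforehand: the same computation then yields radius 0. Finally, one number bounds the
  rounds of every loop, so the running time of the fixed program is a polynomial in it.\<close>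

lemma pathstart_join_list: "ps \<noteq> [] \<Longrightarrow> pathstart (join_list ps) = pathstart (hd ps)"
  by (induction ps rule: join_list.induct) auto

lemma pathfinish_join_list: "ps \<noteq> [] \<Longrightarrow> pathfinish (join_list ps) = pathfinish (last ps)"
  by (induction ps rule: join_list.induct) auto

lemma path_image_join_list:
  "ps \<noteq> [] \<Longrightarrow> successively (\<lambda>p q. pathfinish p = pathstart q) ps \<Longrightarrow>
    path_image (join_list ps) = (\<Union>p\<in>set ps. path_image p)"
proof (induction ps rule: join_list.induct)
  case (3 p q ps)
  then show ?case
    by (auto simp: path_image_join pathstart_join_list)
qed auto

lemma successively_polyline:
  "successively (\<lambda>p q. pathfinish p = pathstart q) (map2 linepath vs (rotate1 vs))"
  by (auto simp: successively_conv_nth nth_rotate1)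

lemma path_image_closed_polyline:
  assumes "vs \<noteq> []"
  shows "path_image (closed_polyline vs) = (\<Union>(a, b)\<in>set (zip vs (rotate1 vs)). closed_segment a b)"
proof -
  have "path_image (closed_polyline vs) = (\<Union>p\<in>set (map2 linepath vs (rotate1 vs)). path_image p)"
    unfolding closed_polyline_def
    by (rule path_image_join_list) (use assms successively_polyline in \<open>auto simp: zip_eq_Nil_iff\<close>)
  then show ?thesis
    by auto
qed

lemma closed_polyline_loop:
  assumes "vs \<noteq> []"
  shows "pathfinish (closed_polyline vs) = pathstart (closed_polyline vs)"
proof -
  have ne: "map2 linepath vs (rotate1 vs) \<noteq> []"
    using assms by (auto simp: zip_eq_Nil_iff)
  have "last (map2 linepath vs (rotate1 vs)) = linepath (last vs) (hd vs)"
    using assms ne by (cases vs) (auto simp: last_map last_zip)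
  moreover have "hd (map2 linepath vs (rotate1 vs)) = linepath (hd vs) (hd (rotate1 vs))"
    using assms by (cases vs) (auto simp: hd_map hd_zip)
  ultimately show ?thesis
    using ne by (simp add: closed_polyline_def pathstart_join_list pathfinish_join_list)
qed

definition boundary :: "polydom \<Rightarrow> complex set" where
  "boundary P = (\<Union>h\<in>set (outer P # holes P). path_image (closed_polyline h))"

locale polygonal =
  fixes P :: polydom
  assumes dom: "polygonal_domain P"
begin

abbreviation "curve vs \<equiv> path_image (closed_polyline vs)"

lemma simple_curves: "h \<in> set (outer P # holes P) \<Longrightarrow> simple_polygon h"
  using dom by (auto simp: polygonal_domain_def)

lemma curve_ne: "h \<in> set (outer P # holes P) \<Longrightarrow> h \<noteq> []"
  using simple_curves by (force simp: simple_polygon_def)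

lemma closed_curve: "h \<in> set (outer P # holes P) \<Longrightarrow> closed (curve h)"
  using simple_curves[of h] by (simp add: simple_polygon_def closed_simple_path_image)

lemma jordan:
  assumes "h \<in> set (outer P # holes P)"
  shows "frontier (inside (curve h)) = curve h" "frontier (outside (curve h)) = curve h"
    "open (inside (curve h))"
  using Jordan_inside_outside[of "closed_polyline h"] simple_curves[OF assms]
    closed_polyline_loop[OF curve_ne[OF assms]]
  by (auto simp: simple_polygon_def)

text \<open>In this form the complement of the region is visibly a union of open sets, one outside
  and several insides, and every boundary curve is the frontier of one of them.\<close>

lemma region_alt:
  "region P = - outside (curve (outer P)) - (\<Union>h\<in>set (holes P). inside (curve h))"
  unfolding region_def closed_region_def union_with_inside ..

lemma closed_region_P: "closed (region P)"
proof -
  have "open (outside (curve (outer P)))" "\<And>h. h \<in> set (holes P) \<Longrightarrow> open (inside (curve h))"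
    using open_outside[OF closed_curve] jordan by auto
  then show ?thesis
    unfolding region_alt by (intro closed_Diff) (auto simp: closed_def)
qed

lemma frontier_region: "frontier (region P) \<subseteq> boundary P"
proof
  fix x assume x: "x \<in> frontier (region P)"
  show "x \<in> boundary P"
  proof (rule ccontr)
    assume nb: "x \<notin> boundary P"
    \<comment> \<open>Points of the region on no boundary curve lie in this open set, which is
      contained in the region.\<close>
    let ?U = "inside (curve (outer P)) - (\<Union>h\<in>set (holes P). curve h \<union> inside (curve h))"
    have "closed (\<Union>h\<in>set (holes P). curve h \<union> inside (curve h))"
      using simple_curves
      by (intro closed_UN) (auto intro!: closed_path_image_Un_inside simple_path_imp_path simp: simple_polygon_def)
    then have "open ?U"
      using jordan(3)[of "outer P"] by (intro open_Diff) auto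
    moreover have "?U \<subseteq> region P"
      by (auto simp: region_def closed_region_def)
    ultimately have "?U \<subseteq> interior (region P)"
      by (rule interior_maximal[rotated])
    moreover have "x \<in> region P"
      using x closed_region_P by (simp add: frontier_def)
    then have "x \<in> ?U"
      using nb by (auto simp: region_def closed_region_def boundary_def)
    ultimately show False
      using x by (auto simp: frontier_def)
  qed
qed

text \<open>Every boundary point is a limit of points outside the region: of the exterior for the
  outer curve, of the hole for the other curves.\<close>

lemma boundary_not_interior: "boundary P \<inter> interior (region P) = {}"
proof -
  have False if x: "x \<in> boundary P" "x \<in> interior (region P)" for x
  proof -
    obtain W where W: "W \<inter> region P = {}" "x \<in> frontier W"
    proof -
      from x(1) consider "x \<in> curve (outer P)" | h where "h \<in> set (holes P)" "x \<in> curve h"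
        by (auto simp: boundary_def)
      then show thesis
      proof cases
        case 1
        have "outside (curve (outer P)) \<inter> region P = {}"
          by (auto simp: region_alt)
        then show ?thesis using that 1 jordan(2)[of "outer P"] by auto
      next
        case 2
        have "inside (curve h) \<inter> region P = {}"
          using 2 by (auto simp: region_alt)
        then show ?thesis using that 2 jordan(1)[of h] by auto
      qed
    qed
    from W(2) have "x \<in> closure W" by (simp add: frontier_def)
    moreover have "interior (region P) \<inter> W = {}"
      using W(1) interior_subset by blast
    ultimately show False
      using x(2) open_Int_closure_eq_empty[of "interior (region P)" W] by auto
  qed
  then show ?thesis by auto
qed

lemma boundary_segments:
  "boundary P = (\<Union>h\<in>set (outer P # holes P). \<Union>(a, b)\<in>set (zip h (rotate1 h)). closed_segment a b)"
  unfolding boundary_def using path_image_closed_polyline[OF curve_ne] by (rule SUP_cong[OF refl])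

end

section \<open>Robust visibility in terms of the boundary\<close>

text \<open>The convex hull of \<open>p\<close> and the disk guarding it is the union of the disks centred at the
  points of the segment from \<open>g\<close> to \<open>p\<close> whose radii shrink linearly to zero at \<open>p\<close>.\<close>

lemma in_Vis_iff:
  fixes S E :: "complex set"
  assumes S: "closed S" "frontier S \<subseteq> E" "E \<inter> interior S = {}" and g: "g \<in> S" and \<alpha>: "0 < \<alpha>"
  shows "p \<in> Vis S \<alpha> g \<longleftrightarrow> (\<forall>x\<in>E. \<forall>y\<in>closed_segment g p. \<alpha> * norm (p - y) \<le> norm (x - y))"
    (is "_ \<longleftrightarrow> ?R")
proof
  assume L: "p \<in> Vis S \<alpha> g"
  show ?R
  proof (intro ballI, rule ccontr)
    fix x y assume x: "x \<in> E" and y: "y \<in> closed_segment g p"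
      and "\<not> \<alpha> * norm (p - y) \<le> norm (x - y)"
    then have xy: "norm (x - y) < \<alpha> * norm (p - y)" by simp
    obtain u where u: "0 \<le> u" "u \<le> 1" "y = p + u *\<^sub>R (g - p)"
      using y unfolding in_segment closed_segment_commute[of g] by (auto simp: algebra_simps)
    have "u \<noteq> 0"
      using xy u by (auto simp: not_less[symmetric])
    then have u0: "u > 0" using u by simp
    have "z \<in> S" if z: "z \<in> ball y (\<alpha> * norm (p - y))" for z
    proof -
      \<comment> \<open>The homothety with centre \<open>p\<close> and ratio \<open>1 / u\<close>
        takes \<open>y\<close> to \<open>g\<close> and the small disk to the guarding disk. So
        \<open>z\<close> lies on a segment from \<open>p\<close> to a point of the guarding
        disk.\<close>
      define q where "q = p + (1 / u) *\<^sub>R (z - p)"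
      have "q - g = (1 / u) *\<^sub>R (z - y)"
        using u0 by (simp add: q_def u(3) algebra_simps)
      then have "norm (q - g) = norm (z - y) / u"
        using u0 by simp
      also have "\<dots> \<le> \<alpha> * norm (p - y) / u"
        using z u0 by (simp add: dist_norm norm_minus_commute divide_simps)
      also have "norm (p - y) = u * norm (p - g)"
        using u0 by (simp add: u(3) norm_minus_commute)
      finally have "norm (q - g) \<le> \<alpha> * norm (p - g)"
        using u0 by simp
      then have "closed_segment p q \<subseteq> S"
        using L by (auto simp: Vis_def robustly_guards_def sees_def dist_norm norm_minus_commute)
      moreover have "z = (1 - u) *\<^sub>R p + u *\<^sub>R q"
        using u0 by (simp add: q_def algebra_simps)
      then have "z \<in> closed_segment p q"
        using u unfolding in_segment by blast
      ultimately show ?thesis by auto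
    qed
    then have "ball y (\<alpha> * norm (p - y)) \<subseteq> interior S"
      by (intro interior_maximal) auto
    moreover have "x \<in> ball y (\<alpha> * norm (p - y))"
      using xy by (simp add: dist_norm norm_minus_commute)
    ultimately show False
      using S(3) x by auto
  qed
next
  assume R: ?R
  \<comment> \<open>At a point \<open>x\<close> of \<open>E\<close> on the segment from
    \<open>g\<close> to \<open>y\<close> the hypothesis for \<open>x\<close> itself forces
    \<open>x = p\<close>; so this segment misses \<open>E\<close>. A connected set that starts in
    \<open>S\<close> and misses its frontier stays in \<open>S\<close>.\<close>
  have seg: "y \<in> S" if y: "y \<in> closed_segment g p" "y \<noteq> p" for y
  proof -
    have "closed_segment g y \<inter> E = {}"
    proof (rule ccontr)
      assume "closed_segment g y \<inter> E \<noteq> {}"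
      then obtain x where x: "x \<in> closed_segment g y" "x \<in> E" by auto
      have "x \<in> closed_segment g p"
        using x(1) y(1) subset_closed_segment[of g y g p] by auto
      then have "\<alpha> * norm (p - x) \<le> 0"
        using R x(2) by fastforce
      then have "p = x" using \<alpha> by (simp add: mult_le_0_iff)
      then show False
        using x(1) y between_antisym[of p g y]
        by (auto simp: between_mem_segment closed_segment_commute)
    qed
    moreover have "closed_segment g y \<inter> frontier S \<noteq> {}" if "y \<notin> S"
      by (rule connected_Int_frontier) (use that g in auto)
    ultimately show ?thesis using S(2) by blast
  qed
  \<comment> \<open>The open disk is connected, has its centre in \<open>S\<close> and misses the
    frontier; closedness of \<open>S\<close> adds the bounding circle.\<close>
  have cb: "z \<in> S" if y: "y \<in> closed_segment g p" "y \<noteq> p" and z: "norm (z - y) \<le> \<alpha> * norm (p - y)" for y z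
  proof -
    define r where "r = \<alpha> * norm (p - y)"
    have r: "r > 0" using \<alpha> y(2) by (simp add: r_def)
    have "ball y r \<inter> E = {}"
      using R y(1) by (force simp: r_def dist_norm norm_minus_commute)
    have "ball y r \<subseteq> S"
    proof (rule ccontr)
      assume "\<not> ball y r \<subseteq> S"
      moreover have "y \<in> ball y r \<inter> S" using seg[OF y] r by simp
      then have "ball y r \<inter> S \<noteq> {}" by blast
      ultimately have "ball y r \<inter> frontier S \<noteq> {}"
        by (intro connected_Int_frontier) auto
      then show False using S(2) \<open>ball y r \<inter> E = {}\<close> by blast
    qed
    then have "closure (ball y r) \<subseteq> S"
      using S(1) by (simp add: closure_minimal)
    then show ?thesis
      using z r by (auto simp: closure_ball r_def dist_norm norm_minus_commute)
  qed
  have "p \<in> S"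
  proof (cases "p = g")
    case False
    have "open_segment g p \<subseteq> S"
      using seg by (auto simp: open_segment_def)
    then have "closure (open_segment g p) \<subseteq> S"
      using S(1) by (rule closure_minimal)
    moreover have "p \<in> closure (open_segment g p)"
      using False by simp
    ultimately show ?thesis by blast
  qed (use g in simp)
  moreover have "z \<in> S" if q: "norm (q - g) \<le> \<alpha> * norm (p - g)" and z: "z \<in> closed_segment p q" for q z
  proof -
    obtain u where u: "0 \<le> u" "u \<le> 1" "z = (1 - u) *\<^sub>R p + u *\<^sub>R q"
      using z unfolding in_segment by auto
    show ?thesis
    proof (cases "u = 0 \<or> p = g")
      case True
      then show ?thesis using u q \<open>p \<in> S\<close> by (auto simp: algebra_simps)
    next
      case False
      define y where "y = (1 - u) *\<^sub>R p + u *\<^sub>R g"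
      have "y \<in> closed_segment g p"
        using u unfolding closed_segment_commute[of g] in_segment y_def by auto
      moreover have py: "p - y = u *\<^sub>R (p - g)"
        by (simp add: y_def algebra_simps)
      then have "y \<noteq> p" using False by auto
      moreover have "norm (z - y) = u * norm (q - g)"
        unfolding u(3) y_def using u(1) by (simp add: algebra_simps flip: scaleR_diff_right)
      then have "norm (z - y) \<le> \<alpha> * norm (p - y)"
        using mult_left_mono[OF q u(1)] u(1) by (simp add: py mult.left_commute)
      ultimately show ?thesis by (rule cb)
    qed
  qed
  ultimately show "p \<in> Vis S \<alpha> g"
    using g by (auto simp: Vis_def robustly_guards_def sees_def dist_norm norm_minus_commute)
qed

section \<open>Radial description of the visibility region\<close>

definition cross :: "complex \<Rightarrow> complex \<Rightarrow> real" where
  "cross a b = Re a * Im b - Im a * Re b"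

text \<open>Lagrange's identity: the inner and the cross product with a unit vector are the
  coordinates along it and across it.\<close>

lemma norm_sq_inner_cross:
  assumes "norm u = 1"
  shows "(norm v)\<^sup>2 = (v \<bullet> u)\<^sup>2 + (cross v u)\<^sup>2"
proof -
  have u: "(Re u)\<^sup>2 + (Im u)\<^sup>2 = 1"
    using assms by (metis cmod_power2 power_one)
  have "(v \<bullet> u)\<^sup>2 + (cross v u)\<^sup>2 = ((Re v)\<^sup>2 + (Im v)\<^sup>2) * ((Re u)\<^sup>2 + (Im u)\<^sup>2)"
    by (simp add: inner_complex_def cross_def power2_eq_square algebra_simps)
  then show ?thesis using u by (simp add: cmod_power2)
qed

lemma cross_eq_0_imp_parallel:
  assumes "norm u = 1" "cross v u = 0"
  shows "v = (v \<bullet> u) *\<^sub>R u"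
proof -
  have "(norm (v - (v \<bullet> u) *\<^sub>R u))\<^sup>2 = 0"
    using assms norm_sq_inner_cross[OF assms(1), of "v - (v \<bullet> u) *\<^sub>R u"]
    by (simp add: inner_diff_left dot_square_norm cross_def algebra_simps)
  then show ?thesis by simp
qed

text \<open>The disks inscribed in the hull that belongs to the point at distance \<open>\<rho>\<close> from the origin
  in direction \<open>u\<close> do not contain \<open>x\<close>.\<close>

definition clear :: "real \<Rightarrow> real \<Rightarrow> complex \<Rightarrow> complex \<Rightarrow> bool" where
  "clear \<alpha> \<rho> u x \<longleftrightarrow> (\<forall>s. 0 \<le> s \<and> s \<le> \<rho> \<longrightarrow> \<alpha> * (\<rho> - s) \<le> norm (x - s *\<^sub>R u))"

lemma small_perturbation:
  fixes x :: real
  assumes "lo < x" "x < hi"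
  obtains e where "e > 0" "\<And>t. \<bar>t\<bar> \<le> e \<Longrightarrow> lo \<le> x + t * p \<and> x + t * p \<le> hi"
proof
  let ?e = "min (x - lo) (hi - x) / (1 + \<bar>p\<bar>)"
  show "?e > 0" using assms by simp
  fix t assume "\<bar>t\<bar> \<le> ?e"
  then have "\<bar>t\<bar> * (1 + \<bar>p\<bar>) \<le> min (x - lo) (hi - x)"
    by (simp add: pos_le_divide_eq)
  moreover have "\<bar>t * p\<bar> \<le> \<bar>t\<bar> * (1 + \<bar>p\<bar>)"
    by (simp add: abs_mult algebra_simps)
  ultimately have "\<bar>t * p\<bar> \<le> min (x - lo) (hi - x)"
    by linarith
  then show "lo \<le> x + t * p \<and> x + t * p \<le> hi" by (auto simp: abs_le_iff)
qed

text \<open>Among the minimizers of the convex function \<open>norm (x - s *\<^sub>R u) + \<alpha> * s\<close> on the edge times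
  an interval, one that also minimizes \<open>norm (x - s *\<^sub>R u)\<close> cannot lie in the interior, since the
  function is affine along the ray that scales \<open>x - s *\<^sub>R u\<close>.\<close>

lemma clear_edge:
  assumes u: "norm u = 1" and \<alpha>: "0 < \<alpha>"
    and foot: "\<And>x. x \<in> closed_segment a b \<Longrightarrow> \<alpha> * \<rho> \<le> norm x"
    and ends: "clear \<alpha> \<rho> u a" "clear \<alpha> \<rho> u b"
    and hit: "\<And>s. 0 \<le> s \<Longrightarrow> s *\<^sub>R u \<in> closed_segment a b \<Longrightarrow> \<rho> \<le> s"
    and x: "x \<in> closed_segment a b"
  shows "clear \<alpha> \<rho> u x"
proof (rule ccontr)
  assume "\<not> clear \<alpha> \<rho> u x"
  then obtain s where s: "0 \<le> s" "s \<le> \<rho>" "norm (x - s *\<^sub>R u) < \<alpha> * (\<rho> - s)"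
    by (auto simp: clear_def not_le)
  define K where "K = closed_segment a b \<times> {0..\<rho>}"
  define f where "f = (\<lambda>z::complex \<times> real. norm (fst z - snd z *\<^sub>R u))"
  define G where "G = (\<lambda>z. f z + \<alpha> * snd z)"
  have cf: "continuous_on A f" "continuous_on A G" for A
    unfolding G_def f_def by (intro continuous_intros)+
  have "compact K" "K \<noteq> {}"
    using x s by (auto simp: K_def intro!: compact_Times)
  then obtain z0 where z0: "z0 \<in> K" "\<And>z. z \<in> K \<Longrightarrow> G z0 \<le> G z"
    using continuous_attains_inf[of K G, OF _ _ cf(2)] by blast
  define K' where "K' = {z \<in> K. G z = G z0}"
  have "compact K'"
  proof -
    have "K' = K \<inter> G -` {G z0}" by (auto simp: K'_def)
    moreover have "closed (G -` {G z0})"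
      by (intro continuous_closed_vimage) (use cf(2)[of UNIV] in \<open>auto simp: continuous_on_eq_continuous_at\<close>)
    ultimately show ?thesis
      using \<open>compact K\<close> by (metis compact_Int_closed)
  qed
  moreover have "z0 \<in> K'" using z0(1) by (simp add: K'_def)
  then have "K' \<noteq> {}" by blast
  ultimately obtain z1 where z1: "z1 \<in> K'" "\<And>z. z \<in> K' \<Longrightarrow> f z1 \<le> f z"
    using continuous_attains_inf[of K' f, OF _ _ cf(1)] by blast
  have min: "G z1 \<le> G z" if "z \<in> K" for z
    using z0(2)[OF that] z1(1) by (simp add: K'_def)
  obtain y t where yt: "z1 = (y, t)" by force
  have y: "y \<in> closed_segment a b" and t: "0 \<le> t" "t \<le> \<rho>"
    using z1(1) by (auto simp: K'_def K_def yt)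
  have "(x, s) \<in> K" using x s by (simp add: K_def)
  then have "G z1 < \<alpha> * \<rho>"
    using min[of "(x, s)"] s(3) by (simp add: G_def f_def algebra_simps)
  then have lt: "norm (y - t *\<^sub>R u) < \<alpha> * (\<rho> - t)"
    by (simp add: G_def f_def yt algebra_simps)
  \<comment> \<open>Here and below the hypotheses exclude all faces of the domain:
    \<open>ends\<close> the endpoints of the edge, \<open>foot\<close> the value
    \<open>t = 0\<close>, the sign of the norm \<open>t = \<rho>\<close>, and \<open>hit\<close> the
    points where \<open>f\<close> vanishes. So \<open>z1\<close> can be moved both ways in every
    direction.\<close>
  then have "t < \<rho>"
    using \<alpha> norm_ge_zero[of "y - t *\<^sub>R u"] zero_less_mult_pos[OF _ \<alpha>, of "\<rho> - t"] by linarith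
  have "y \<noteq> a" "y \<noteq> b"
    using ends lt t by (auto simp: clear_def not_le[symmetric])
  have "t \<noteq> 0" using foot[OF y] lt by auto
  then have "0 < t" using t by simp
  have "y \<noteq> t *\<^sub>R u"
    using hit[of t] y t \<open>t < \<rho>\<close> by auto
  then have f1: "f z1 > 0" by (simp add: f_def yt)
  define w where "w = b - a"
  obtain l where l: "0 < l" "l < 1" "y = a + l *\<^sub>R w"
  proof -
    obtain l where "0 \<le> l" "l \<le> 1" "y = (1 - l) *\<^sub>R a + l *\<^sub>R b"
      using y by (auto simp: in_segment)
    moreover from this have "l \<noteq> 0" "l \<noteq> 1" using \<open>y \<noteq> a\<close> \<open>y \<noteq> b\<close> by auto
    ultimately show thesis by (intro that[of l]) (auto simp: w_def algebra_simps)
  qed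
  have inK: "(y + (e * p) *\<^sub>R w, t + e * q) \<in> K"
    if "0 \<le> l + e * p \<and> l + e * p \<le> 1" "0 \<le> t + e * q \<and> t + e * q \<le> \<rho>" for e p q
  proof -
    have "y + (e * p) *\<^sub>R w = (1 - (l + e * p)) *\<^sub>R a + (l + e * p) *\<^sub>R b"
      by (simp add: l w_def algebra_simps)
    then show ?thesis using that unfolding K_def in_segment mem_Times_iff by (auto intro!: exI[of _ "l + e * p"])
  qed
  have moves: "\<exists>e0>0. \<forall>e. \<bar>e\<bar> \<le> e0 \<longrightarrow> (y + (e * p) *\<^sub>R w, t + e * q) \<in> K" for p q
  proof -
    obtain e1 where e1: "e1 > 0" "\<And>e. \<bar>e\<bar> \<le> e1 \<Longrightarrow> 0 \<le> l + e * p \<and> l + e * p \<le> 1"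
      using small_perturbation[OF l(1,2)] by blast
    obtain e2 where e2: "e2 > 0" "\<And>e. \<bar>e\<bar> \<le> e2 \<Longrightarrow> 0 \<le> t + e * q \<and> t + e * q \<le> \<rho>"
      using small_perturbation[OF \<open>0 < t\<close> \<open>t < \<rho>\<close>] by blast
    show ?thesis
      using e1 e2 inK by (intro exI[of _ "min e1 e2"]) auto
  qed
  show False
  proof (cases "cross w u = 0")
    case True
    \<comment> \<open>The edge is parallel to the ray: sliding \<open>y\<close> and \<open>t\<close>
      back together keeps \<open>f\<close> and lowers \<open>\<alpha> * t\<close>.\<close>
    define c where "c = w \<bullet> u"
    have w: "w = c *\<^sub>R u"
      using cross_eq_0_imp_parallel[OF u True] by (simp add: c_def)
    have "a \<noteq> b" using \<open>y \<noteq> a\<close> y by auto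
    then have c: "c \<noteq> 0" using w by (auto simp: w_def)
    obtain e where e: "e > 0" "\<forall>e'. \<bar>e'\<bar> \<le> e \<longrightarrow> (y + (e' * (1 / c)) *\<^sub>R w, t + e' * 1) \<in> K"
      using moves[of "1 / c" 1] by auto
    then have "(y - e *\<^sub>R u, t - e) \<in> K"
      using spec[OF e(2), of "- e"] c by (simp add: w)
    from min[OF this] show False
      using mult_pos_pos[OF \<alpha> e(1)] by (simp add: G_def f_def yt algebra_simps)
  next
    case False
    define z where "z = y - t *\<^sub>R u"
    \<comment> \<open>\<open>p\<close> and \<open>q\<close> are the coordinates of \<open>z\<close>
      in the basis \<open>w\<close>, \<open>u\<close>. Moving \<open>y\<close> along
      \<open>- p\<close> times \<open>w\<close> while \<open>t\<close> moves at speed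
      \<open>q\<close> scales \<open>z\<close> itself.\<close>
    define p where "p = cross z u / cross w u"
    define q where "q = (z - p *\<^sub>R w) \<bullet> u"
    have "cross (z - p *\<^sub>R w) u = cross z u - p * cross w u"
      by (simp add: cross_def algebra_simps)
    also have "\<dots> = 0" using False by (simp add: p_def)
    finally have zpq: "z = p *\<^sub>R w + q *\<^sub>R u"
      using cross_eq_0_imp_parallel[OF u, of "z - p *\<^sub>R w"] by (simp add: q_def algebra_simps)
    obtain e where e: "e > 0" "\<forall>e'. \<bar>e'\<bar> \<le> e \<longrightarrow> (y + (e' * - p) *\<^sub>R w, t + e' * q) \<in> K"
      using moves[of "- p" q] by auto
    define d where "d = min e (1/2)"
    have d: "0 < d" "d \<le> e" "d \<le> 1 / 2" using e(1) by (auto simp: d_def)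
    have fz: "f (y + (e' * - p) *\<^sub>R w, t + e' * q) = (1 - e') * norm z" if "\<bar>e'\<bar> \<le> 1/2" for e'
    proof -
      have "y + (e' * - p) *\<^sub>R w - (t + e' * q) *\<^sub>R u = z - e' *\<^sub>R (p *\<^sub>R w + q *\<^sub>R u)"
        by (simp add: z_def algebra_simps)
      also have "\<dots> = (1 - e') *\<^sub>R z" unfolding zpq[symmetric] by (simp add: algebra_simps)
      finally show ?thesis using that by (simp add: f_def abs_le_iff)
    qed
    have f1z: "f z1 = norm z" by (simp add: f_def yt z_def)
    have Gz: "G (y + (e' * - p) *\<^sub>R w, t + e' * q) = G z1 + e' * (\<alpha> * q - norm z)" if "\<bar>e'\<bar> \<le> 1/2" for e'
      using fz[OF that] f1z by (simp add: G_def yt algebra_simps)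
    have inKd: "(y + (d * - p) *\<^sub>R w, t + d * q) \<in> K" "(y + (- d * - p) *\<^sub>R w, t + - d * q) \<in> K"
      using spec[OF e(2), of d] spec[OF e(2), of "- d"] d by auto
    have "0 \<le> d * (\<alpha> * q - norm z)" "0 \<le> - d * (\<alpha> * q - norm z)"
      using min[OF inKd(1)] min[OF inKd(2)] Gz[of d] Gz[of "- d"] d by auto
    \<comment> \<open>An affine function with a minimum inside has slope 0. So the moved point is
      still a minimizer of \<open>G\<close>, but \<open>f\<close> has shrunk by the factor
      \<open>1 - d\<close>.\<close>
    then have "\<alpha> * q - norm z = 0"
      using d(1) by (simp add: zero_le_mult_iff mult_le_0_iff)
    then have "(y + (d * - p) *\<^sub>R w, t + d * q) \<in> K'"
      using inKd(1) Gz[of d] d z1(1) by (simp add: K'_def)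
    then have "norm z \<le> (1 - d) * norm z"
      using z1(2) fz[of d] f1z d by fastforce
    then show False
      using f1 f1z d(1) by (simp add: algebra_simps mult_le_0_iff)
  qed
qed

text \<open>Cauchy-Schwarz with the unit vector
  \<open>(\<alpha>, sqrt (1 - \<alpha>\<^sup>2))\<close>; the defect is an explicit square.\<close>

lemma inner_sqrt_bound:
  fixes \<alpha> x h :: real
  assumes "0 \<le> \<alpha>" "\<alpha> \<le> 1"
  shows "\<alpha> * x + sqrt (1 - \<alpha>\<^sup>2) * h \<le> sqrt (x\<^sup>2 + h\<^sup>2)"
proof (rule real_le_rsqrt)
  have "\<alpha>\<^sup>2 \<le> 1" using assms by (simp add: power_le_one)
  then have b: "(sqrt (1 - \<alpha>\<^sup>2))\<^sup>2 = 1 - \<alpha>\<^sup>2" by simp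
  have "x\<^sup>2 + h\<^sup>2 - (\<alpha> * x + sqrt (1 - \<alpha>\<^sup>2) * h)\<^sup>2 = (sqrt (1 - \<alpha>\<^sup>2) * x - \<alpha> * h)\<^sup>2"
    using b by (simp add: power2_eq_square algebra_simps)
  moreover have "0 \<le> (sqrt (1 - \<alpha>\<^sup>2) * x - \<alpha> * h)\<^sup>2" by simp
  ultimately show "(\<alpha> * x + sqrt (1 - \<alpha>\<^sup>2) * h)\<^sup>2 \<le> x\<^sup>2 + h\<^sup>2"
    by linarith
qed

text \<open>In coordinates along and across \<open>u\<close>, the convex function
  \<open>\<alpha> * s + norm (v - s *\<^sub>R u)\<close> is smallest at
  \<open>s = c - h * \<alpha> / \<beta>\<close>, with value
  \<open>\<alpha> * c + \<beta> * h\<close>. The guard \<open>\<alpha> * h \<le> \<beta> * c\<close>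
  says that this \<open>s\<close> is not negative; if it fails, the minimum over
  \<open>s \<ge> 0\<close> is the value \<open>norm v\<close> at 0. For \<open>\<beta> = 0\<close>
  that guard only says \<open>h = 0\<close>, and the other one rules out points behind the
  origin.\<close>

lemma clear_point_iff:
  fixes v :: complex
  assumes u: "norm u = 1" and \<alpha>: "0 < \<alpha>" "\<alpha> \<le> 1" and \<rho>: "0 \<le> \<rho>"
  defines "\<beta> \<equiv> sqrt (1 - \<alpha>\<^sup>2)"
  defines "c \<equiv> v \<bullet> u" and "h \<equiv> \<bar>cross v u\<bar>"
  shows "clear \<alpha> \<rho> u v \<longleftrightarrow> \<alpha> * \<rho> \<le> norm v \<and>
    (0 \<le> \<alpha> * c + \<beta> * h \<and> \<alpha> * h \<le> \<beta> * c \<longrightarrow> \<alpha> * \<rho> \<le> \<alpha> * c + \<beta> * h)"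
    (is "_ \<longleftrightarrow> ?d \<and> (?act \<longrightarrow> ?w)")
proof -
  have a1: "\<alpha>\<^sup>2 \<le> 1" using \<alpha> by (simp add: power_le_one)
  have b: "\<beta>\<^sup>2 = 1 - \<alpha>\<^sup>2" "0 \<le> \<beta>" using a1 by (simp_all add: \<beta>_def)
  have h: "0 \<le> h" by (simp add: h_def)
  have nv: "(norm v)\<^sup>2 = c\<^sup>2 + h\<^sup>2"
    using norm_sq_inner_cross[OF u, of v] by (simp add: c_def h_def)
  have nvs: "norm (v - s *\<^sub>R u) = sqrt ((c - s)\<^sup>2 + h\<^sup>2)" for s
  proof -
    have "(v - s *\<^sub>R u) \<bullet> u = c - s" "cross (v - s *\<^sub>R u) u = cross v u"
      using u by (simp_all add: c_def inner_diff_left dot_square_norm cross_def algebra_simps)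
    then have "(norm (v - s *\<^sub>R u))\<^sup>2 = (c - s)\<^sup>2 + h\<^sup>2"
      using norm_sq_inner_cross[OF u, of "v - s *\<^sub>R u"] by (simp add: h_def)
    then show ?thesis by (metis norm_ge_zero real_sqrt_unique)
  qed
  show ?thesis
  proof (intro iffI conjI impI)
    assume C: "clear \<alpha> \<rho> u v"
    show "\<alpha> * \<rho> \<le> norm v"
      using C \<rho> unfolding clear_def by (metis diff_zero order_refl scaleR_zero_left)
    assume act: ?act
    have c0: "0 \<le> c"
    proof (cases "\<alpha> = 1")
      case True
      then show ?thesis using act h by (auto simp: \<beta>_def)
    next
      case False
      then have "\<alpha>\<^sup>2 < 1" using \<alpha> by (simp add: power_less_one_iff)
      then have "\<beta> > 0" by (simp add: \<beta>_def)
      moreover have "0 \<le> \<beta> * c" using act h \<alpha> by (meson mult_nonneg_nonneg less_imp_le order_trans)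
      ultimately show ?thesis by (simp add: zero_le_mult_iff)
    qed
    define s where "s = c - h * \<alpha> / \<beta>"
    have s: "0 \<le> s" "\<alpha> * s \<le> \<alpha> * c" "\<alpha> * \<rho> \<le> \<alpha> * s + norm (v - s *\<^sub>R u) \<Longrightarrow> ?w"
    proof -
      show "0 \<le> s" using act c0 b(2) by (cases "\<beta> = 0") (auto simp: s_def field_simps)
      show "\<alpha> * s \<le> \<alpha> * c" using h b(2) \<alpha> by (simp add: s_def)
      assume "\<alpha> * \<rho> \<le> \<alpha> * s + norm (v - s *\<^sub>R u)"
      also have "\<alpha> * s + norm (v - s *\<^sub>R u) = \<alpha> * c + \<beta> * h"
      proof (cases "\<beta> = 0")
        case True
        then have "h = 0" using act \<alpha> h by (simp add: mult_le_0_iff)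
        then show ?thesis by (simp add: nvs s_def)
      next
        case False
        have "(c - s)\<^sup>2 + h\<^sup>2 = (h / \<beta>)\<^sup>2 * (\<alpha>\<^sup>2 + \<beta>\<^sup>2)"
          using False by (simp add: s_def field_simps power2_eq_square)
        also have "\<dots> = (h / \<beta>)\<^sup>2" using b by simp
        finally have "norm (v - s *\<^sub>R u) = h / \<beta>"
          using h b by (simp add: nvs)
        moreover have "h / \<beta> - \<alpha> * (h * \<alpha> / \<beta>) = \<beta> * h"
        proof -
          have "h / \<beta> - \<alpha> * (h * \<alpha> / \<beta>) = h * (1 - \<alpha>\<^sup>2) / \<beta>"
            using False by (simp add: field_simps power2_eq_square)
          also have "\<dots> = \<beta> * h" unfolding b(1)[symmetric] using False by (simp add: power2_eq_square)
          finally show ?thesis .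
        qed
        ultimately show ?thesis by (simp add: s_def algebra_simps)
      qed
      finally show ?w .
    qed
    show ?w
    proof (cases "s \<le> \<rho>")
      case True
      then have "\<alpha> * (\<rho> - s) \<le> norm (v - s *\<^sub>R u)"
        using C s(1) by (auto simp: clear_def)
      then show ?thesis using s(3) by (simp add: algebra_simps)
    next
      case False
      \<comment> \<open>The minimizer lies beyond \<open>\<rho>\<close>; then
        \<open>\<rho> \<le> s \<le> c\<close> already gives the bound.\<close>
      then have "\<alpha> * \<rho> \<le> \<alpha> * s" using \<alpha> by simp
      then show ?thesis using s(2) mult_nonneg_nonneg[OF b(2) h] by linarith
    qed
  next
    assume R: "?d \<and> (?act \<longrightarrow> ?w)"
    show "clear \<alpha> \<rho> u v"
      unfolding clear_def
    proof (intro allI impI)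
      fix s assume s: "0 \<le> s \<and> s \<le> \<rho>"
      show "\<alpha> * (\<rho> - s) \<le> norm (v - s *\<^sub>R u)"
      proof (cases ?act)
        case True
        have "\<alpha> * (c - s) + \<beta> * h \<le> norm (v - s *\<^sub>R u)"
          unfolding nvs \<beta>_def using \<alpha> by (intro inner_sqrt_bound) auto
        then show ?thesis using R True by (simp add: algebra_simps)
      next
        case False
        \<comment> \<open>This says that the slope of
          \<open>\<alpha> * s + norm (v - s *\<^sub>R u)\<close> at \<open>s = 0\<close> is not
          negative, so the value at 0 is the minimum.\<close>
        have c: "c \<le> \<alpha> * norm v"
        proof (cases "c \<le> 0")
          case True
          then show ?thesis using \<alpha> mult_nonneg_nonneg[of \<alpha> "norm v"] norm_ge_zero[of v] by linarith
        next
          case c: False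
          then have "0 \<le> \<alpha> * c + \<beta> * h" using \<alpha> b h by simp
          then have "\<beta> * c < \<alpha> * h" using False by auto
          then have "(\<beta> * c)\<^sup>2 \<le> (\<alpha> * h)\<^sup>2"
            using c b by (intro power_mono) auto
          then have "c\<^sup>2 \<le> (\<alpha> * norm v)\<^sup>2"
            by (simp add: power_mult_distrib b nv algebra_simps)
          then show ?thesis by (rule power2_le_imp_le) (use \<alpha> in simp)
        qed
        have "norm v - \<alpha> * s \<le> norm (v - s *\<^sub>R u)"
        proof (rule ccontr)
          assume "\<not> ?thesis"
          then have "(norm (v - s *\<^sub>R u))\<^sup>2 < (norm v - \<alpha> * s)\<^sup>2"
            by (intro power_strict_mono) auto
          moreover have "(norm (v - s *\<^sub>R u))\<^sup>2 = (norm v)\<^sup>2 - 2 * s * c + s\<^sup>2"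
          proof -
            have "(norm (v - s *\<^sub>R u))\<^sup>2 = (c - s)\<^sup>2 + h\<^sup>2" by (simp add: nvs)
            also have "\<dots> = (norm v)\<^sup>2 - 2 * s * c + s\<^sup>2"
              unfolding nv by (simp add: power2_eq_square algebra_simps)
            finally show ?thesis .
          qed
          ultimately have "- 2 * s * c + s\<^sup>2 < - 2 * s * (\<alpha> * norm v) + \<alpha>\<^sup>2 * s\<^sup>2"
            by (simp add: power2_eq_square algebra_simps)
          moreover have "s * c \<le> s * (\<alpha> * norm v)" using c s by (intro mult_left_mono) auto
          moreover have "\<alpha>\<^sup>2 * s\<^sup>2 \<le> 1 * s\<^sup>2" using a1 by (intro mult_right_mono) auto
          ultimately show False by linarith
        qed
        then show ?thesis using R by (simp add: algebra_simps)
      qed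
    qed
  qed
qed

text \<open>A constraint is the bound \<open>numer c u / denom c u\<close> on the distance from the origin in
  direction \<open>u\<close>; it is imposed only in the directions in which the constraint is active. Its
  graph is a circle about the origin, a circle through the origin, or a line.\<close>

datatype con = Con (n0: real) (nv: complex) (m0: real) (mv: complex) (d1: complex) (d2: complex)

definition numer :: "con \<Rightarrow> complex \<Rightarrow> real" where
  "numer c u = n0 c + nv c \<bullet> u"

definition denom :: "con \<Rightarrow> complex \<Rightarrow> real" where
  "denom c u = m0 c + mv c \<bullet> u"

definition active :: "con \<Rightarrow> complex \<Rightarrow> bool" where
  "active c u \<longleftrightarrow> 0 \<le> d1 c \<bullet> u \<and> 0 \<le> d2 c \<bullet> u \<and> 0 \<le> numer c u \<and> 0 < denom c u"

definition radius :: "con \<Rightarrow> complex \<Rightarrow> real" where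
  "radius c u = numer c u / denom c u"

definition bounded_by :: "con set \<Rightarrow> real \<Rightarrow> complex \<Rightarrow> bool" where
  "bounded_by C \<rho> u \<longleftrightarrow> (\<forall>c\<in>C. active c u \<longrightarrow> \<rho> \<le> radius c u)"

text \<open>The position of the point of the edge from \<open>a\<close> to \<open>a + w\<close> that is closest to the origin.\<close>

definition foot_pos :: "complex \<Rightarrow> complex \<Rightarrow> real" where
  "foot_pos a w = max 0 (min 1 (- (a \<bullet> w) / (w \<bullet> w)))"

definition foot_con :: "real \<Rightarrow> complex \<Rightarrow> complex \<Rightarrow> con" where
  "foot_con \<alpha> a w = Con (norm (a + foot_pos a w *\<^sub>R w) / \<alpha>) 0 1 0 0 0"

text \<open>The hull of the point at distance \<open>\<rho>\<close> in direction \<open>u\<close> avoids the vertex \<open>a\<close> iff \<open>\<rho>\<close> is at most the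
  minimum of \<open>s + norm (a - s *\<^sub>R u) / \<alpha>\<close> over \<open>s \<ge> 0\<close>. When the minimum is attained at some \<open>s > 0\<close>,
  it equals \<open>a \<bullet> u + k * \<bar>cross a u\<bar>\<close> with \<open>k = sqrt (1 - \<alpha>\<^sup>2) / \<alpha>\<close>; the two signs of the cross product give
  two circles through the origin and \<open>a\<close>.\<close>

definition vertex_con :: "real \<Rightarrow> real \<Rightarrow> complex \<Rightarrow> con" where
  "vertex_con \<sigma> k a = Con 0 (a + (\<sigma> * k) *\<^sub>R (\<i> * a)) 1 0
     (\<sigma> *\<^sub>R (\<i> * a)) (k *\<^sub>R a - \<sigma> *\<^sub>R (\<i> * a))"

text \<open>The line through \<open>a\<close> and \<open>b\<close> is written as
  \<open>n \<bullet> x = 1\<close>, so that \<open>1 / (n \<bullet> u)\<close> is the distance to it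
  along \<open>u\<close>. The factor \<open>cross a b\<close> makes the two guards describe the
  wedge between \<open>a\<close> and \<open>b\<close> for either orientation.\<close>

definition line_con :: "complex \<Rightarrow> complex \<Rightarrow> con" where
  "line_con a b = Con 1 0 0 (- (1 / cross a b) *\<^sub>R (\<i> * (b - a)))
     (cross a b *\<^sub>R (\<i> * a)) (- cross a b *\<^sub>R (\<i> * b))"

text \<open>Only the start of the edge gets vertex constraints: the end is the start of the next
  edge on the closed curve.\<close>

definition edge_cons :: "real \<Rightarrow> complex \<Rightarrow> complex \<Rightarrow> con list" where
  "edge_cons \<alpha> a b =
     (let k = sqrt (1 - \<alpha>\<^sup>2) / \<alpha> in
      [foot_con \<alpha> a (b - a), vertex_con 1 k a, vertex_con (- 1) k a, line_con a b])"

section \<open>Equivalence of clearance and the constraints of an edge\<close>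

lemmas con_simps = numer_def denom_def active_def radius_def

lemma inner_i_mult: "(\<i> * a) \<bullet> u = cross a u"
  by (simp add: inner_complex_def cross_def)

lemma cross_simps [simp]:
  "cross (x + y) u = cross x u + cross y u" "cross u (x + y) = cross u x + cross u y"
  "cross (x - y) u = cross x u - cross y u" "cross u (x - y) = cross u x - cross u y"
  "cross (r *\<^sub>R x) u = r * cross x u" "cross u (r *\<^sub>R x) = r * cross u x"
  "cross x x = 0" "cross 0 u = 0" "cross u 0 = 0"
  by (simp_all add: cross_def algebra_simps)

lemma cross_commute: "cross x y = - cross y x"
  by (simp add: cross_def)

text \<open>Clamping the foot of the perpendicular to the edge gives the variational inequality
  \<open>0 \<le> (m - l) * ((a + l *\<^sub>R w) \<bullet> w)\<close>; expanding the squared norm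
  then shows minimality.\<close>

lemma foot_closest:
  assumes "x \<in> closed_segment a b"
  shows "norm (a + foot_pos a (b - a) *\<^sub>R (b - a)) \<le> norm x"
proof -
  define w l where "w = b - a" and "l = foot_pos a w"
  obtain m where m: "0 \<le> m" "m \<le> 1" "x = a + m *\<^sub>R w"
    using assms by (auto simp: in_segment w_def algebra_simps)
  have "0 \<le> (m - l) * ((a + l *\<^sub>R w) \<bullet> w)"
  proof (cases "w = 0")
    case False
    then have w: "0 < w \<bullet> w" by simp
    define l0 where "l0 = - (a \<bullet> w) / (w \<bullet> w)"
    have aw: "(a + l *\<^sub>R w) \<bullet> w = (l - l0) * (w \<bullet> w)"
      using w by (simp add: l0_def inner_add_left field_simps)
    have "0 \<le> (m - l) * (l - l0)"
      using m unfolding l_def foot_pos_def l0_def[symmetric]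
      by (auto simp: min_def max_def zero_le_mult_iff)
    then have "0 \<le> (m - l) * (l - l0) * (w \<bullet> w)"
      by (rule mult_nonneg_nonneg[OF _ less_imp_le[OF w]])
    then show ?thesis unfolding aw by (simp only: mult.assoc)
  qed simp
  moreover have "(norm x)\<^sup>2 = (norm (a + l *\<^sub>R w))\<^sup>2 + 2 * ((m - l) * ((a + l *\<^sub>R w) \<bullet> w))
      + ((m - l) * norm w)\<^sup>2"
    unfolding m(3) power_mult_distrib power2_norm_eq_inner
    by (simp add: inner_add_left inner_add_right inner_commute power2_eq_square algebra_simps)
  ultimately have "(norm (a + l *\<^sub>R w))\<^sup>2 \<le> (norm x)\<^sup>2"
    using zero_le_power2[of "(m - l) * norm w"] by linarith
  then have "norm (a + l *\<^sub>R w) \<le> norm x"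
    by (rule power2_le_imp_le) simp
  then show ?thesis by (simp only: l_def w_def)
qed

lemma foot_in_segment: "a + foot_pos a (b - a) *\<^sub>R (b - a) \<in> closed_segment a b"
  by (auto simp: in_segment foot_pos_def algebra_simps intro!: exI[of _ "foot_pos a (b - a)"])

lemma bounded_by_foot_con:
  assumes "0 < \<alpha>"
  shows "bounded_by {foot_con \<alpha> a (b - a)} \<rho> u \<longleftrightarrow> (\<forall>x\<in>closed_segment a b. \<alpha> * \<rho> \<le> norm x)"
proof -
  have "bounded_by {foot_con \<alpha> a (b - a)} \<rho> u \<longleftrightarrow> \<alpha> * \<rho> \<le> norm (a + foot_pos a (b - a) *\<^sub>R (b - a))"
    using assms by (auto simp: bounded_by_def con_simps foot_con_def field_simps)
  then show ?thesis
    using foot_closest foot_in_segment order_trans by blast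
qed

text \<open>A constraint can be active only if its sign agrees with that of
  \<open>cross a u\<close>; together the two express the absolute value.\<close>

lemma bounded_by_vertex_con:
  assumes "norm u = 1" "0 < \<alpha>" "\<alpha> \<le> 1"
  defines "\<beta> \<equiv> sqrt (1 - \<alpha>\<^sup>2)"
  shows "bounded_by {vertex_con 1 (\<beta> / \<alpha>) a, vertex_con (- 1) (\<beta> / \<alpha>) a} \<rho> u \<longleftrightarrow>
    (0 \<le> \<alpha> * (a \<bullet> u) + \<beta> * \<bar>cross a u\<bar> \<and> \<alpha> * \<bar>cross a u\<bar> \<le> \<beta> * (a \<bullet> u) \<longrightarrow>
       \<alpha> * \<rho> \<le> \<alpha> * (a \<bullet> u) + \<beta> * \<bar>cross a u\<bar>)"
proof -
  define k where "k = \<beta> / \<alpha>"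
  have k: "\<alpha> * k = \<beta>" using assms(2) by (simp add: k_def)
  have pos: "0 \<le> x \<longleftrightarrow> 0 \<le> \<alpha> * x" "x \<le> y \<longleftrightarrow> \<alpha> * x \<le> \<alpha> * y" for x y
    using assms(2) by (simp_all add: zero_le_mult_iff)
  have 1: "active (vertex_con \<sigma> k a) u \<longleftrightarrow> 0 \<le> \<sigma> * cross a u \<and>
      \<alpha> * (\<sigma> * cross a u) \<le> \<beta> * (a \<bullet> u) \<and> 0 \<le> \<alpha> * (a \<bullet> u) + \<beta> * (\<sigma> * cross a u)" for \<sigma>
  proof -
    have "\<alpha> * (k * (a \<bullet> u) - \<sigma> * cross a u) = \<beta> * (a \<bullet> u) - \<alpha> * (\<sigma> * cross a u)"
      "\<alpha> * (a \<bullet> u + (\<sigma> * k) * cross a u) = \<alpha> * (a \<bullet> u) + \<beta> * (\<sigma> * cross a u)"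
      by (simp_all add: algebra_simps flip: k)
    then show ?thesis
      using pos(1)[of "k * (a \<bullet> u) - \<sigma> * cross a u"] pos(1)[of "a \<bullet> u + (\<sigma> * k) * cross a u"]
      by (simp add: con_simps vertex_con_def inner_add_left inner_diff_left inner_i_mult)
  qed
  have 2: "\<rho> \<le> radius (vertex_con \<sigma> k a) u \<longleftrightarrow>
      \<alpha> * \<rho> \<le> \<alpha> * (a \<bullet> u) + \<beta> * (\<sigma> * cross a u)" for \<sigma>
  proof -
    have "\<alpha> * (a \<bullet> u + (\<sigma> * k) * cross a u) = \<alpha> * (a \<bullet> u) + \<beta> * (\<sigma> * cross a u)"
      by (simp add: algebra_simps flip: k)
    then show ?thesis
      using pos(2)[of \<rho> "a \<bullet> u + (\<sigma> * k) * cross a u"]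
      by (simp add: con_simps vertex_con_def inner_add_left inner_i_mult)
  qed
  show ?thesis
    unfolding bounded_by_def k_def[symmetric] by (cases "0 \<le> cross a u") (auto simp: 1 2)
qed

lemma bounded_by_line_con:
  assumes u: "norm u = 1" and ab: "cross a b \<noteq> 0"
  shows "bounded_by {line_con a b} \<rho> u \<longleftrightarrow> (\<forall>s\<ge>0. s *\<^sub>R u \<in> closed_segment a b \<longrightarrow> \<rho> \<le> s)"
proof -
  define D where "D = cross a b"
  have D: "D \<noteq> 0" using ab by (simp add: D_def)
  define n where "n = (cross u b + cross a u) / D"
  have numer: "numer (line_con a b) u = 1" and denom: "denom (line_con a b) u = n"
    using D
    by (simp_all add: con_simps line_con_def inner_i_mult n_def D_def[symmetric] field_simps)
      (simp add: cross_def inner_complex_def algebra_simps)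
  have act: "active (line_con a b) u \<longleftrightarrow> 0 \<le> D * cross a u \<and> 0 \<le> D * cross u b \<and> 0 < n"
    by (simp add: active_def numer denom) (simp add: line_con_def inner_i_mult D_def[symmetric] cross_commute[of b])
  show ?thesis
  proof (cases "active (line_con a b) u")
    case True
    then have n: "0 < n" and s: "0 \<le> cross a u / D" "0 \<le> cross u b / D"
      using D by (auto simp: act zero_le_mult_iff zero_le_divide_iff)
    have sum1: "(cross u b / D) / n + (cross a u / D) / n = 1"
    proof -
      have "n = cross u b / D + cross a u / D" by (simp add: n_def add_divide_distrib)
      then have "(cross u b / D) / n + (cross a u / D) / n = n / n"
        by (simp only: add_divide_distrib[symmetric])
      also have "\<dots> = 1" using n by simp
      finally show ?thesis .
    qed
    have eq: "s *\<^sub>R u = (1 - t) *\<^sub>R a + t *\<^sub>R b"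
      if "s = 1 / n" "t = (cross a u / D) / n" for s t
    proof -
      have nt: "1 - t = (cross u b / D) / n"
        using sum1 unfolding that by linarith
      have "u = (1 / D) *\<^sub>R (D *\<^sub>R u)" using D by simp
      \<comment> \<open>Cramer's rule in the basis \<open>a\<close>, \<open>b\<close>.\<close>
      also have "D *\<^sub>R u = cross u b *\<^sub>R a + cross a u *\<^sub>R b"
        by (simp add: D_def cross_def complex_eq_iff algebra_simps)
      finally have "s *\<^sub>R u = s *\<^sub>R ((1 / D) *\<^sub>R (cross u b *\<^sub>R a + cross a u *\<^sub>R b))"
        by (rule arg_cong)
      then show ?thesis
        unfolding nt by (simp add: that scaleR_add_right mult.commute)
    qed
    have "(1 / n) *\<^sub>R u \<in> closed_segment a b"
      unfolding in_segment
    proof (intro exI conjI)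
      let ?t = "(cross a u / D) / n"
      show "(1 / n) *\<^sub>R u = (1 - ?t) *\<^sub>R a + ?t *\<^sub>R b" by (rule eq[OF refl refl])
      show "0 \<le> ?t" using s(1) n by (rule divide_nonneg_pos)
      show "?t \<le> 1" using divide_nonneg_pos[OF s(2) n] sum1 by linarith
    qed
    moreover have "s = 1 / n" if s: "s *\<^sub>R u \<in> closed_segment a b" for s
    proof -
      obtain t where t: "s *\<^sub>R u = (1 - t) *\<^sub>R a + t *\<^sub>R b"
        using s by (auto simp: in_segment)
      \<comment> \<open>This linear equation holds at every point of the line through
        \<open>a\<close> and \<open>b\<close>; it determines \<open>s\<close>.\<close>
      have "cross (s *\<^sub>R u) b + cross a (s *\<^sub>R u) = D"
        unfolding t by (simp add: D_def algebra_simps)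
      then have "s * n = 1" using D by (simp add: n_def field_simps)
      then show ?thesis using n by (simp add: field_simps)
    qed
    moreover have "bounded_by {line_con a b} \<rho> u \<longleftrightarrow> \<rho> \<le> 1 / n"
      using True by (simp add: bounded_by_def radius_def numer denom)
    moreover have "0 \<le> 1 / n" using n by simp
    ultimately show ?thesis by metis
  next
    case False
    have False if s: "0 \<le> s" "s *\<^sub>R u \<in> closed_segment a b" for s
    proof -
      obtain t where t: "0 \<le> t" "t \<le> 1" "s *\<^sub>R u = (1 - t) *\<^sub>R a + t *\<^sub>R b"
        using s(2) by (auto simp: in_segment)
      have "cross (s *\<^sub>R u) b = (1 - t) * D" "cross a (s *\<^sub>R u) = t * D"
        unfolding t(3) by (simp_all add: D_def)
      then have c: "s * cross u b = (1 - t) * D" "s * cross a u = t * D" by simp_all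
      then have "s \<noteq> 0" using D by auto
      then have "0 < s" using s by simp
      have "s * n = 1" using c D by (simp add: n_def field_simps)
      then have "0 < n" using \<open>0 < s\<close> by (metis zero_less_mult_pos zero_less_one)
      moreover have "0 \<le> D * cross a u" "0 \<le> D * cross u b"
      proof -
        have "s * (D * cross a u) = t * D\<^sup>2" "s * (D * cross u b) = (1 - t) * D\<^sup>2"
          using c by algebra+
        moreover have "0 \<le> t * D\<^sup>2" "0 \<le> (1 - t) * D\<^sup>2"
          using t by simp_all
        ultimately have "0 \<le> s * (D * cross a u)" "0 \<le> s * (D * cross u b)"
          by simp_all
        then show "0 \<le> D * cross a u" "0 \<le> D * cross u b"
          using \<open>0 < s\<close> by (auto simp: zero_le_mult_iff)
      qed
      ultimately show False using False act by blast
    qed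
    then show ?thesis using False by (auto simp: bounded_by_def)
  qed
qed

text \<open>If the line through an edge contains the origin, then division by zero makes the constraint
  inactive. Nothing is lost: the first point of the edge on a ray is one of its endpoints.\<close>

lemma line_con_degenerate: "cross a b = 0 \<Longrightarrow> bounded_by {line_con a b} \<rho> u"
  by (simp add: bounded_by_def con_simps line_con_def)

lemma degenerate_hit:
  assumes u: "norm u = 1" and ab: "cross a b = 0" and 0: "0 \<notin> closed_segment a b"
    and clear: "clear \<alpha> \<rho> u a" "clear \<alpha> \<rho> u b" and \<alpha>: "0 < \<alpha>"
    and s: "0 \<le> s" "s *\<^sub>R u \<in> closed_segment a b"
  shows "\<rho> \<le> s"
proof -
  obtain t where t: "0 \<le> t" "t \<le> 1" "s *\<^sub>R u = (1 - t) *\<^sub>R a + t *\<^sub>R b"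
    using s(2) by (auto simp: in_segment)
  have "s \<noteq> 0" using s(2) 0 by auto
  then have s0: "0 < s" using s by simp
  have "cross a (s *\<^sub>R u) = 0" "cross b (s *\<^sub>R u) = 0"
    unfolding t(3) using ab by (simp_all add: cross_commute[of b])
  then have "cross a u = 0" "cross b u = 0" using s0 by simp_all
  then obtain p q where pq: "a = p *\<^sub>R u" "b = q *\<^sub>R u"
    using cross_eq_0_imp_parallel[OF u] by blast
  have "u \<noteq> 0" using u by auto
  then have st: "s = (1 - t) * p + t * q"
    using t(3) by (simp add: pq flip: scaleR_add_left)
  \<comment> \<open>At the point with parameter \<open>s = r\<close> the disk is centred at the
    obstacle itself, so its radius \<open>\<alpha> * (\<rho> - r)\<close> cannot be
    positive.\<close>
  have le: "\<rho> \<le> r" if "clear \<alpha> \<rho> u (r *\<^sub>R u)" "0 \<le> r" for r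
  proof (rule ccontr)
    assume "\<not> \<rho> \<le> r"
    then have "\<alpha> * (\<rho> - r) \<le> 0" using that by (auto simp: clear_def)
    then show False using \<alpha> \<open>\<not> \<rho> \<le> r\<close> by (simp add: mult_le_0_iff)
  qed
  have seg: "x *\<^sub>R u \<in> closed_segment a b" if x: "x \<in> closed_segment p q" for x
  proof -
    obtain t where t: "0 \<le> t" "t \<le> 1" "x = (1 - t) * p + t * q"
      using x unfolding in_segment real_scaleR_def by blast
    then have "x *\<^sub>R u = (1 - t) *\<^sub>R a + t *\<^sub>R b"
      by (simp add: pq flip: scaleR_add_left)
    then show ?thesis using t(1,2) unfolding in_segment by blast
  qed
  have "s \<in> closed_segment p q"
    using t st by (auto simp: in_segment)
  \<comment> \<open>The edge avoids the origin, so both endpoints lie on the same side of it as the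
    point that was hit.\<close>
  have pos: "0 < p" "0 < q"
  proof -
    have "0 \<notin> closed_segment p q" using seg[of 0] 0 by auto
    then show "0 < p" "0 < q"
      using \<open>s \<in> closed_segment p q\<close> s0 by (auto simp: closed_segment_eq_real_ivl split: if_splits)
  qed
  have "p \<le> s \<or> q \<le> s"
    using \<open>s \<in> closed_segment p q\<close> by (auto simp: closed_segment_eq_real_ivl split: if_splits)
  then show ?thesis
    using le[of p] le[of q] clear pos by (auto simp: pq)
qed

lemma clear_imp_bounded_by:
  assumes "norm u = 1" "0 < \<alpha>" "\<alpha> \<le> 1" "0 \<le> \<rho>"
    and cl: "\<And>x. x \<in> closed_segment a b \<Longrightarrow> clear \<alpha> \<rho> u x"
  shows "bounded_by (set (edge_cons \<alpha> a b)) \<rho> u"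
proof -
  have a: "clear \<alpha> \<rho> u a" using cl by simp
  have "bounded_by {foot_con \<alpha> a (b - a)} \<rho> u"
    unfolding bounded_by_foot_con[OF assms(2)]
  proof
    fix x assume "x \<in> closed_segment a b"
    from cl[OF this] show "\<alpha> * \<rho> \<le> norm x"
      using assms(4) unfolding clear_def by (metis diff_zero order_refl scaleR_zero_left)
  qed
  moreover have "bounded_by {line_con a b} \<rho> u"
  proof (cases "cross a b = 0")
    case False
    have "\<rho> \<le> s" if s: "s \<ge> 0" "s *\<^sub>R u \<in> closed_segment a b" for s
    proof (rule ccontr)
      assume n: "\<not> \<rho> \<le> s"
      then have "\<alpha> * (\<rho> - s) \<le> 0" using cl[OF s(2)] s(1) by (auto simp: clear_def)
      then show False using assms(2) n by (simp add: mult_le_0_iff)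
    qed
    then show ?thesis using bounded_by_line_con[OF assms(1) False] by blast
  qed (rule line_con_degenerate)
  moreover have "bounded_by {vertex_con 1 (sqrt (1 - \<alpha>\<^sup>2) / \<alpha>) a,
      vertex_con (- 1) (sqrt (1 - \<alpha>\<^sup>2) / \<alpha>) a} \<rho> u"
    using a clear_point_iff[OF assms(1-4), of a] bounded_by_vertex_con[OF assms(1-3), of a \<rho>] by blast
  ultimately show ?thesis
    by (auto simp: edge_cons_def Let_def bounded_by_def)
qed

lemma bounded_by_imp_clear_start:
  assumes "norm u = 1" "0 < \<alpha>" "\<alpha> \<le> 1" "0 \<le> \<rho>"
    and "bounded_by (set (edge_cons \<alpha> a b)) \<rho> u"
  shows "clear \<alpha> \<rho> u a"
proof -
  have "bounded_by {foot_con \<alpha> a (b - a)} \<rho> u"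
    and "bounded_by {vertex_con 1 (sqrt (1 - \<alpha>\<^sup>2) / \<alpha>) a,
      vertex_con (- 1) (sqrt (1 - \<alpha>\<^sup>2) / \<alpha>) a} \<rho> u"
    using assms(5) by (auto simp: edge_cons_def Let_def bounded_by_def)
  then show ?thesis
    using clear_point_iff[OF assms(1-4), of a] bounded_by_vertex_con[OF assms(1-3), of a \<rho>]
      bounded_by_foot_con[OF assms(2), of a b \<rho> u] by auto
qed

text \<open>Verifies the hypotheses of \<open>clear_edge\<close>. Clearance of \<open>b\<close> is
  assumed here, because it follows from the constraints of the edge that starts at
  \<open>b\<close>.\<close>

lemma bounded_by_imp_clear:
  assumes "norm u = 1" "0 < \<alpha>" "\<alpha> \<le> 1" "0 \<le> \<rho>" "0 \<notin> closed_segment a b"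
    and bd: "bounded_by (set (edge_cons \<alpha> a b)) \<rho> u"
    and b: "clear \<alpha> \<rho> u b" and x: "x \<in> closed_segment a b"
  shows "clear \<alpha> \<rho> u x"
proof (rule clear_edge[OF assms(1,2) _ _ b _ x])
  show a: "clear \<alpha> \<rho> u a" by (rule bounded_by_imp_clear_start[OF assms(1-4) bd])
  have foot: "bounded_by {foot_con \<alpha> a (b - a)} \<rho> u" and line: "bounded_by {line_con a b} \<rho> u"
    using bd by (auto simp: edge_cons_def Let_def bounded_by_def)
  show "\<alpha> * \<rho> \<le> norm x" if "x \<in> closed_segment a b" for x
    using foot that unfolding bounded_by_foot_con[OF assms(2)] by blast
  show "\<rho> \<le> s" if "0 \<le> s" "s *\<^sub>R u \<in> closed_segment a b" for s
    using degenerate_hit[OF assms(1) _ assms(5) a b assms(2) that]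
      line that unfolding bounded_by_line_con[OF assms(1)] by (cases "cross a b = 0") (auto simp: bounded_by_line_con[OF assms(1)])
qed

text \<open>The complement of \<open>S\<close> is connected, unbounded and disjoint from the
  frontier, so it is exactly the outside of the frontier. Only the image of the curve
  matters.\<close>

lemma closed_region_eq:
  fixes S :: "complex set"
  assumes S: "closed S" "bounded S" "connected (- S)" and \<gamma>: "path_image \<gamma> = frontier S"
  shows "closed_region \<gamma> = S"
proof -
  have "- S \<subseteq> outside (frontier S)"
  proof
    fix p assume p: "p \<in> - S"
    have sub: "- S \<subseteq> connected_component_set (- frontier S) p"
      using p S by (intro connected_component_maximal) (auto simp: frontier_def)
    have "\<not> bounded (- S)" using S(2) cobounded_imp_unbounded by fastforce
    then have "\<not> bounded (connected_component_set (- frontier S) p)"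
      using sub bounded_subset by blast
    then show "p \<in> outside (frontier S)"
      using p S(1) by (auto simp: outside_def frontier_def)
  qed
  moreover have "outside (frontier S) \<subseteq> - S"
    using outside_frontier_misses_closure[OF S(2)] closure_subset[of S] by blast
  ultimately have "outside (frontier S) = - S" by blast
  then show ?thesis
    unfolding closed_region_def \<gamma> union_with_inside by simp
qed

section \<open>The region around the origin: star-shaped, with a continuous radial function\<close>

locale robust_region =
  fixes es :: "(complex \<times> complex) list" and \<alpha> :: real
  assumes es_ne: "es \<noteq> []"
    and cyclic: "(a, b) \<in> set es \<Longrightarrow> \<exists>c. (b, c) \<in> set es"
    and alpha: "0 < \<alpha>" "\<alpha> \<le> 1"
    and origin: "(a, b) \<in> set es \<Longrightarrow> 0 \<notin> closed_segment a b"
begin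

definition E :: "complex set" where
  "E = (\<Union>(a, b)\<in>set es. closed_segment a b)"

definition V :: "complex set" where
  "V = {p. \<forall>x\<in>E. \<forall>y\<in>closed_segment 0 p. \<alpha> * norm (p - y) \<le> norm (x - y)}"

definition cons :: "con list" where
  "cons = concat (map (\<lambda>(a, b). edge_cons \<alpha> a b) es)"

lemma set_cons: "set cons = (\<Union>(a, b)\<in>set es. set (edge_cons \<alpha> a b))"
  by (auto simp: cons_def)

lemma in_V_iff_clear:
  assumes "norm u = 1" "0 \<le> \<rho>"
  shows "\<rho> *\<^sub>R u \<in> V \<longleftrightarrow> (\<forall>x\<in>E. clear \<alpha> \<rho> u x)"
proof -
  have "closed_segment 0 (\<rho> *\<^sub>R u) = (\<lambda>s. s *\<^sub>R u) ` {0..\<rho>}"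
  proof (intro set_eqI iffI)
    fix y assume "y \<in> closed_segment 0 (\<rho> *\<^sub>R u)"
    then obtain t where "0 \<le> t" "t \<le> 1" "y = (t * \<rho>) *\<^sub>R u" by (auto simp: in_segment)
    then show "y \<in> (\<lambda>s. s *\<^sub>R u) ` {0..\<rho>}"
      using assms(2) by (intro image_eqI[of _ _ "t * \<rho>"]) (auto intro: mult_left_le_one_le)
  next
    fix y assume "y \<in> (\<lambda>s. s *\<^sub>R u) ` {0..\<rho>}"
    then obtain s where s: "0 \<le> s" "s \<le> \<rho>" "y = s *\<^sub>R u" by auto
    then show "y \<in> closed_segment 0 (\<rho> *\<^sub>R u)"
      unfolding in_segment by (cases "\<rho> = 0") (auto intro!: exI[of _ "s / \<rho>"])
  qed
  moreover have "norm (\<rho> *\<^sub>R u - s *\<^sub>R u) = \<rho> - s" if "s \<le> \<rho>" for s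
    using that assms(1) by (simp flip: scaleR_diff_left)
  ultimately show ?thesis
    unfolding V_def clear_def by auto
qed

lemma in_V_iff:
  assumes "norm u = 1" "0 \<le> \<rho>"
  shows "\<rho> *\<^sub>R u \<in> V \<longleftrightarrow> bounded_by (set cons) \<rho> u"
  unfolding in_V_iff_clear[OF assms]
proof
  assume "\<forall>x\<in>E. clear \<alpha> \<rho> u x"
  then have "bounded_by (set (edge_cons \<alpha> a b)) \<rho> u" if "(a, b) \<in> set es" for a b
    using that by (intro clear_imp_bounded_by[OF assms(1) alpha assms(2)]) (auto simp: E_def)
  then show "bounded_by (set cons) \<rho> u"
    unfolding bounded_by_def set_cons by auto
next
  assume "bounded_by (set cons) \<rho> u"
  then have bd: "bounded_by (set (edge_cons \<alpha> a b)) \<rho> u" if "(a, b) \<in> set es" for a b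
    using that unfolding bounded_by_def set_cons by auto
  show "\<forall>x\<in>E. clear \<alpha> \<rho> u x"
  proof
    fix x assume "x \<in> E"
    then obtain a b where ab: "(a, b) \<in> set es" "x \<in> closed_segment a b" by (auto simp: E_def)
    obtain c where "(b, c) \<in> set es" using cyclic[OF ab(1)] ..
    then have "clear \<alpha> \<rho> u b"
      using bounded_by_imp_clear_start[OF assms(1) alpha assms(2) bd] by blast
    then show "clear \<alpha> \<rho> u x"
      using bounded_by_imp_clear[OF assms(1) alpha assms(2) origin[OF ab(1)] bd[OF ab(1)] _ ab(2)] by blast
  qed
qed

text \<open>On the way to \<open>q\<close>, the point \<open>t *\<^sub>R q\<close> is within
  \<open>t * (\<alpha> * (\<rho> - s))\<close> of \<open>(t * s) *\<^sub>R u\<close>. The triangle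
  inequality leaves the clearance \<open>\<alpha> * ((1 - t) * \<rho>)\<close>, which suffices
  because \<open>norm q \<le> \<rho>\<close>. This supplies the interior points that make
  \<open>R\<close> continuous.\<close>

lemma V_cone:
  assumes p: "\<rho> *\<^sub>R u \<in> V" and u: "norm u = 1" and s: "0 \<le> s" "s \<le> \<rho>"
    and q: "norm (q - s *\<^sub>R u) \<le> \<alpha> * (\<rho> - s)"
  shows "q \<in> V"
  unfolding V_def
proof (intro CollectI ballI)
  fix x y assume x: "x \<in> E" and "y \<in> closed_segment 0 q"
  then obtain t where t: "0 \<le> t" "t \<le> 1" "y = t *\<^sub>R q" by (auto simp: in_segment)
  have "norm q \<le> norm (s *\<^sub>R u) + norm (q - s *\<^sub>R u)"
    by (metis add_diff_cancel_left' diff_add_cancel norm_triangle_ineq)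
  also have "\<dots> \<le> s + 1 * (\<rho> - s)"
    using q u s alpha by (intro add_mono order_trans[OF q] mult_right_mono) auto
  finally have nq: "norm q \<le> \<rho>" by simp
  have "0 \<le> t * s" "t * s \<le> \<rho>"
    using t s mult_left_le_one_le[of s t] by auto
  then have "\<alpha> * (\<rho> - t * s) \<le> norm (x - (t * s) *\<^sub>R u)"
    using p x s in_V_iff_clear[OF u, of \<rho>] unfolding clear_def by auto
  also have "\<dots> \<le> norm (x - y) + norm (t *\<^sub>R (q - s *\<^sub>R u))"
  proof -
    have "x - (t * s) *\<^sub>R u = (x - y) + t *\<^sub>R (q - s *\<^sub>R u)"
      by (simp add: t(3) algebra_simps)
    then show ?thesis using norm_triangle_ineq by metis
  qed
  also have "norm (t *\<^sub>R (q - s *\<^sub>R u)) \<le> t * (\<alpha> * (\<rho> - s))"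
    using mult_left_mono[OF q t(1)] t by simp
  finally have "\<alpha> * ((1 - t) * \<rho>) \<le> norm (x - y)"
    by (simp add: algebra_simps)
  moreover have "norm (q - y) = (1 - t) * norm q"
    using t by (simp add: t(3) flip: scaleR_diff_left[of 1, simplified])
  moreover have "\<alpha> * ((1 - t) * norm q) \<le> \<alpha> * ((1 - t) * \<rho>)"
    using nq t alpha by (intro mult_left_mono) auto
  ultimately show "\<alpha> * norm (q - y) \<le> norm (x - y)" by simp
qed

lemma closed_V: "closed V"
proof -
  have "V = (\<Inter>x\<in>E. \<Inter>t\<in>{0..1}. {p. \<alpha> * norm (p - t *\<^sub>R p) \<le> norm (x - t *\<^sub>R p)})"
  proof -
    have "closed_segment 0 p = (\<lambda>t. t *\<^sub>R p) ` {0..1}" for p :: complex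
      by (force simp: in_segment)
    then show ?thesis unfolding V_def by auto
  qed
  also have "closed \<dots>"
    by (intro closed_INT ballI closed_Collect_le continuous_intros)
  finally show ?thesis .
qed

lemma E_ne: "E \<noteq> {}"
proof -
  obtain a b where "(a, b) \<in> set es" using es_ne by (cases es) auto
  then have "a \<in> E" by (force simp: E_def)
  then show ?thesis by blast
qed

lemma polar: obtains r \<theta> where "0 \<le> r" "p = r *\<^sub>R cis \<theta>"
  by (metis norm_ge_zero rcis_cmod_Arg rcis_def scaleR_conv_of_real)

text \<open>The minimum is over a nonempty set: the foot constraint of an edge is active in every
  direction.\<close>

definition R :: "real \<Rightarrow> real" where
  "R \<theta> = Min ((\<lambda>c. radius c (cis \<theta>)) ` {c \<in> set cons. active c (cis \<theta>)})"

lemma in_V_iff_R: "0 \<le> \<rho> \<Longrightarrow> \<rho> *\<^sub>R cis \<theta> \<in> V \<longleftrightarrow> \<rho> \<le> R \<theta>"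
proof -
  assume r: "0 \<le> \<rho>"
  obtain a b where ab: "(a, b) \<in> set es" using es_ne by (cases es) auto
  have "foot_con \<alpha> a (b - a) \<in> set cons" "active (foot_con \<alpha> a (b - a)) (cis \<theta>)"
    using ab alpha by (auto simp: set_cons edge_cons_def Let_def foot_con_def con_simps)
  then show ?thesis
    unfolding R_def in_V_iff[of "cis \<theta>", simplified, OF r] bounded_by_def
    by (subst Min_ge_iff) auto
qed

text \<open>The edges keep some distance \<open>d\<close> from the origin, and since
  \<open>\<alpha> \<le> 1\<close> the triangle inequality clears all points at distance
  \<open>d\<close>.\<close>

lemma R_pos: "0 < R \<theta>"
proof -
  have "closed E" "0 \<notin> E"
    using origin by (auto simp: E_def intro!: closed_UN)
  then obtain d where d: "0 < d" "\<And>x. x \<in> E \<Longrightarrow> d \<le> norm x"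
    using separate_point_closed[of E 0] by (auto simp: dist_norm norm_minus_commute)
  have "d *\<^sub>R cis \<theta> \<in> V"
    unfolding in_V_iff_clear[of "cis \<theta>", simplified, OF less_imp_le[OF d(1)]] clear_def
  proof (intro ballI allI impI)
    fix x s assume x: "x \<in> E" and s: "0 \<le> s \<and> s \<le> d"
    have "\<alpha> * (d - s) \<le> 1 * (d - s)"
      using alpha s by (intro mult_right_mono) auto
    also have "\<dots> \<le> norm x - norm (s *\<^sub>R cis \<theta>)"
      using d(2)[OF x] s by simp
    also have "\<dots> \<le> norm (x - s *\<^sub>R cis \<theta>)"
      by (rule norm_triangle_ineq2)
    finally show "\<alpha> * (d - s) \<le> norm (x - s *\<^sub>R cis \<theta>)" .
  qed
  then show ?thesis
    using d(1) in_V_iff_R[of d \<theta>] by simp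
qed

lemma bounded_V: "bounded V"
proof -
  obtain x where x: "x \<in> E" using E_ne by auto
  have "norm p \<le> norm x / \<alpha>" if "p \<in> V" for p
    using that x alpha unfolding V_def by (force simp: field_simps)
  then show ?thesis by (auto simp: bounded_iff)
qed

lemma interior_V:
  assumes "0 \<le> s" "s < R \<theta>"
  shows "s *\<^sub>R cis \<theta> \<in> interior V"
proof -
  have RV: "R \<theta> *\<^sub>R cis \<theta> \<in> V" using in_V_iff_R[of "R \<theta>" \<theta>] R_pos[of \<theta>] by simp
  have "ball (s *\<^sub>R cis \<theta>) (\<alpha> * (R \<theta> - s)) \<subseteq> V"
    using V_cone[OF RV _ assms(1)] assms by (auto simp: dist_norm norm_minus_commute)
  moreover have "0 < \<alpha> * (R \<theta> - s)" using alpha assms by simp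
  ultimately show ?thesis by (auto simp: mem_interior)
qed

text \<open>Points below the graph are interior to \<open>V\<close>, which gives lower
  semicontinuity; closedness of \<open>V\<close> gives upper semicontinuity.\<close>

lemma isCont_R: "isCont R \<theta>"
  unfolding isCont_def
proof (rule order_tendstoI)
  have cis: "((\<lambda>t. s *\<^sub>R cis t) \<longlongrightarrow> s *\<^sub>R cis \<theta>) (at \<theta>)" for s
    by (intro tendsto_intros)
  fix a assume a: "a < R \<theta>"
  \<comment> \<open>\<open>in_V_iff_R\<close> speaks of nonnegative radii only, hence
    \<open>max 0\<close>.\<close>
  define s where "s = max 0 ((a + R \<theta>) / 2)"
  have s: "0 \<le> s" "s < R \<theta>" "a < s" using a R_pos[of \<theta>] by (auto simp: s_def less_max_iff_disj)
  have "\<forall>\<^sub>F t in at \<theta>. s *\<^sub>R cis t \<in> interior V"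
    by (rule topological_tendstoD[OF cis open_interior interior_V]) (use s in auto)
  then show "\<forall>\<^sub>F t in at \<theta>. a < R t"
  proof (rule eventually_mono)
    fix t assume "s *\<^sub>R cis t \<in> interior V"
    then have "s *\<^sub>R cis t \<in> V" using interior_subset by auto
    then show "a < R t" using in_V_iff_R[OF s(1)] s(3) by force
  qed
next
  have cis: "((\<lambda>t. s *\<^sub>R cis t) \<longlongrightarrow> s *\<^sub>R cis \<theta>) (at \<theta>)" for s
    by (intro tendsto_intros)
  fix a assume a: "R \<theta> < a"
  then have a0: "0 \<le> a" using R_pos[of \<theta>] by simp
  have "open (- V)" "a *\<^sub>R cis \<theta> \<in> - V"
    using closed_V a in_V_iff_R[OF a0] by auto
  then have "\<forall>\<^sub>F t in at \<theta>. a *\<^sub>R cis t \<in> - V"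
    by (rule topological_tendstoD[OF cis])
  then show "\<forall>\<^sub>F t in at \<theta>. R t < a"
    by (rule eventually_mono) (use in_V_iff_R[OF a0] in auto)
qed

lemma R_periodic: "R (\<theta> + 2 * pi) = R \<theta>"
  by (simp add: R_def flip: cis_mult)

lemma frontier_V: "frontier V = range (\<lambda>\<theta>. R \<theta> *\<^sub>R cis \<theta>)"
proof (intro set_eqI iffI)
  fix p assume p: "p \<in> frontier V"
  obtain r \<theta> where r: "0 \<le> r" "p = r *\<^sub>R cis \<theta>" using polar .
  have "p \<in> V" "p \<notin> interior V" using p closed_V by (auto simp: frontier_def)
  then have "r = R \<theta>"
    using in_V_iff_R[OF r(1)] interior_V[OF r(1)] r(2) by force
  then show "p \<in> range (\<lambda>\<theta>. R \<theta> *\<^sub>R cis \<theta>)" using r by auto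
next
  fix p assume "p \<in> range (\<lambda>\<theta>. R \<theta> *\<^sub>R cis \<theta>)"
  then obtain \<theta> where p: "p = R \<theta> *\<^sub>R cis \<theta>" by auto
  have "p \<in> V" using in_V_iff_R[of "R \<theta>" \<theta>] R_pos[of \<theta>] p by simp
  moreover have "p \<notin> interior V"
  proof
    assume "p \<in> interior V"
    then obtain e where e: "e > 0" "ball p e \<subseteq> V" by (auto simp: mem_interior)
    have "(R \<theta> + e / 2) *\<^sub>R cis \<theta> \<in> ball p e"
      using e(1) by (simp add: p dist_norm flip: scaleR_diff_left)
    then have "(R \<theta> + e / 2) *\<^sub>R cis \<theta> \<in> V" using e(2) by blast
    then show False
      using in_V_iff_R[of "R \<theta> + e / 2" \<theta>] R_pos[of \<theta>] e(1) by simp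
  qed
  ultimately show "p \<in> frontier V" using closed_V by (simp add: frontier_def)
qed

text \<open>Every point off \<open>V\<close> can be moved straight outward, staying off
  \<open>V\<close>, until it leaves a large disk, whose complement is connected.\<close>

lemma connected_complement_V: "connected (- V)"
proof -
  obtain B where B: "0 < B" "V \<subseteq> ball 0 B"
    using bounded_subset_ballD[OF bounded_V, of 0] by auto
  define A where "A = - ball (0::complex) B"
  have A: "connected A" "A \<subseteq> - V"
    using B(2) connected_complement_bounded_convex[of "ball (0::complex) B"] by (auto simp: A_def)
  define L where "L = (\<lambda>p::complex. (\<lambda>t. t *\<^sub>R p) ` {1..})"
  have conL: "connected (L p)" for p
    unfolding L_def by (intro connected_continuous_image continuous_intros) auto
  have L: "p \<in> L p" "L p \<subseteq> - V" "L p \<inter> A \<noteq> {}" if "p \<notin> V" for p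
  proof -
    show "p \<in> L p" unfolding L_def by (rule image_eqI[of _ _ 1]) auto
    obtain r \<theta> where r: "0 \<le> r" "p = r *\<^sub>R cis \<theta>" using polar .
    have rR: "R \<theta> < r" using that in_V_iff_R[OF r(1)] r(2) by auto
    show "L p \<subseteq> - V"
    proof
      fix q assume "q \<in> L p"
      then obtain t where t: "1 \<le> t" "q = (t * r) *\<^sub>R cis \<theta>" by (auto simp: L_def r)
      have "r \<le> t * r" using t r by (simp add: mult_le_cancel_right1)
      then show "q \<in> - V" using in_V_iff_R[of "t * r" \<theta>] t r rR by auto
    qed
    have "0 < r" using rR R_pos[of \<theta>] by simp
    have "max 1 (B / r) *\<^sub>R p \<in> L p" unfolding L_def by (rule imageI) auto
    moreover have "B \<le> max 1 (B / r) * r" using \<open>0 < r\<close> by (simp add: max_def field_simps)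
    then have "max 1 (B / r) *\<^sub>R p \<in> A"
      using \<open>0 < r\<close> by (simp add: A_def r(2))
    ultimately show "L p \<inter> A \<noteq> {}" by blast
  qed
  have "- V = A \<union> (\<Union>p\<in>- V. L p)"
    using A(2) L(1,2) by blast
  also have "\<dots> = (if - V = {} then A else \<Union>p\<in>- V. A \<union> L p)"
    by auto
  also have "connected \<dots>"
  proof (cases "- V = {}")
    case False
    have "A \<noteq> {}"
    proof -
      obtain p where "p \<in> - V" using False by blast
      then show ?thesis using L(3)[of p] by auto
    qed
    then have "connected (\<Union>p\<in>- V. A \<union> L p)"
      using A(1) conL L(3) by (intro connected_Union) (auto intro!: connected_Un)
    then show ?thesis using False by simp
  qed (use A in simp)
  finally show ?thesis .
qed

lemma closed_region_eq_V:
  assumes "path_image \<gamma> = (+) g ` frontier V"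
  shows "closed_region \<gamma> = (+) g ` V"
proof (rule closed_region_eq)
  show "closed ((+) g ` V)" "bounded ((+) g ` V)"
    using closed_V bounded_V by (simp_all add: closed_translation bounded_translation)
  have "(+) g ` S = {x. x - g \<in> S}" for S
    by (force simp: image_iff)
  then have eq: "- ((+) g ` V) = (+) g ` (- V)"
    by auto
  show "connected (- ((+) g ` V))"
    unfolding eq by (intro connected_continuous_image connected_complement_V continuous_intros)
  show "path_image \<gamma> = frontier ((+) g ` V)"
    by (simp add: assms frontier_translation)
qed

end

section \<open>Breakpoints\<close>

text \<open>A direction \<open>\<theta>\<close> with \<open>sin \<theta> \<noteq> 0\<close> is encoded, up to sign, by the cotangent of \<open>\<theta>\<close>. Division
  by zero makes some of the roots below meaningless; superfluous breakpoints do no harm.\<close>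

definition lin_root :: "complex \<Rightarrow> real" where
  "lin_root z = - Im z / Re z"

text \<open>The third entry serves the linear case \<open>a = 0\<close>. No case is tested, so the
  list always has the same length.\<close>

definition quad_roots :: "real \<Rightarrow> real \<Rightarrow> real \<Rightarrow> real list" where
  "quad_roots a b c = [(- b + sqrt (b * b - 4 * a * c)) / (2 * a),
     (- b - sqrt (b * b - 4 * a * c)) / (2 * a), - c / b]"

lemma quad_roots:
  assumes "a * t\<^sup>2 + b * t + c = 0" "\<not> (a = 0 \<and> b = 0 \<and> c = 0)"
  shows "t \<in> set (quad_roots a b c)"
proof (cases "a = 0")
  case True
  then have "b * t = - c" "b \<noteq> 0" using assms by auto
  then show ?thesis by (simp add: quad_roots_def field_simps)
next
  case False
  then have "t = (- b + sqrt (discrim a b c)) / (2 * a) \<or> t = (- b - sqrt (discrim a b c)) / (2 * a)"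
    using assms(1) discriminant_iff[OF False, of t b c] by simp
  then show ?thesis by (auto simp: quad_roots_def discrim_def power2_eq_square)
qed

text \<open>Two constraints agree where \<open>A + L \<bullet> u + q\<^sub>1 x\<^sup>2 + q\<^sub>2 x y + q\<^sub>3 y\<^sup>2\<close> vanishes for \<open>u = (x, y)\<close>. In all
  cases that occur, the linear or the quadratic part is zero; either way the agreement is a
  quadratic equation for the cotangent.\<close>

definition cA :: "con \<Rightarrow> con \<Rightarrow> real" where
  "cA c c' = n0 c * m0 c' - n0 c' * m0 c"

definition cL :: "con \<Rightarrow> con \<Rightarrow> complex" where
  "cL c c' = n0 c *\<^sub>R mv c' + m0 c' *\<^sub>R nv c - n0 c' *\<^sub>R mv c - m0 c *\<^sub>R nv c'"

definition cQ1 :: "con \<Rightarrow> con \<Rightarrow> real" where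
  "cQ1 c c' = Re (nv c) * Re (mv c') - Re (nv c') * Re (mv c)"

definition cQ2 :: "con \<Rightarrow> con \<Rightarrow> real" where
  "cQ2 c c' = Re (nv c) * Im (mv c') + Im (nv c) * Re (mv c')
     - Re (nv c') * Im (mv c) - Im (nv c') * Re (mv c)"

definition cQ3 :: "con \<Rightarrow> con \<Rightarrow> real" where
  "cQ3 c c' = Im (nv c) * Im (mv c') - Im (nv c') * Im (mv c)"

text \<open>The four linear roots concern \<open>c\<close> alone; those of \<open>c'\<close> come
  from the pair in the other order. Both quadratics make the agreement equation homogeneous: for
  linear part \<open>L\<close>, \<open>A + L \<bullet> u = 0\<close> is squared and
  \<open>A * A\<close> multiplied by \<open>x * x + y * y = 1\<close>; with a quadratic part,
  \<open>A\<close> itself is multiplied by it.\<close>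

definition breaks :: "con \<Rightarrow> con \<Rightarrow> real list" where
  "breaks c c' =
     [lin_root (d1 c), lin_root (d2 c), lin_root (nv c), lin_root (mv c)] @
     (let A = cA c c'; x = Re (cL c c'); y = Im (cL c c') in
        quad_roots (x * x - A * A) (2 * x * y) (y * y - A * A)) @
     quad_roots (cQ1 c c' + cA c c') (cQ2 c c') (cQ3 c c' + cA c c')"

text \<open>The three cases are a circle through the origin, a circle about the origin, and a
  line.\<close>

definition regular :: "con \<Rightarrow> bool" where
  "regular c \<longleftrightarrow> n0 c = 0 \<and> m0 c = 1 \<and> mv c = 0 \<or> nv c = 0 \<and> m0 c = 1 \<and> mv c = 0 \<or>
     n0 c = 1 \<and> nv c = 0 \<and> m0 c = 0"

lemma regular_edge_cons: "c \<in> set (edge_cons \<alpha> a b) \<Longrightarrow> regular c"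
  by (auto simp: edge_cons_def Let_def regular_def foot_con_def vertex_con_def line_con_def)

text \<open>An open sector free of breakpoints. The directions with \<open>sin \<theta> = 0\<close>,
  which have no cotangent, count as breakpoints as well.\<close>

definition gap :: "real set \<Rightarrow> real \<Rightarrow> real \<Rightarrow> bool" where
  "gap T x y \<longleftrightarrow> (\<forall>\<theta>. x < \<theta> \<and> \<theta> < y \<longrightarrow> sin \<theta> \<noteq> 0 \<and> cos \<theta> / sin \<theta> \<notin> T)"

lemma inner_cis: "z \<bullet> cis \<theta> = Re z * cos \<theta> + Im z * sin \<theta>"
  by (simp add: inner_complex_def)

lemma gap_linear:
  assumes "gap T x y" "lin_root z \<in> T" "x < \<theta>" "\<theta> < y" "z \<bullet> cis \<theta> = 0"
  shows "z = 0"
proof (rule ccontr)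
  assume z: "z \<noteq> 0"
  have s: "sin \<theta> \<noteq> 0" "cos \<theta> / sin \<theta> \<noteq> lin_root z"
    using assms unfolding gap_def by metis+
  have "Re z * cos \<theta> = - (Im z * sin \<theta>)" using assms(5) by (simp add: inner_cis)
  moreover from this have "Re z \<noteq> 0" using s(1) z by (auto simp: complex_eq_iff)
  ultimately show False using s by (simp add: lin_root_def field_simps)
qed

text \<open>Division by \<open>(sin \<theta>)\<^sup>2\<close> turns the form into a polynomial in
  the cotangent, whose roots are all in \<open>T\<close> unless it is the zero polynomial.\<close>

lemma gap_quadratic:
  assumes "gap T x y" "set (quad_roots a b c) \<subseteq> T" "x < \<theta>" "\<theta> < y"
    and "a * (cos \<theta>)\<^sup>2 + b * (cos \<theta> * sin \<theta>) + c * (sin \<theta>)\<^sup>2 = 0"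
  shows "a = 0 \<and> b = 0 \<and> c = 0"
proof (rule ccontr)
  assume n: "\<not> ?thesis"
  have s: "sin \<theta> \<noteq> 0" "cos \<theta> / sin \<theta> \<notin> T"
    using assms unfolding gap_def by metis+
  have "a * (cos \<theta> / sin \<theta>)\<^sup>2 + b * (cos \<theta> / sin \<theta>) + c
      = (a * (cos \<theta>)\<^sup>2 + b * (cos \<theta> * sin \<theta>) + c * (sin \<theta>)\<^sup>2) / (sin \<theta>)\<^sup>2"
    using s(1) by (simp add: field_simps power2_eq_square)
  also have "\<dots> = 0" using assms(5) by simp
  finally show False using quad_roots[OF _ n] s(2) assms(2) by blast
qed

text \<open>The difference of the two radii with the denominators cleared; for positive denominators
  it has the same sign.\<close>

definition cW :: "con \<Rightarrow> con \<Rightarrow> complex \<Rightarrow> real" where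
  "cW c c' u = numer c u * denom c' u - numer c' u * denom c u"

lemma cW_cis:
  "cW c c' (cis \<theta>) = cA c c' + cL c c' \<bullet> cis \<theta> +
     (cQ1 c c' * (cos \<theta>)\<^sup>2 + cQ2 c c' * (cos \<theta> * sin \<theta>) + cQ3 c c' * (sin \<theta>)\<^sup>2)"
  by (simp add: cW_def numer_def denom_def cA_def cL_def cQ1_def cQ2_def cQ3_def inner_cis
      power2_eq_square algebra_simps)

lemma gap_cW:
  assumes "gap T x y" "set (breaks c c') \<subseteq> T" "regular c" "regular c'" "x < \<theta>" "\<theta> < y"
    and "cW c c' (cis \<theta>) = 0"
  shows "cW c c' (cis t) = 0"
proof -
  consider "cQ1 c c' = 0" "cQ2 c c' = 0" "cQ3 c c' = 0" | "cL c c' = 0"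
    using assms(3,4) by (auto simp: regular_def cL_def cQ1_def cQ2_def cQ3_def)
  then show ?thesis
  proof cases
    case 1
    define A X Y where "A = cA c c'" and "X = Re (cL c c')" and "Y = Im (cL c c')"
    have 0: "A + (X * cos \<theta> + Y * sin \<theta>) = 0"
      using assms(7) by (simp add: cW_cis 1 inner_cis A_def X_def Y_def)
    have "(X * X - A * A) * (cos \<theta>)\<^sup>2 + 2 * X * Y * (cos \<theta> * sin \<theta>) + (Y * Y - A * A) * (sin \<theta>)\<^sup>2
      = (X * cos \<theta> + Y * sin \<theta>)\<^sup>2 - A\<^sup>2 * (sin \<theta>)\<^sup>2 - A\<^sup>2 * (cos \<theta>)\<^sup>2"
      by (simp add: power2_eq_square algebra_simps)
    also have "X * cos \<theta> + Y * sin \<theta> = - A" using 0 by simp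
    also have "(- A)\<^sup>2 - A\<^sup>2 * (sin \<theta>)\<^sup>2 - A\<^sup>2 * (cos \<theta>)\<^sup>2 = 0"
      by (simp add: sin_squared_eq algebra_simps)
    finally have "X * X - A * A = 0 \<and> 2 * X * Y = 0 \<and> Y * Y - A * A = 0"
      by (intro gap_quadratic[OF assms(1) _ assms(5,6)])
        (use assms(2) in \<open>auto simp: breaks_def Let_def A_def X_def Y_def\<close>)
    then have "A = 0" "X = 0" "Y = 0" by auto
    then show ?thesis by (simp add: cW_cis 1 inner_cis A_def X_def Y_def)
  next
    case 2
    have "(cQ1 c c' + cA c c') * (cos \<theta>)\<^sup>2 + cQ2 c c' * (cos \<theta> * sin \<theta>) + (cQ3 c c' + cA c c') * (sin \<theta>)\<^sup>2
      = cQ1 c c' * (cos \<theta>)\<^sup>2 + cQ2 c c' * (cos \<theta> * sin \<theta>) + cQ3 c c' * (sin \<theta>)\<^sup>2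
        + cA c c' * ((sin \<theta>)\<^sup>2 + (cos \<theta>)\<^sup>2)"
      by (simp only: distrib_right distrib_left)
    also have "\<dots> = 0" using assms(7) by (simp add: cW_cis 2)
    finally have z: "cQ1 c c' + cA c c' = 0 \<and> cQ2 c c' = 0 \<and> cQ3 c c' + cA c c' = 0"
      by (intro gap_quadratic[OF assms(1) _ assms(5,6)])
        (use assms(2) in \<open>auto simp: breaks_def Let_def\<close>)
    then have "cQ1 c c' = - cA c c'" "cQ3 c c' = - cA c c'" "cQ2 c c' = 0" by auto
    then have "cW c c' (cis t) = cA c c' * (1 - ((sin t)\<^sup>2 + (cos t)\<^sup>2))"
      by (simp only: cW_cis 2 inner_zero_left) (simp add: sin_squared_eq algebra_simps)
    then show ?thesis by simp
  qed
qed

text \<open>By the intermediate value theorem a sign change would produce a zero between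
  \<open>x\<close> and \<open>y\<close>, and such a zero makes \<open>f\<close> vanish
  everywhere.\<close>

lemma sgn_const:
  fixes f :: "real \<Rightarrow> real"
  assumes cont: "continuous_on UNIV f"
    and zero: "\<And>\<theta> t. x < \<theta> \<Longrightarrow> \<theta> < y \<Longrightarrow> f \<theta> = 0 \<Longrightarrow> f t = 0"
    and s: "x < s" "s < y" and t: "x < t" "t < y"
  shows "sgn (f s) = sgn (f t)"
proof -
  have "f s * f t > 0 \<or> f s = 0 \<and> f t = 0"
  proof (rule ccontr)
    assume n: "\<not> ?thesis"
    then have "\<not> 0 < f s * f t" by blast
    then have "f s \<le> 0 \<and> 0 \<le> f t \<or> f t \<le> 0 \<and> 0 \<le> f s"
      by (metis linorder_not_le mult_neg_neg mult_pos_pos less_imp_le)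
    moreover have "\<exists>z. x < z \<and> z < y \<and> f z = 0"
      if st: "f p \<le> 0" "0 \<le> f q" and p: "x < p" "p < y" and q: "x < q" "q < y" for p q
    proof -
      have cont': "continuous_on A f" for A using cont continuous_on_subset by blast
      show ?thesis
      proof (cases "p \<le> q")
        case True
        then obtain z where "p \<le> z" "z \<le> q" "f z = 0"
          using IVT'[of f p 0 q, OF st True cont'] by blast
        then show ?thesis using p q by (intro exI[of _ z]) auto
      next
        case False
        then obtain z where "q \<le> z" "z \<le> p" "f z = 0"
          using IVT2'[of f p 0 q, OF st _ cont'] by auto
        then show ?thesis using p q by (intro exI[of _ z]) auto
      qed
    qed
    ultimately obtain z where "x < z" "z < y" "f z = 0" using s t by blast
    then show False using zero n by blast
  qed
  then show ?thesis by (auto simp: zero_less_mult_iff)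
qed

lemma continuous_cis_inner: "continuous_on A (\<lambda>\<theta>. z \<bullet> cis \<theta>)"
  unfolding inner_cis by (intro continuous_intros)

lemma continuous_numer: "continuous_on A (\<lambda>\<theta>. numer c (cis \<theta>))"
  and continuous_denom: "continuous_on A (\<lambda>\<theta>. denom c (cis \<theta>))"
  unfolding numer_def denom_def by (intro continuous_intros continuous_cis_inner)+

lemma sgn_const_linear:
  assumes "gap T x y" "lin_root z \<in> T" "r = 0 \<or> z = 0" "x < s" "s < y" "x < t" "t < y"
  shows "sgn (r + z \<bullet> cis s) = sgn (r + z \<bullet> cis t)"
proof (cases "z = 0")
  case False
  show ?thesis
  proof (rule sgn_const[where x = x and y = y and f = "\<lambda>\<theta>. r + z \<bullet> cis \<theta>"])
    show "continuous_on UNIV (\<lambda>\<theta>. r + z \<bullet> cis \<theta>)"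
      by (intro continuous_intros continuous_cis_inner)
    show "r + z \<bullet> cis t' = 0" if "x < \<theta>" "\<theta> < y" "r + z \<bullet> cis \<theta> = 0" for \<theta> t'
      using gap_linear[OF assms(1,2) that(1,2)] that(3) assms(3) False by simp
  qed (use assms in auto)
qed simp

lemma sgn_eq_iff: "sgn (a::real) = sgn b \<Longrightarrow> (0 \<le> a \<longleftrightarrow> 0 \<le> b) \<and> (0 < a \<longleftrightarrow> 0 < b)"
  by (auto simp: sgn_if split: if_splits)

lemma gap_active:
  assumes g: "gap T x y" and T: "set (breaks c c') \<subseteq> T" and c: "regular c"
    and st: "x < s" "s < y" "x < t" "t < y"
  shows "active c (cis s) \<longleftrightarrow> active c (cis t)"
proof -
  have roots: "lin_root (d1 c) \<in> T" "lin_root (d2 c) \<in> T" "lin_root (nv c) \<in> T" "lin_root (mv c) \<in> T"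
    using T by (auto simp: breaks_def)
  have "sgn (0 + d1 c \<bullet> cis s) = sgn (0 + d1 c \<bullet> cis t)" "sgn (0 + d2 c \<bullet> cis s) = sgn (0 + d2 c \<bullet> cis t)"
    by (intro sgn_const_linear[OF g] roots st; simp)+
  moreover have "sgn (n0 c + nv c \<bullet> cis s) = sgn (n0 c + nv c \<bullet> cis t)"
    "sgn (m0 c + mv c \<bullet> cis s) = sgn (m0 c + mv c \<bullet> cis t)"
    by (intro sgn_const_linear[OF g] roots st; use c in \<open>auto simp: regular_def\<close>)+
  ultimately show ?thesis
    unfolding active_def numer_def denom_def
    by (simp only: add_0) (metis sgn_eq_iff)
qed

lemma gap_radius_le:
  assumes g: "gap T x y" and T: "set (breaks c c') \<subseteq> T" and c: "regular c" "regular c'"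
    and st: "x < s" "s < y" "x < t" "t < y"
    and d: "0 < denom c (cis s)" "0 < denom c' (cis s)" "0 < denom c (cis t)" "0 < denom c' (cis t)"
    and le: "radius c (cis s) \<le> radius c' (cis s)"
  shows "radius c (cis t) \<le> radius c' (cis t)"
proof -
  have iff: "radius c (cis r) \<le> radius c' (cis r) \<longleftrightarrow> 0 \<le> - cW c c' (cis r)"
    if "0 < denom c (cis r)" "0 < denom c' (cis r)" for r
    using that by (simp add: radius_def cW_def divide_le_eq pos_le_divide_eq field_simps)
  have "sgn (- cW c c' (cis s)) = sgn (- cW c c' (cis t))"
  proof (rule sgn_const[where x = x and y = y and f = "\<lambda>\<theta>. - cW c c' (cis \<theta>)"])
    show "continuous_on UNIV (\<lambda>\<theta>. - cW c c' (cis \<theta>))"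
      unfolding cW_def by (intro continuous_intros continuous_numer continuous_denom)
    show "- cW c c' (cis t') = 0" if "x < \<theta>" "\<theta> < y" "- cW c c' (cis \<theta>) = 0" for \<theta> t'
      using gap_cW[OF g T c that(1,2)] that(3) by simp
  qed (use st in auto)
  then show ?thesis using le iff d sgn_eq_iff by blast
qed

section \<open>One minimal constraint for each sector\<close>

context robust_region
begin

lemma regular_cons: "c \<in> set cons \<Longrightarrow> regular c"
  using regular_edge_cons by (auto simp: set_cons)

lemma R_eq_iff_minimal:
  assumes "c \<in> set cons" "active c (cis \<theta>)"
    and "\<And>c'. c' \<in> set cons \<Longrightarrow> active c' (cis \<theta>) \<Longrightarrow> radius c (cis \<theta>) \<le> radius c' (cis \<theta>)"
  shows "R \<theta> = radius c (cis \<theta>)"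
  unfolding R_def using assms by (intro Min_eqI) auto

text \<open>One sample direction decides the closed sector. Inside it, activity and the order of the
  radii are constant. At the ends, \<open>R \<theta> * denom = numer\<close> survives by continuity,
  and the denominator stays positive because numerator and denominator of a regular constraint never
  vanish together.\<close>

lemma R_on_gap:
  assumes g: "gap T x y" and T: "\<And>c c'. c \<in> set cons \<Longrightarrow> c' \<in> set cons \<Longrightarrow> set (breaks c c') \<subseteq> T"
    and m: "x < m" "m < y" and c: "c \<in> set cons" "active c (cis m)"
    and min: "\<And>c'. c' \<in> set cons \<Longrightarrow> active c' (cis m) \<Longrightarrow> radius c (cis m) \<le> radius c' (cis m)"
    and \<theta>: "x \<le> \<theta>" "\<theta> \<le> y"
  shows "R \<theta> = radius c (cis \<theta>)" "0 < denom c (cis \<theta>)"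
proof -
  have eq: "R t * denom c (cis t) = numer c (cis t)" "0 < denom c (cis t)" if t: "x < t" "t < y" for t
  proof -
    have act: "active c' (cis t) \<longleftrightarrow> active c' (cis m)" if "c' \<in> set cons" for c'
      using gap_active[OF g T[OF that that] regular_cons[OF that]] m t by blast
    have "R t = radius c (cis t)"
    proof (rule R_eq_iff_minimal[OF c(1)])
      show "active c (cis t)" using act c by blast
      fix c' assume c': "c' \<in> set cons" "active c' (cis t)"
      show "radius c (cis t) \<le> radius c' (cis t)"
        by (rule gap_radius_le[OF g T[OF c(1) c'(1)] regular_cons[OF c(1)] regular_cons[OF c'(1)] m t])
          (use c' c act min in \<open>auto simp: active_def\<close>)
    qed
    moreover show "0 < denom c (cis t)" using act c by (auto simp: active_def)
    ultimately show "R t * denom c (cis t) = numer c (cis t)" by (simp add: radius_def)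
  qed
  have contR: "continuous_on A R" for A
    using isCont_R continuous_at_imp_continuous_on by blast
  have cl: "closure {x<..<y} = {x..y}" using m by simp
  have "\<theta> \<in> closure {x<..<y}" using \<theta> cl by simp
  then have e: "R \<theta> * denom c (cis \<theta>) - numer c (cis \<theta>) = 0" and d0: "0 \<le> denom c (cis \<theta>)"
  proof -
    assume th: "\<theta> \<in> closure {x<..<y}"
    show "R \<theta> * denom c (cis \<theta>) - numer c (cis \<theta>) = 0"
      by (rule continuous_constant_on_closure[of "{x<..<y}" "\<lambda>\<theta>. R \<theta> * denom c (cis \<theta>) - numer c (cis \<theta>)", OF _ _ th])
        (use eq in \<open>auto intro!: continuous_intros contR continuous_denom continuous_numer\<close>)
    show "0 \<le> denom c (cis \<theta>)"
      by (rule continuous_ge_on_closure[of "{x<..<y}", OF continuous_denom th])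
        (use eq(2) in \<open>auto intro: less_imp_le\<close>)
  qed
  have "denom c (cis \<theta>) \<noteq> 0"
  proof
    assume 0: "denom c (cis \<theta>) = 0"
    then have "numer c (cis \<theta>) = 0" using e by simp
    then show False using 0 regular_cons[OF c(1)] by (auto simp: regular_def numer_def denom_def)
  qed
  then show "0 < denom c (cis \<theta>)" using d0 by simp
  then show "R \<theta> = radius c (cis \<theta>)" using e by (simp add: radius_def field_simps)
qed

end

section \<open>The boundary curve\<close>

text \<open>This is why adding the bounding vectors finds a direction inside a sector. It also
  locates the points of a chord in \<open>line_piece\<close>.\<close>

lemma polar_between:
  assumes "0 < p" "0 < q" "x < y" "y < x + pi"
  obtains r \<theta> where "0 < r" "x < \<theta>" "\<theta> < y" "p *\<^sub>R cis x + q *\<^sub>R cis y = r *\<^sub>R cis \<theta>"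
proof -
  \<comment> \<open>Rotated by \<open>- x\<close>, so that the first vector becomes the positive
    number \<open>p\<close> and \<open>0 < Im z\<close>.\<close>
  define z where "z = complex_of_real p + q *\<^sub>R cis (y - x)"
  have s: "0 < sin (y - x)" using assms by (intro sin_gt_zero) auto
  then have "0 < Im z" using assms by (simp add: z_def)
  then have z0: "z \<noteq> 0" by auto
  define t where "t = Arg z"
  have zt: "z = norm z *\<^sub>R cis t"
    using z0 by (simp add: t_def cis_Arg sgn_div_norm)
  have "0 < norm z * sin t"
    using \<open>0 < Im z\<close> by (subst (asm) zt) simp
  then have "0 < sin t" by (simp add: zero_less_mult_iff z0)
  have "- pi < t" "t \<le> pi" using Arg_bounded[of z] by (auto simp: t_def)
  have t: "0 < t" "t < pi"
  proof -
    show "0 < t"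
    proof (rule ccontr)
      assume "\<not> 0 < t"
      then have "0 \<le> sin (- t)" using \<open>- pi < t\<close> by (intro sin_ge_zero) auto
      then show False using \<open>0 < sin t\<close> by simp
    qed
    show "t < pi" using \<open>0 < sin t\<close> \<open>t \<le> pi\<close> by (cases "t = pi") auto
  qed
  have e: "p *\<^sub>R cis x + q *\<^sub>R cis y = norm z *\<^sub>R cis (x + t)"
  proof -
    have "p *\<^sub>R cis x + q *\<^sub>R cis y = z * cis x"
      by (simp add: z_def distrib_right cis_mult scaleR_conv_of_real)
    also have "\<dots> = norm z *\<^sub>R cis (x + t)"
      by (subst zt) (simp add: cis_mult add.commute)
    finally show ?thesis .
  qed
  \<comment> \<open>A further rotation makes the second vector real; now the imaginary part is
    negative, which bounds the angle from above.\<close>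
  have "z * cis (- (y - x)) = p *\<^sub>R cis (- (y - x)) + of_real q"
    by (simp add: z_def distrib_right cis_mult scaleR_conv_of_real)
  then have "Im (z * cis (- (y - x))) = - (p * sin (y - x))"
    using sin_minus[of "y - x"] by simp
  moreover have "z * cis (- (y - x)) = norm z *\<^sub>R cis (t - (y - x))"
    by (subst zt) (simp add: cis_mult algebra_simps)
  ultimately have "Im (norm z *\<^sub>R cis (t - (y - x))) = - (p * sin (y - x))"
    by (simp only:)
  moreover have "0 < p * sin (y - x)" using s assms(1) by simp
  ultimately have "norm z * sin (t - (y - x)) < 0" by simp
  then have neg: "sin (t - (y - x)) < 0" by (simp add: mult_less_0_iff z0)
  have "x + t < y"
  proof (rule ccontr)
    assume "\<not> x + t < y"
    then have "0 \<le> sin (t - (y - x))" using t assms by (intro sin_ge_zero) auto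
    then show False using neg by simp
  qed
  then show thesis
    using e t z0 by (intro that[of "norm z" "x + t"]) auto
qed

lemma cis_inj_interval:
  assumes "cis s = cis t" "\<bar>s - t\<bar> < 2 * pi"
  shows "s = t"
proof -
  have "cis (s - t) = 1" using assms(1) by (simp flip: cis_divide)
  then have "cos (s - t) = 1" by (metis cis.simps(1) one_complex.simps(1))
  then obtain n :: int where "s - t = n * 2 * pi"
    using cos_one_2pi_int by auto
  then have "\<bar>real_of_int n\<bar> < 1" using assms(2) by (simp add: abs_mult)
  then have "n = 0" by linarith
  then show ?thesis using \<open>s - t = n * 2 * pi\<close> by simp
qed

section \<open>Joining consecutive stretches of one parametrized curve\<close>

lemma join_list_arcs:
  fixes f :: "nat \<Rightarrow> real"
  assumes "ps \<noteq> []"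
    and "\<And>i. i < length ps \<Longrightarrow> arc (ps ! i) \<and> path_image (ps ! i) = Z ` {f i..f (Suc i)} \<and>
      pathstart (ps ! i) = Z (f i) \<and> pathfinish (ps ! i) = Z (f (Suc i)) \<and> f i < f (Suc i)"
    and "inj_on Z {f 0..f (length ps)}"
  shows "arc (join_list ps) \<and> path_image (join_list ps) = Z ` {f 0..f (length ps)} \<and>
    f 0 < f (length ps)"
  using assms
proof (induction ps arbitrary: f rule: join_list.induct)
  case (2 p)
  from "2.prems"(2)[of 0] show ?case by simp
next
  case (3 p q ps)
  let ?f = "\<lambda>i. f (Suc i)"
  have p: "arc p" "path_image p = Z ` {f 0..f 1}" "pathstart p = Z (f 0)" "pathfinish p = Z (f 1)" "f 0 < f 1"
    using "3.prems"(2)[of 0] by auto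
  have "inj_on Z {?f 0..?f (length (q # ps))}"
    by (rule inj_on_subset[OF "3.prems"(3)]) (use p(5) in auto)
  then have IH: "arc (join_list (q # ps)) \<and> path_image (join_list (q # ps)) = Z ` {f 1..f (length (p # q # ps))}
      \<and> f 1 < f (length (p # q # ps))"
    using "3.IH"[of ?f] "3.prems"(2)[of "Suc i" for i] by simp
  have ps: "pathstart (join_list (q # ps)) = Z (f 1)"
    using "3.prems"(2)[of 1] by (simp add: pathstart_join_list)
  have "path_image p \<inter> path_image (join_list (q # ps)) \<subseteq> {Z (f 1)}"
  proof
    fix z assume "z \<in> path_image p \<inter> path_image (join_list (q # ps))"
    then have "z \<in> Z ` {f 0..f 1}" "z \<in> Z ` {f 1..f (length (p # q # ps))}"
      using p(2) IH by blast+
    then obtain s t where "z = Z s" "z = Z t" "s \<in> {f 0..f 1}" "t \<in> {f 1..f (length (p # q # ps))}"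
      unfolding image_iff by blast
    moreover from this have "s = t"
      using "3.prems"(3) IH p(5) by (auto simp: inj_on_def)
    ultimately show "z \<in> {Z (f 1)}" by auto
  qed
  then have "arc (p +++ join_list (q # ps))"
    using IH p ps by (intro arc_join) auto
  moreover have "path_image (p +++ join_list (q # ps)) = Z ` ({f 0..f 1} \<union> {f 1..f (length (p # q # ps))})"
    using p ps IH by (simp add: path_image_join image_Un)
  moreover have "{f 0..f 1} \<union> {f 1..f (length (p # q # ps))} = {f 0..f (length (p # q # ps))}"
    using IH p(5) by auto
  ultimately show ?case using IH p(5) by auto
qed simp

text \<open>The first piece is joined to the arc formed by all others; injectivity up to the closing
  point lets them meet only in their common ends.\<close>

lemma join_list_loop:
  fixes f :: "nat \<Rightarrow> real"
  assumes len: "2 \<le> length ps"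
    and pieces: "\<And>i. i < length ps \<Longrightarrow> arc (ps ! i) \<and> path_image (ps ! i) = Z ` {f i..f (Suc i)} \<and>
      pathstart (ps ! i) = Z (f i) \<and> pathfinish (ps ! i) = Z (f (Suc i)) \<and> f i < f (Suc i)"
    and inj: "inj_on Z {f 0..<f (length ps)}" and loop: "Z (f (length ps)) = Z (f 0)"
  shows "simple_path (join_list ps) \<and> path_image (join_list ps) = Z ` {f 0..f (length ps)}"
proof -
  obtain p q qs where ps: "ps = p # q # qs" using len by (cases ps rule: join_list.cases) auto
  let ?n = "length ps"
  have p: "arc p" "path_image p = Z ` {f 0..f 1}" "pathstart p = Z (f 0)" "pathfinish p = Z (f 1)" "f 0 < f 1"
    using pieces[of 0] by (auto simp: ps)
  \<comment> \<open>The closing value \<open>Z (f ?n)\<close> equals \<open>Z (f 0)\<close>, and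
    injectivity keeps this away from the values between \<open>f 1\<close> and
    \<open>f ?n\<close>.\<close>
  have inj1: "inj_on Z {f 1..f ?n}"
  proof (rule inj_onI)
    fix s t assume st: "s \<in> {f 1..f ?n}" "t \<in> {f 1..f ?n}" "Z s = Z t"
    have "Z r \<noteq> Z (f 0)" if "f 1 \<le> r" "r < f ?n" for r
    proof -
      have "r \<in> {f 0..<f ?n}" "f 0 \<in> {f 0..<f ?n}" using that p(5) by simp_all
      then show ?thesis using inj_onD[OF inj, of r "f 0"] that p(5) by auto
    qed
    then have "s = f ?n \<longleftrightarrow> t = f ?n" using st loop by (metis atLeastAtMost_iff less_eq_real_def)
    then show "s = t"
      using st p(5) inj_onD[OF inj, of s t] by (cases "s = f ?n") auto
  qed
  have tail: "arc (join_list (q # qs)) \<and> path_image (join_list (q # qs)) = Z ` {f 1..f ?n} \<and> f 1 < f ?n"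
    using join_list_arcs[of "q # qs" Z "\<lambda>i. f (Suc i)"] pieces[of "Suc i" for i] inj1 by (auto simp: ps)
  have st: "pathstart (join_list (q # qs)) = Z (f 1)"
    using pieces[of 1] by (simp add: ps pathstart_join_list)
  have fin: "pathfinish (join_list (q # qs)) = Z (f 0)"
    using pieces[of "length qs + 1"] loop by (auto simp: ps pathfinish_join_list last_conv_nth)
  have "path_image p \<inter> path_image (join_list (q # qs)) \<subseteq> {Z (f 0), Z (f 1)}"
  proof
    fix z assume "z \<in> path_image p \<inter> path_image (join_list (q # qs))"
    then have "z \<in> Z ` {f 0..f 1}" "z \<in> Z ` {f 1..f ?n}"
      using p(2) tail by blast+
    then obtain s t where z: "z = Z s" "z = Z t" "s \<in> {f 0..f 1}" "t \<in> {f 1..f ?n}"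
      unfolding image_iff by blast
    show "z \<in> {Z (f 0), Z (f 1)}"
    proof (cases "t = f ?n")
      case False
      then have "s = t" using inj_onD[OF inj, of s t] z tail p(5) by auto
      then show ?thesis using z by auto
    qed (use z loop in auto)
  qed
  then have "simple_path (p +++ join_list (q # qs))"
    using p st tail fin by (intro simple_path_join_loop) auto
  moreover have "path_image (p +++ join_list (q # qs)) = Z ` ({f 0..f 1} \<union> {f 1..f ?n})"
    using p st tail by (simp add: path_image_join image_Un)
  moreover have "{f 0..f 1} \<union> {f 1..f ?n} = {f 0..f ?n}"
    using tail p(5) by auto
  ultimately show ?thesis by (simp add: ps)
qed

text \<open>\<open>m0\<close> is 0 for lines and 1 for circles. A circle through the origin with
  radial function \<open>z \<bullet> u\<close> has the diameter \<open>z\<close>, hence the centre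
  \<open>z / 2\<close>; for a circle about the origin \<open>nv c = 0\<close>, and the same formula
  gives the centre \<open>g\<close>.\<close>

definition shape_of :: "complex \<Rightarrow> con \<Rightarrow> shape" where
  "shape_of g c = (if m0 c \<le> 0 then Straight else Ccw (g + nv c /\<^sub>R 2))"

section \<open>The radial graph as a closed curve of arcs and segments\<close>

context robust_region
begin

definition Z :: "complex \<Rightarrow> real \<Rightarrow> complex" where
  "Z g \<theta> = g + R \<theta> *\<^sub>R cis \<theta>"

lemma Z_inj:
  assumes "Z g s = Z g t" "\<bar>s - t\<bar> < 2 * pi"
  shows "s = t"
proof -
  have e: "R s *\<^sub>R cis s = R t *\<^sub>R cis t" using assms(1) by (simp add: Z_def)
  from arg_cong[OF e, of norm] have "R s = R t"
    using R_pos[of s] R_pos[of t] by simp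
  then have "cis s = cis t" using e R_pos[of t] by simp
  then show ?thesis using assms(2) by (rule cis_inj_interval)
qed

lemma line_piece:
  assumes xy: "x < y" "y < x + pi"
    and n: "\<And>\<theta>. x \<le> \<theta> \<Longrightarrow> \<theta> \<le> y \<Longrightarrow> R \<theta> * (n \<bullet> cis \<theta>) = 1"
  shows "closed_segment (Z g x) (Z g y) = Z g ` {x..y}"
proof (intro set_eqI iffI)
  fix z assume "z \<in> closed_segment (Z g x) (Z g y)"
  then obtain t where t: "0 \<le> t" "t \<le> 1" "z = (1 - t) *\<^sub>R Z g x + t *\<^sub>R Z g y"
    by (auto simp: in_segment)
  consider "t = 0" | "t = 1" | "0 < t" "t < 1" using t by linarith
  then show "z \<in> Z g ` {x..y}"
  proof cases
    case 3
    obtain r \<theta> where r: "0 < r" "x < \<theta>" "\<theta> < y"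
      "((1 - t) * R x) *\<^sub>R cis x + (t * R y) *\<^sub>R cis y = r *\<^sub>R cis \<theta>"
      using polar_between[OF _ _ xy, of "(1 - t) * R x" "t * R y"] 3 R_pos by (auto intro: mult_pos_pos)
    have "n \<bullet> (r *\<^sub>R cis \<theta>) = (1 - t) * (R x * (n \<bullet> cis x)) + t * (R y * (n \<bullet> cis y))"
      unfolding r(4)[symmetric] by (simp add: inner_add_right)
    then have "r * (n \<bullet> cis \<theta>) = 1" using n[of x] n[of y] xy by simp
    moreover have "R \<theta> * (n \<bullet> cis \<theta>) = 1" using n r by simp
    ultimately have "r = R \<theta>" by (metis mult_cancel_right mult_zero_right zero_neq_one)
    moreover have "z = g + (((1 - t) * R x) *\<^sub>R cis x + (t * R y) *\<^sub>R cis y)"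
      by (simp add: t(3) Z_def algebra_simps)
    ultimately show ?thesis using r by (auto simp: Z_def)
  qed (use t xy in auto)
next
  fix z assume "z \<in> Z g ` {x..y}"
  then obtain \<theta> where th: "x \<le> \<theta>" "\<theta> \<le> y" "z = Z g \<theta>" by auto
  have s: "0 < sin (y - x)" using xy by (intro sin_gt_zero) auto
  \<comment> \<open>The weights come from writing \<open>cis \<theta>\<close> as a combination of
    \<open>cis x\<close> and \<open>cis y\<close> by the sine rule; pairing with \<open>n\<close>
    shows that they add up to 1.\<close>
  define p q where "p = sin (y - \<theta>) * R \<theta> / (sin (y - x) * R x)"
    and "q = sin (\<theta> - x) * R \<theta> / (sin (y - x) * R y)"
  have pq: "0 \<le> p" "0 \<le> q"
    unfolding p_def q_def using th xy s R_pos[of \<theta>] R_pos[of x] R_pos[of y]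
    by (intro divide_nonneg_pos mult_nonneg_nonneg mult_pos_pos sin_ge_zero less_imp_le[OF R_pos]; simp)+
  have "sin (y - x) *\<^sub>R cis \<theta> = sin (y - \<theta>) *\<^sub>R cis x + sin (\<theta> - x) *\<^sub>R cis y"
    by (simp add: complex_eq_iff sin_diff algebra_simps)
  then have "(R \<theta> / sin (y - x)) *\<^sub>R (sin (y - x) *\<^sub>R cis \<theta>) =
      (R \<theta> / sin (y - x)) *\<^sub>R (sin (y - \<theta>) *\<^sub>R cis x + sin (\<theta> - x) *\<^sub>R cis y)"
    by (rule arg_cong)
  then have e: "R \<theta> *\<^sub>R cis \<theta> = p *\<^sub>R (R x *\<^sub>R cis x) + q *\<^sub>R (R y *\<^sub>R cis y)"
    using s R_pos[of x] R_pos[of y] by (simp add: p_def q_def scaleR_add_right mult.commute)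
  have "n \<bullet> (R \<theta> *\<^sub>R cis \<theta>) = p * (R x * (n \<bullet> cis x)) + q * (R y * (n \<bullet> cis y))"
    unfolding e by (simp add: inner_add_right)
  then have "p + q = 1" using n[of x] n[of y] n[of \<theta>] th xy by simp
  then have "z = (1 - q) *\<^sub>R Z g x + q *\<^sub>R Z g y"
  proof -
    have p: "p = 1 - q" using \<open>p + q = 1\<close> by simp
    show ?thesis
      unfolding th(3) Z_def e p by (simp add: algebra_simps)
  qed
  then show "z \<in> closed_segment (Z g x) (Z g y)"
    using pq \<open>p + q = 1\<close> unfolding in_segment by (intro exI[of _ q]) auto
qed

text \<open>On a circle through \<open>g\<close> the central angle is twice the angle seen from
  \<open>g\<close>, so \<open>y < x + pi\<close> keeps the arc below a full turn; for a line it
  makes the chord sweep the whole sector.\<close>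

lemma piece:
  assumes c: "regular c" and xy: "x < y" "y < x + pi"
    and r: "\<And>\<theta>. x \<le> \<theta> \<Longrightarrow> \<theta> \<le> y \<Longrightarrow> R \<theta> = radius c (cis \<theta>) \<and> 0 < denom c (cis \<theta>)"
  shows "\<exists>p. traces (Z g x) (shape_of g c) (Z g y) p \<and> arc p \<and> path_image p = Z g ` {x..y} \<and>
    pathstart p = Z g x \<and> pathfinish p = Z g y"
proof -
  from c consider (circle) "n0 c = 0" "m0 c = 1" "mv c = 0" | (disk) "nv c = 0" "m0 c = 1" "mv c = 0"
    | (line) "n0 c = 1" "nv c = 0" "m0 c = 0"
    by (auto simp: regular_def)
  then show ?thesis
  proof cases
    case circle
    define z where "z = nv c"
    have R: "R \<theta> = z \<bullet> cis \<theta>" if "x \<le> \<theta>" "\<theta> \<le> y" for \<theta>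
      using r[OF that] by (simp add: circle radius_def numer_def denom_def z_def)
    have "z \<noteq> 0" using R[of x] R_pos[of x] xy by auto
    define \<rho> \<phi> where "\<rho> = norm z / 2" and "\<phi> = Arg z"
    have \<rho>: "0 < \<rho>" using \<open>z \<noteq> 0\<close> by (simp add: \<rho>_def)
    have z: "z = (2 * \<rho>) *\<^sub>R cis \<phi>"
      using \<open>z \<noteq> 0\<close> by (simp add: \<rho>_def \<phi>_def cis_Arg sgn_div_norm)
    \<comment> \<open>The inscribed angle theorem, in the form
      \<open>z = (2 * \<rho>) *\<^sub>R cis \<phi>\<close>: the foot of \<open>z\<close> on the ray
      runs along the circle with diameter \<open>z\<close> at double speed.\<close>
    have Z: "Z g \<theta> = (g + z /\<^sub>R 2) + of_real \<rho> * cis (2 * \<theta> - \<phi>)" if "x \<le> \<theta>" "\<theta> \<le> y" for \<theta>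
    proof -
      have "(z \<bullet> cis \<theta>) *\<^sub>R cis \<theta> = \<rho> *\<^sub>R cis \<phi> + \<rho> *\<^sub>R cis (2 * \<theta> - \<phi>)"
        by (simp add: z complex_eq_iff inner_complex_def cos_diff sin_diff cos_double sin_double)
          (use sin_cos_squared_add[of \<theta>] in algebra)
      then show ?thesis
        by (simp add: Z_def R[OF that] z scaleR_conv_of_real)
    qed
    let ?p = "part_circlepath (g + z /\<^sub>R 2) \<rho> (2 * x - \<phi>) (2 * y - \<phi>)"
    have "traces (Z g x) (Ccw (g + z /\<^sub>R 2)) (Z g y) ?p"
      using \<rho> xy by (intro traces.intros Z) auto
    moreover have "arc ?p" using \<rho> xy by (intro arc_part_circlepath) auto
    moreover have "path_image ?p = Z g ` {x..y}"
    proof -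
      have "{2 * x - \<phi>..2 * y - \<phi>} = (\<lambda>\<theta>. 2 * \<theta> - \<phi>) ` {x..y}"
        using xy by (simp add: image_affinity_atLeastAtMost_diff)
      moreover have "2 * x - \<phi> \<le> 2 * y - \<phi>" using xy by simp
      ultimately have "path_image ?p = (\<lambda>\<theta>. (g + z /\<^sub>R 2) + of_real \<rho> * cis (2 * \<theta> - \<phi>)) ` {x..y}"
        unfolding path_image_part_circlepath' closed_segment_eq_real_ivl by (simp add: image_image)
      also have "\<dots> = Z g ` {x..y}"
        by (intro image_cong) (simp_all add: Z)
      finally show ?thesis .
    qed
    moreover have "pathstart ?p = Z g x" "pathfinish ?p = Z g y"
      using xy by (simp_all add: Z cis_conv_exp)
    moreover have "shape_of g c = Ccw (g + z /\<^sub>R 2)" by (simp add: shape_of_def circle z_def)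
    ultimately show ?thesis by metis
  next
    case disk
    define \<rho> where "\<rho> = n0 c"
    have R: "R \<theta> = \<rho>" if "x \<le> \<theta>" "\<theta> \<le> y" for \<theta>
      using r[OF that] by (simp add: disk radius_def numer_def denom_def \<rho>_def)
    have \<rho>: "0 < \<rho>" using R[of x] R_pos[of x] xy by simp
    have Z: "Z g \<theta> = g + of_real \<rho> * cis \<theta>" if "x \<le> \<theta>" "\<theta> \<le> y" for \<theta>
      using that by (simp add: Z_def R scaleR_conv_of_real)
    let ?p = "part_circlepath g \<rho> x y"
    have "traces (Z g x) (Ccw g) (Z g y) ?p"
      using \<rho> xy by (intro traces.intros Z) auto
    moreover have "arc ?p" using \<rho> xy by (intro arc_part_circlepath) auto
    moreover have "path_image ?p = Z g ` {x..y}"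
      unfolding path_image_part_circlepath' using xy
      by (intro image_cong) (auto simp: closed_segment_eq_real_ivl Z)
    moreover have "pathstart ?p = Z g x" "pathfinish ?p = Z g y"
      using xy by (simp_all add: Z cis_conv_exp)
    moreover have "shape_of g c = Ccw g" by (simp add: shape_of_def disk)
    ultimately show ?thesis by metis
  next
    case line
    have "R \<theta> * (mv c \<bullet> cis \<theta>) = 1" if "x \<le> \<theta>" "\<theta> \<le> y" for \<theta>
      using r[OF that] by (simp add: line radius_def numer_def denom_def)
    then have "closed_segment (Z g x) (Z g y) = Z g ` {x..y}"
      by (rule line_piece[OF xy])
    moreover have "Z g x \<noteq> Z g y" using Z_inj[of g x y] xy by auto
    moreover have "shape_of g c = Straight" by (simp add: shape_of_def line)
    ultimately show ?thesis
      using traces.intros(1)[of "Z g x" "Z g y"] by (intro exI[of _ "linepath (Z g x) (Z g y)"]) auto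
  qed
qed

text \<open>The sectors make up one full turn, so the joined pieces have the frontier of
  \<open>V\<close> as their image, and \<open>closed_region_eq_V\<close> identifies the enclosed
  region from that image.\<close>

theorem describes_V:
  assumes K: "2 \<le> K"
    and f: "\<And>i. i < K \<Longrightarrow> f i < f (Suc i) \<and> f (Suc i) < f i + pi \<and> gap T (f i) (f (Suc i))"
    and loop: "f K = f 0 + 2 * pi"
    and T: "\<And>c c'. c \<in> set cons \<Longrightarrow> c' \<in> set cons \<Longrightarrow> set (breaks c c') \<subseteq> T"
    and c: "\<And>i. i < K \<Longrightarrow> c i \<in> set cons \<and> (\<exists>m. f i < m \<and> m < f (Suc i) \<and> active (c i) (cis m) \<and>
      (\<forall>c'\<in>set cons. active c' (cis m) \<longrightarrow> radius (c i) (cis m) \<le> radius c' (cis m)))"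
  shows "describes (Boundary (map (\<lambda>i. (g + radius (c i) (cis (f i)) *\<^sub>R cis (f i), shape_of g (c i))) [0..<K]))
    ((+) g ` V)"
proof -
  have onf: "R \<theta> = radius (c i) (cis \<theta>) \<and> 0 < denom (c i) (cis \<theta>)"
    if i: "i < K" and th: "f i \<le> \<theta>" "\<theta> \<le> f (Suc i)" for i \<theta>
  proof -
    obtain m where m: "f i < m" "m < f (Suc i)" "active (c i) (cis m)"
      "\<And>c'. c' \<in> set cons \<Longrightarrow> active c' (cis m) \<Longrightarrow> radius (c i) (cis m) \<le> radius c' (cis m)"
      using c[OF i] by auto
    have g: "gap T (f i) (f (Suc i))" and ci: "c i \<in> set cons" using f[OF i] c[OF i] by auto
    show ?thesis
      using R_on_gap[OF g T m(1,2) ci m(3,4) th] by blast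
  qed
  have "\<exists>p. traces (Z g (f i)) (shape_of g (c i)) (Z g (f (Suc i))) p \<and> arc p \<and>
      path_image p = Z g ` {f i..f (Suc i)} \<and> pathstart p = Z g (f i) \<and> pathfinish p = Z g (f (Suc i))"
    if i: "i < K" for i
    using f[OF i] c[OF i] onf[OF i] by (intro piece regular_cons) auto
  then obtain p where p: "\<And>i. i < K \<Longrightarrow> traces (Z g (f i)) (shape_of g (c i)) (Z g (f (Suc i))) (p i) \<and> arc (p i) \<and>
      path_image (p i) = Z g ` {f i..f (Suc i)} \<and> pathstart (p i) = Z g (f i) \<and> pathfinish (p i) = Z g (f (Suc i))"
    by metis
  define ps where "ps = map p [0..<K]"
  have ZK: "Z g (f K) = Z g (f 0)"
    unfolding loop Z_def R_periodic by (simp flip: cis_mult)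
  have sp: "simple_path (join_list ps) \<and> path_image (join_list ps) = Z g ` {f 0..f (length ps)}"
  proof (rule join_list_loop)
    show "2 \<le> length ps" using K by (simp add: ps_def)
    show "arc (ps ! i) \<and> path_image (ps ! i) = Z g ` {f i..f (Suc i)} \<and>
      pathstart (ps ! i) = Z g (f i) \<and> pathfinish (ps ! i) = Z g (f (Suc i)) \<and> f i < f (Suc i)"
      if "i < length ps" for i
      using p[of i] f[of i] that by (simp add: ps_def)
    show "Z g (f (length ps)) = Z g (f 0)" using ZK by (simp add: ps_def)
    show "inj_on (Z g) {f 0..<f (length ps)}"
      using loop by (auto simp: inj_on_def ps_def intro!: Z_inj[of g])
  qed
  have "Z g ` {f 0..f (length ps)} = (+) g ` frontier V"
  proof -
    have "\<exists>s\<in>{f 0..f K}. Z g s = Z g t" for t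
    proof -
      define k where "k = \<lfloor>(t - f 0) / (2 * pi)\<rfloor>"
      define s where "s = t - 2 * pi * k"
      have "of_int k \<le> (t - f 0) / (2 * pi)" "(t - f 0) / (2 * pi) < of_int k + 1"
        unfolding k_def by linarith+
      then have "f 0 \<le> s" "s \<le> f 0 + 2 * pi"
        using pi_gt_zero by (simp_all add: s_def field_simps)
      moreover have "cis s = cis t"
        by (simp add: s_def flip: cis_divide)
      then have "Z g s = Z g t" by (simp add: Z_def R_def)
      ultimately show ?thesis using loop by auto
    qed
    then have "Z g ` {f 0..f K} = range (Z g)"
      by (auto simp: image_iff) metis
    also have "\<dots> = (+) g ` frontier V" by (auto simp: frontier_V Z_def)
    finally show ?thesis by (simp add: ps_def)
  qed
  then have region: "closed_region (join_list ps) = (+) g ` V"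
    using sp by (intro closed_region_eq_V) simp
  have start: "Z g (f i) = g + radius (c i) (cis (f i)) *\<^sub>R cis (f i)" if "i < K" for i
    using onf[OF that, of "f i"] f[OF that] by (simp add: Z_def)
  let ?bs = "map (\<lambda>i. (g + radius (c i) (cis (f i)) *\<^sub>R cis (f i), shape_of g (c i))) [0..<K]"
  have "traces (fst (?bs ! i)) (snd (?bs ! i)) (fst (?bs ! (Suc i mod length ?bs))) (ps ! i)"
    if i: "i < length ?bs" for i
  proof -
    have "fst (?bs ! (Suc i mod K)) = Z g (f (Suc i))"
    proof (cases "Suc i = K")
      \<comment> \<open>The last piece ends one full turn after the start, hence at the starting
        point of piece 0.\<close>
      case True
      then show ?thesis using start[of 0] ZK K by simp
    next
      case False
      then show ?thesis using start[of "Suc i"] i by simp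
    qed
    then show ?thesis using p[of i] i start[of i] by (simp add: ps_def)
  qed
  moreover have "length ps = length ?bs" by (simp add: ps_def)
  ultimately show ?thesis
    using K sp region by (simp only: describes.simps) (intro conjI exI[of _ ps]; auto)
qed

end

section \<open>Reasoning about programs\<close>

text \<open>Bounds the running time if every loop makes at most \<open>N\<close> iterations each time it is entered.\<close>

primrec time_bound :: "nat \<Rightarrow> com \<Rightarrow> nat" where
  "time_bound N Skip = 1"
| "time_bound N (NAssign x e f) = 1 + ncost e + ncost f"
| "time_bound N (RAssign x e f) = 1 + ncost e + rcost f"
| "time_bound N (Seq c d) = time_bound N c + time_bound N d"
| "time_bound N (Cond b c d) = 1 + bcost b + (time_bound N c + time_bound N d)"
| "time_bound N (While b c) = 1 + bcost b + N * (1 + bcost b + time_bound N c)"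

text \<open>The program is fixed, and each loop contributes one factor \<open>N\<close>, the
  polynomial \<open>[:0, 1:]\<close>.\<close>

lemma time_bound_poly: "\<exists>p :: nat poly. \<forall>N. time_bound N c = poly p N"
proof (induction c)
  case Skip
  show ?case by (rule exI[of _ "[:1:]"]) simp
next
  case (NAssign x e f)
  show ?case by (rule exI[of _ "[:1 + ncost e + ncost f:]"]) simp
next
  case (RAssign x e f)
  show ?case by (rule exI[of _ "[:1 + ncost e + rcost f:]"]) simp
next
  case (Seq c d)
  then obtain p q where "\<forall>N. time_bound N c = poly p N" "\<forall>N. time_bound N d = poly q N" by blast
  then show ?case by (intro exI[of _ "p + q"]) simp
next
  case (Cond b c d)
  then obtain p q where "\<forall>N. time_bound N c = poly p N" "\<forall>N. time_bound N d = poly q N" by blast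
  then show ?case by (intro exI[of _ "[:1 + bcost b:] + (p + q)"]) simp
next
  case (While b c)
  then obtain p where "\<forall>N. time_bound N c = poly p N" by blast
  then show ?case
    by (intro exI[of _ "[:1 + bcost b:] + [:0, 1:] * ([:1 + bcost b:] + p)"]) simp
qed

section \<open>Frame conditions and total correctness\<close>

primrec nmods :: "com \<Rightarrow> array_name set" where
  "nmods Skip = {}"
| "nmods (NAssign x e f) = {x}"
| "nmods (RAssign x e f) = {}"
| "nmods (Seq c d) = nmods c \<union> nmods d"
| "nmods (Cond b c d) = nmods c \<union> nmods d"
| "nmods (While b c) = nmods c"

primrec rmods :: "com \<Rightarrow> array_name set" where
  "rmods Skip = {}"
| "rmods (NAssign x e f) = {}"
| "rmods (RAssign x e f) = {x}"
| "rmods (Seq c d) = rmods c \<union> rmods d"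
| "rmods (Cond b c d) = rmods c \<union> rmods d"
| "rmods (While b c) = rmods c"

definition agree :: "com \<Rightarrow> state \<Rightarrow> state \<Rightarrow> bool" where
  "agree c s s' \<longleftrightarrow> (\<forall>x. x \<notin> nmods c \<longrightarrow> nats s' x = nats s x) \<and> (\<forall>x. x \<notin> rmods c \<longrightarrow> reals s' x = reals s x)"

lemma agreeD:
  "agree c s s' \<Longrightarrow> x \<notin> nmods c \<Longrightarrow> nats s' x = nats s x"
  "agree c s s' \<Longrightarrow> x \<notin> rmods c \<Longrightarrow> reals s' x = reals s x"
  by (auto simp: agree_def)

lemma state_upd_simps [simp]:
  "nats (nupd x i v s) y = (if y = x then (nats s x)(i := v) else nats s y)"
  "reals (nupd x i v s) = reals s"
  "reals (rupd x i r s) y = (if y = x then (reals s x)(i := r) else reals s y)"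
  "nats (rupd x i r s) = nats s"
  by (auto simp: nupd_def rupd_def)

lemma exec_agree: "exec c s t s' \<Longrightarrow> agree c s s'"
  by (induction rule: exec.induct) (auto simp: agree_def)

text \<open>Total correctness with the time bound built in, so that the verification of a program
  never mentions its cost.\<close>

definition runs :: "nat \<Rightarrow> com \<Rightarrow> state \<Rightarrow> (state \<Rightarrow> bool) \<Rightarrow> bool" where
  "runs N c s Q \<longleftrightarrow> (\<exists>t s'. exec c s t s' \<and> t \<le> time_bound N c \<and> Q s')"

lemma runs_frame:
  assumes "runs N c s Q" "\<And>s'. Q s' \<Longrightarrow> agree c s s' \<Longrightarrow> Q' s'"
  shows "runs N c s Q'"
  using assms exec_agree unfolding runs_def by blast

lemma runs_mono: "runs N c s Q \<Longrightarrow> (\<And>s'. Q s' \<Longrightarrow> Q' s') \<Longrightarrow> runs N c s Q'"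
  unfolding runs_def by blast

lemma runs_Skip: "Q s \<Longrightarrow> runs N Skip s Q"
  unfolding runs_def using exec.Skip by fastforce

lemma runs_NAssign: "Q (nupd x (nval e s) (nval f s) s) \<Longrightarrow> runs N (NAssign x e f) s Q"
  unfolding runs_def using exec.NAssign by fastforce

lemma runs_RAssign: "Q (rupd x (nval e s) (rval f s) s) \<Longrightarrow> runs N (RAssign x e f) s Q"
  unfolding runs_def using exec.RAssign by fastforce

lemma runs_Seq: "runs N c s (\<lambda>s'. runs N d s' Q) \<Longrightarrow> runs N (Seq c d) s Q"
  unfolding runs_def using exec.Seq by (metis (no_types, lifting) add_mono time_bound.simps(4))

lemma runs_Cond:
  assumes "bval b s \<Longrightarrow> runs N c s Q" "\<not> bval b s \<Longrightarrow> runs N d s Q"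
  shows "runs N (Cond b c d) s Q"
proof (cases "bval b s")
  case True
  then obtain t s' where "exec c s t s'" "t \<le> time_bound N c" "Q s'" using assms(1) by (auto simp: runs_def)
  then show ?thesis using CondTrue[OF True] unfolding runs_def by fastforce
next
  case False
  then obtain t s' where "exec d s t s'" "t \<le> time_bound N d" "Q s'" using assms(2) by (auto simp: runs_def)
  then show ?thesis using CondFalse[OF False] unfolding runs_def by fastforce
qed

text \<open>For proofs that name the intermediate states instead of nesting
  \<open>runs\<close>.\<close>

definition reaches :: "nat \<Rightarrow> com \<Rightarrow> state \<Rightarrow> state \<Rightarrow> bool" where
  "reaches N c s s' \<longleftrightarrow> (\<exists>t. exec c s t s' \<and> t \<le> time_bound N c)"

lemma runsE:
  assumes "runs N c s Q"
  obtains s' where "reaches N c s s'" "agree c s s'" "Q s'"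
  using assms exec_agree unfolding runs_def reaches_def by blast

lemma reaches_Seq: "reaches N c s s' \<Longrightarrow> runs N d s' Q \<Longrightarrow> runs N (Seq c d) s Q"
  by (rule runs_Seq) (auto simp: runs_def reaches_def)

definition For :: "array_name \<Rightarrow> nexp \<Rightarrow> com \<Rightarrow> com" where
  "For x e c = Seq (NAssign x (NConst 0) (NConst 0))
     (While (BNot (NLe e (NArr x (NConst 0))))
       (Seq c (NAssign x (NConst 0) (NAdd (NArr x (NConst 0)) (NConst 1)))))"

lemma mods_For [simp]: "nmods (For x e c) = insert x (nmods c)" "rmods (For x e c) = rmods c"
  by (auto simp: For_def)

text \<open>\<open>I i\<close> is the state of affairs after \<open>i\<close> rounds with the
  counter already advanced. The bound \<open>e\<close> is evaluated anew before each round, so it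
  has to be shown constant; \<open>agree\<close> makes everything that the loop does not write
  available.\<close>

lemma runs_For:
  assumes I0: "I 0 (nupd x 0 0 s)"
    and step: "\<And>i s'. i < n \<Longrightarrow> I i s' \<Longrightarrow> nats s' x 0 = i \<Longrightarrow> agree (For x e c) s s' \<Longrightarrow>
      runs N c s' (\<lambda>s''. I (Suc i) (nupd x 0 (Suc i) s''))"
    and e: "\<And>i s'. I i s' \<Longrightarrow> nats s' x 0 = i \<Longrightarrow> agree (For x e c) s s' \<Longrightarrow> nval e s' = n"
    and n: "n \<le> N" and x: "x \<notin> nmods c"
    and fin: "\<And>s'. I n s' \<Longrightarrow> agree (For x e c) s s' \<Longrightarrow> Q s'"
  shows "runs N (For x e c) s Q"
proof -
  let ?b = "BNot (NLe e (NArr x (NConst 0)))"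
  let ?d = "Seq c (NAssign x (NConst 0) (NAdd (NArr x (NConst 0)) (NConst 1)))"
  have loop: "\<exists>t s''. exec (While ?b ?d) s' t s'' \<and>
      t \<le> 1 + bcost ?b + (n - i) * (1 + bcost ?b + time_bound N ?d) \<and> I n s'' \<and> agree (For x e c) s s''"
    if "i \<le> n" "I i s'" "nats s' x 0 = i" "agree (For x e c) s s'" for i s'
    using that
  proof (induction "n - i" arbitrary: i s')
    case 0
    then have "i = n" by simp
    then have "\<not> bval ?b s'" using e[OF 0(3-5)] 0 by simp
    then have "exec (While ?b ?d) s' (1 + bcost ?b) s'" by (rule WhileFalse)
    then show ?case using 0 \<open>i = n\<close> by (metis add.right_neutral le_refl diff_self_eq_0 mult_0)
  next
    case (Suc m)
    then have i: "i < n" by simp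
    then have b: "bval ?b s'" using e[OF Suc(4-6)] Suc by simp
    obtain t1 s1 where c: "exec c s' t1 s1" "t1 \<le> time_bound N c" "I (Suc i) (nupd x 0 (Suc i) s1)"
      using step[OF i Suc(4-6)] by (auto simp: runs_def)
    have x1: "nats s1 x 0 = i" using agreeD(1)[OF exec_agree[OF c(1)] x] Suc by simp
    let ?a = "NAssign x (NConst 0) (NAdd (NArr x (NConst 0)) (NConst 1))"
    have a: "exec ?a s1 (time_bound N ?a) (nupd x 0 (Suc i) s1)"
      using exec.NAssign[of x "NConst 0" "NAdd (NArr x (NConst 0)) (NConst 1)" s1] x1 by simp
    have d: "exec ?d s' (t1 + time_bound N ?a) (nupd x 0 (Suc i) s1)"
      by (rule exec.Seq[OF c(1) a])
    have ag: "agree (For x e c) s (nupd x 0 (Suc i) s1)"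
      using Suc(6) exec_agree[OF c(1)] by (auto simp: agree_def)
    obtain t2 s2 where r: "exec (While ?b ?d) (nupd x 0 (Suc i) s1) t2 s2"
      "t2 \<le> 1 + bcost ?b + (n - Suc i) * (1 + bcost ?b + time_bound N ?d)" "I n s2" "agree (For x e c) s s2"
    proof -
      have "m = n - Suc i" "nats (nupd x 0 (Suc i) s1) x 0 = Suc i" using Suc(2) i by simp_all
      then show thesis using Suc(1)[OF _ Suc_leI[OF i] c(3) _ ag] that by blast
    qed
    have "n - i = Suc (n - Suc i)" using i by simp
    then have "1 + bcost ?b + (t1 + time_bound N ?a) + t2 \<le>
        1 + bcost ?b + (n - i) * (1 + bcost ?b + time_bound N ?d)"
      using r(2) c(2) by simp
    then show ?case using WhileTrue[OF b d r(1)] r(3,4) by blast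
  qed
  let ?i = "NAssign x (NConst 0) (NConst 0)"
  have i: "exec ?i s (time_bound N ?i) (nupd x 0 0 s)"
    using exec.NAssign[of x "NConst 0" "NConst 0" s] by simp
  have "agree (For x e c) s (nupd x 0 0 s)" by (auto simp: agree_def)
  then obtain t s' where w: "exec (While ?b ?d) (nupd x 0 0 s) t s'"
    "t \<le> 1 + bcost ?b + (n - 0) * (1 + bcost ?b + time_bound N ?d)" "I n s'" "agree (For x e c) s s'"
    using loop[of 0 "nupd x 0 0 s"] I0 by auto
  have "n * (1 + bcost ?b + time_bound N ?d) \<le> N * (1 + bcost ?b + time_bound N ?d)"
    using n by (rule mult_le_mono1)
  then have "time_bound N ?i + t \<le> time_bound N (For x e c)"
    using w(2) by (simp add: For_def)
  moreover have "exec (For x e c) s (time_bound N ?i + t) s'"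
    unfolding For_def by (rule exec.Seq[OF i w(1)])
  ultimately show ?thesis
    using fin w(3,4) unfolding runs_def by blast
qed

abbreviation NV :: "array_name \<Rightarrow> nexp" where "NV x \<equiv> NArr x (NConst 0)"
abbreviation RV :: "array_name \<Rightarrow> rexp" where "RV x \<equiv> RArr x (NConst 0)"
abbreviation NSet :: "array_name \<Rightarrow> nexp \<Rightarrow> com" where "NSet x e \<equiv> NAssign x (NConst 0) e"
abbreviation RSet :: "array_name \<Rightarrow> rexp \<Rightarrow> com" where "RSet x e \<equiv> RAssign x (NConst 0) e"
abbreviation RNum :: "nat \<Rightarrow> rexp" where "RNum k \<equiv> RNat (NConst k)"

notation Seq (infixr ";;" 60)

lemmas runs_straight = runs_Seq runs_NAssign runs_RAssign runs_Skip

section \<open>The successor of each vertex on its boundary curve\<close>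

text \<open>\<open>i\<close> counts the vertices over all curves, and \<open>b\<close> is where the
  current curve begins; the last vertex of a curve is sent back to \<open>b\<close>. At the end
  \<open>i\<close> is the number of edges, the loop bound of \<open>cons_prog\<close>.\<close>

definition succ_prog :: com where
  "succ_prog =
     NSet ''i'' (NConst 0) ;;
     For ''c'' (NV ''curves'')
       (NSet ''b'' (NV ''i'') ;;
        For ''j'' (NArr ''lengths'' (NV ''c''))
          (Cond (NLe (NArr ''lengths'' (NV ''c'')) (NAdd (NV ''j'') (NConst 1)))
             (NAssign ''s'' (NV ''i'') (NV ''b''))
             (NAssign ''s'' (NV ''i'') (NAdd (NV ''i'') (NConst 1))) ;;
           NSet ''i'' (NAdd (NV ''i'') (NConst 1))))"

lemma mods_succ_prog [simp]:
  "nmods succ_prog = {''i'', ''c'', ''b'', ''j'', ''s''}" "rmods succ_prog = {}"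
  by (auto simp: succ_prog_def)

definition offset :: "'a list list \<Rightarrow> nat \<Rightarrow> nat" where
  "offset hs c = length (concat (take c hs))"

lemma offset_Suc: "c < length hs \<Longrightarrow> offset hs (Suc c) = offset hs c + length (hs ! c)"
  by (simp add: offset_def take_Suc_conv_app_nth)

lemma offset_mono: "c \<le> d \<Longrightarrow> offset hs c \<le> offset hs d"
proof -
  assume "c \<le> d"
  then have "take d hs = take c hs @ take (d - c) (drop c hs)"
    by (metis le_add_diff_inverse take_add)
  then show ?thesis by (simp add: offset_def)
qed

lemma offset_less:
  assumes "c < d" "d \<le> length hs" "j < length (hs ! c)"
  shows "offset hs c + j < offset hs d"
  using offset_mono[of "Suc c" d hs] offset_Suc[of c hs] assms by simp

lemma nth_concat_offset:
  assumes "c < length hs" "j < length (hs ! c)"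
  shows "concat hs ! (offset hs c + j) = hs ! c ! j"
proof -
  have "hs = take c hs @ hs ! c # drop (Suc c) hs" using assms(1) by (rule id_take_nth_drop)
  then have "concat hs = concat (take c hs) @ hs ! c @ concat (drop (Suc c) hs)"
    by (metis concat.simps(2) concat_append)
  then show ?thesis using assms(2) by (simp add: offset_def nth_append)
qed

lemma offset_surj:
  assumes "p < offset hs d" "d \<le> length hs"
  obtains c j where "c < d" "j < length (hs ! c)" "p = offset hs c + j"
proof -
  have "\<exists>c j. c < d \<and> j < length (hs ! c) \<and> p = offset hs c + j"
    using assms
  proof (induction d)
    case 0
    then show ?case by (simp add: offset_def)
  next
    case (Suc d)
    show ?case
    proof (cases "p < offset hs d")
      case True
      then show ?thesis using Suc by (auto intro: less_SucI)
    next
      case False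
      then show ?thesis using Suc offset_Suc[of d hs] by (intro exI[of _ d] exI[of _ "p - offset hs d"]) auto
    qed
  qed
  then show thesis using that by blast
qed

definition succ_ok :: "'a list list \<Rightarrow> (nat \<Rightarrow> nat) \<Rightarrow> nat \<Rightarrow> nat \<Rightarrow> bool" where
  "succ_ok hs f c j \<longleftrightarrow> f (offset hs c + j) = offset hs c + (if Suc j < length (hs ! c) then Suc j else 0)"

lemma succ_ok_step:
  assumes "\<forall>c'<c. \<forall>j<length (hs ! c'). succ_ok hs f c' j" "\<forall>j'<j. succ_ok hs f c j'"
    and c: "c < length hs" "j < length (hs ! c)"
    and p: "p = offset hs c + j"
    and v: "v = offset hs c + (if Suc j < length (hs ! c) then Suc j else 0)"
  shows "\<forall>c'<c. \<forall>j<length (hs ! c'). succ_ok hs (f(p := v)) c' j"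
    "\<forall>j'<Suc j. succ_ok hs (f(p := v)) c j'"
proof -
  have "offset hs c' + j' \<noteq> p" if "c' < c" "j' < length (hs ! c')" for c' j'
    using offset_less[OF that(1) _ that(2)] c p by auto
  then show "\<forall>c'<c. \<forall>j<length (hs ! c'). succ_ok hs (f(p := v)) c' j"
    using assms(1) by (auto simp: succ_ok_def)
  show "\<forall>j'<Suc j. succ_ok hs (f(p := v)) c j'"
    using assms(2) p v by (auto simp: succ_ok_def less_Suc_eq)
qed

lemma runs_succ_prog:
  assumes cs: "nats s ''curves'' 0 = length hs"
    and ls: "\<And>c. c < length hs \<Longrightarrow> nats s ''lengths'' c = length (hs ! c)"
    and N: "length hs \<le> N" "\<And>h. h \<in> set hs \<Longrightarrow> length h \<le> N"
  shows "runs N succ_prog s (\<lambda>s'. nats s' ''i'' 0 = length (concat hs) \<and>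
    (\<forall>c<length hs. \<forall>j<length (hs ! c). succ_ok hs (nats s' ''s'') c j))"
  unfolding succ_prog_def
proof (rule runs_Seq, rule runs_NAssign, rule runs_For[where n = "length hs" and
      I = "\<lambda>c s'. nats s' ''i'' 0 = offset hs c \<and> (\<forall>c'<c. \<forall>j<length (hs ! c'). succ_ok hs (nats s' ''s'') c' j)"],
    goal_cases)
  case 1
  show ?case by (simp add: offset_def)
next
  case (2 c s1)
  have s1: "nats s1 ''curves'' = nats s ''curves''" "nats s1 ''lengths'' = nats s ''lengths''"
    using agreeD(1)[OF 2(4)] by auto
  have off: "nats s1 ''i'' 0 = offset hs c" and ok: "\<forall>c'<c. \<forall>j<length (hs ! c'). succ_ok hs (nats s1 ''s'') c' j"
    using 2(2) by auto
  show ?case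
  proof (rule runs_Seq, rule runs_NAssign, rule runs_For[where n = "length (hs ! c)" and
      I = "\<lambda>j s'. nats s' ''i'' 0 = offset hs c + j \<and> nats s' ''b'' 0 = offset hs c \<and>
        (\<forall>c'<c. \<forall>j<length (hs ! c'). succ_ok hs (nats s' ''s'') c' j) \<and>
        (\<forall>j'<j. succ_ok hs (nats s' ''s'') c j')"], goal_cases)
    case 1
    then show ?case using off ok by simp
  next
    case (2 j s2)
    have s2: "nats s2 ''c'' 0 = c" "nats s2 ''lengths'' c = length (hs ! c)"
      using agreeD(1)[OF 2(4)] s1 ls \<open>nats s1 ''c'' 0 = c\<close> \<open>c < length hs\<close> by auto
    have I: "nats s2 ''i'' 0 = offset hs c + j" "nats s2 ''b'' 0 = offset hs c" "nats s2 ''j'' 0 = j"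
      "\<forall>c'<c. \<forall>j<length (hs ! c'). succ_ok hs (nats s2 ''s'') c' j"
      "\<forall>j'<j. succ_ok hs (nats s2 ''s'') c j'" using 2 by auto
    show ?case
      by (intro runs_Seq runs_NAssign runs_Cond)
        (use succ_ok_step[OF I(4,5) \<open>c < length hs\<close> \<open>j < length (hs ! c)\<close>] I s2 in auto)
  next
    case (3 j s2)
    then show ?case
      using agreeD(1)[OF 3(3)] s1 ls \<open>nats s1 ''c'' 0 = c\<close> \<open>c < length hs\<close> by auto
  next
    case 4
    then show ?case using N(2) \<open>c < length hs\<close> by simp
  next
    case 5
    then show ?case by simp
  next
    case (6 s2)
    then show ?case
      using \<open>c < length hs\<close> by (auto simp: offset_Suc less_Suc_eq)
  qed
next
  case (3 c s1)
  then show ?case using agreeD(1)[OF 3(3)] cs by auto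
next
  case 4
  then show ?case using N by simp
next
  case 5
  then show ?case by auto
next
  case (6 s1)
  then show ?case by (simp add: offset_def)
qed

text \<open>Links the computed successor indices with the edges that \<open>closed_polyline\<close>
  obtains by rotating each vertex list.\<close>

lemma cyclic_edges:
  assumes ok: "\<And>c j. c < length hs \<Longrightarrow> j < length (hs ! c) \<Longrightarrow> succ_ok hs f c j"
  shows "(\<lambda>p. (concat hs ! p, concat hs ! f p)) ` {..<length (concat hs)} =
    (\<Union>h\<in>set hs. set (zip h (rotate1 h)))" (is "?L = ?R")
proof -
  have e: "concat hs ! f (offset hs c + j) = rotate1 (hs ! c) ! j"
    if "c < length hs" "j < length (hs ! c)" for c j
  proof -
    have "f (offset hs c + j) = offset hs c + (Suc j mod length (hs ! c))"
      using ok[OF that] that by (auto simp: succ_ok_def mod_Suc)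
    moreover have "Suc j mod length (hs ! c) < length (hs ! c)" using that by (intro mod_less_divisor) auto
    ultimately show ?thesis
      using nth_concat_offset[OF that(1)] that by (simp add: nth_rotate1)
  qed
  have n: "length (concat hs) = offset hs (length hs)" by (simp add: offset_def)
  show ?thesis
  proof (intro equalityI subsetI)
    fix z assume "z \<in> ?L"
    then obtain p where p: "p < offset hs (length hs)" "z = (concat hs ! p, concat hs ! f p)"
      using n by auto
    obtain c j where cj: "c < length hs" "j < length (hs ! c)" "p = offset hs c + j"
      using offset_surj[OF p(1) order_refl] .
    have "z = zip (hs ! c) (rotate1 (hs ! c)) ! j"
      using cj e[OF cj(1,2)] nth_concat_offset[OF cj(1,2)] by (simp add: p(2))
    then show "z \<in> ?R"
      using cj by (auto simp: in_set_conv_nth intro!: bexI[of _ "hs ! c"])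
  next
    fix z assume "z \<in> ?R"
    then obtain h where h: "h \<in> set hs" "z \<in> set (zip h (rotate1 h))" by auto
    obtain c where c: "c < length hs" "h = hs ! c" using h(1) by (auto simp: in_set_conv_nth)
    obtain j where j: "j < length (hs ! c)" "z = (hs ! c ! j, rotate1 (hs ! c) ! j)"
      using h(2) c by (auto simp: in_set_conv_nth)
    show "z \<in> ?L"
      unfolding n using offset_less[OF c(1) order_refl j(1)] e[OF c(1) j(1)] nth_concat_offset[OF c(1) j(1)] j(2)
      by (intro image_eqI[of _ _ "offset hs c + j"]) auto
  qed
qed

lemma runs_Seq_frame:
  assumes "runs N c s P" "\<And>s'. P s' \<Longrightarrow> agree c s s' \<Longrightarrow> runs N d s' Q"
  shows "runs N (c ;; d) s Q"
  using runs_Seq[OF runs_frame[OF assms]] .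

section \<open>Computing the constraints\<close>

text \<open>Constraint number \<open>k\<close> is stored at index \<open>k\<close> of ten arrays of reals; \<open>C\<close> counts the constraints.\<close>

definition con_at :: "state \<Rightarrow> nat \<Rightarrow> con" where
  "con_at s k = Con (reals s ''n0'' k) (Complex (reals s ''n1'' k) (reals s ''n2'' k))
     (reals s ''m0'' k) (Complex (reals s ''m1'' k) (reals s ''m2'' k))
     (Complex (reals s ''d1'' k) (reals s ''d2'' k)) (Complex (reals s ''e1'' k) (reals s ''e2'' k))"

definition con_list :: "state \<Rightarrow> con list" where
  "con_list s = map (con_at s) [0..<nats s ''C'' 0]"

definition con_names :: "string set" where
  "con_names = {''n0'', ''n1'', ''n2'', ''m0'', ''m1'', ''m2'', ''d1'', ''d2'', ''e1'', ''e2''}"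

definition add_con :: "rexp \<Rightarrow> rexp \<Rightarrow> rexp \<Rightarrow> rexp \<Rightarrow> rexp \<Rightarrow> rexp \<Rightarrow> rexp \<Rightarrow> rexp \<Rightarrow> rexp \<Rightarrow> rexp \<Rightarrow> com" where
  "add_con r0 r1 r2 r3 r4 r5 r6 r7 r8 r9 =
     RAssign ''n0'' (NV ''C'') r0 ;; RAssign ''n1'' (NV ''C'') r1 ;; RAssign ''n2'' (NV ''C'') r2 ;;
     RAssign ''m0'' (NV ''C'') r3 ;; RAssign ''m1'' (NV ''C'') r4 ;; RAssign ''m2'' (NV ''C'') r5 ;;
     RAssign ''d1'' (NV ''C'') r6 ;; RAssign ''d2'' (NV ''C'') r7 ;;
     RAssign ''e1'' (NV ''C'') r8 ;; RAssign ''e2'' (NV ''C'') r9 ;;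
     NSet ''C'' (NAdd (NV ''C'') (NConst 1))"

lemma mods_add_con [simp]:
  "nmods (add_con r0 r1 r2 r3 r4 r5 r6 r7 r8 r9) = {''C''}"
  "rmods (add_con r0 r1 r2 r3 r4 r5 r6 r7 r8 r9) = con_names"
  by (auto simp: add_con_def con_names_def)

text \<open>The ten expressions are evaluated one after another, when some constraint arrays have
  already been written. Hence their values are required in all states that differ from
  \<open>s\<close> only in these arrays.\<close>

lemma runs_add_con:
  assumes "\<And>s'. nats s' = nats s \<Longrightarrow> (\<And>x. x \<notin> con_names \<Longrightarrow> reals s' x = reals s x) \<Longrightarrow>
    Con (rval r0 s') (Complex (rval r1 s') (rval r2 s')) (rval r3 s') (Complex (rval r4 s') (rval r5 s'))
      (Complex (rval r6 s') (rval r7 s')) (Complex (rval r8 s') (rval r9 s')) = c"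
  shows "runs N (add_con r0 r1 r2 r3 r4 r5 r6 r7 r8 r9) s (\<lambda>s'. con_list s' = con_list s @ [c])"
proof -
  have r: "rval r0 s' = n0 c" "rval r1 s' = Re (nv c)" "rval r2 s' = Im (nv c)" "rval r3 s' = m0 c"
    "rval r4 s' = Re (mv c)" "rval r5 s' = Im (mv c)" "rval r6 s' = Re (d1 c)" "rval r7 s' = Im (d1 c)"
    "rval r8 s' = Re (d2 c)" "rval r9 s' = Im (d2 c)"
    if "nats s' = nats s" "\<And>x. x \<notin> con_names \<Longrightarrow> reals s' x = reals s x" for s'
    using assms[OF that] by (auto dest!: sym[of "Con _ _ _ _ _ _" c])
  define K where "K = nats s ''C'' 0"
  have set: "runs N (RAssign x (NV ''C'') r ;; d) s' Q"
    if "nats s' = nats s" "rval r s' = v" "runs N d (rupd x K v s') Q" for x r v d s' Q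
    using that by (intro runs_Seq runs_RAssign) (simp add: K_def)
  have "runs N (add_con r0 r1 r2 r3 r4 r5 r6 r7 r8 r9) s (\<lambda>s'. s' = nupd ''C'' 0 (Suc K) (rupd ''e2'' K (Im (d2 c)) (rupd ''e1'' K (Re (d2 c)) (rupd ''d2'' K (Im (d1 c)) (rupd ''d1'' K (Re (d1 c)) (rupd ''m2'' K (Im (mv c)) (rupd ''m1'' K (Re (mv c)) (rupd ''m0'' K (m0 c) (rupd ''n2'' K (Im (nv c)) (rupd ''n1'' K (Re (nv c)) (rupd ''n0'' K (n0 c) s)))))))))))"
    unfolding add_con_def
    apply (rule set, simp, rule r(1), simp, simp add: con_names_def)
    apply (rule set, simp, rule r(2), simp, simp add: con_names_def)
    apply (rule set, simp, rule r(3), simp, simp add: con_names_def)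
    apply (rule set, simp, rule r(4), simp, simp add: con_names_def)
    apply (rule set, simp, rule r(5), simp, simp add: con_names_def)
    apply (rule set, simp, rule r(6), simp, simp add: con_names_def)
    apply (rule set, simp, rule r(7), simp, simp add: con_names_def)
    apply (rule set, simp, rule r(8), simp, simp add: con_names_def)
    apply (rule set, simp, rule r(9), simp, simp add: con_names_def)
    apply (rule set, simp, rule r(10), simp, simp add: con_names_def)
    apply (rule runs_NAssign, simp add: K_def)
    done
  then show ?thesis
    by (rule runs_mono) (simp add: con_list_def con_at_def K_def)
qed

definition temps_ok :: "real \<Rightarrow> complex \<Rightarrow> complex \<Rightarrow> state \<Rightarrow> bool" where
  "temps_ok \<alpha> a b s \<longleftrightarrow> reals s ''ax'' 0 = Re a \<and> reals s ''ay'' 0 = Im a \<and>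
     reals s ''bx'' 0 = Re b \<and> reals s ''by'' 0 = Im b \<and>
     reals s ''wx'' 0 = Re (b - a) \<and> reals s ''wy'' 0 = Im (b - a) \<and>
     reals s ''la'' 0 = foot_pos a (b - a) \<and> reals s ''ka'' 0 = sqrt (1 - \<alpha>\<^sup>2) / \<alpha> \<and>
     reals s ''cr'' 0 = cross a b \<and> reals s ''alpha'' 0 = \<alpha>"

text \<open>Minimum and maximum via \<open>sqrt (x * x) = \<bar>x\<bar>\<close>.\<close>

definition rclamp :: "rexp \<Rightarrow> rexp" where
  "rclamp e =
     (let m = RDiv (RSub (RAdd (RNum 1) e) (RSqrt (RMul (RSub (RNum 1) e) (RSub (RNum 1) e)))) (RNum 2)
      in RDiv (RAdd m (RSqrt (RMul m m))) (RNum 2))"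

lemma rval_rclamp [simp]: "rval (rclamp e) s = max 0 (min 1 (rval e s))"
  by (simp add: rclamp_def Let_def max_def min_def abs_if)

definition rdot :: "rexp \<Rightarrow> rexp \<Rightarrow> rexp \<Rightarrow> rexp \<Rightarrow> rexp" where
  "rdot a b c d = RAdd (RMul a c) (RMul b d)"

lemma rval_rdot [simp]: "rval (rdot a b c d) s = rval a s * rval c s + rval b s * rval d s"
  by (simp add: rdot_def)

abbreviation rneg :: "rexp \<Rightarrow> rexp" where "rneg e \<equiv> RSub (RNum 0) e"

definition temps_prog :: com where
  "temps_prog =
     RSet ''ax'' (RSub (RArr ''vx'' (NV ''e'')) (RV ''gx'')) ;;
     RSet ''ay'' (RSub (RArr ''vy'' (NV ''e'')) (RV ''gy'')) ;;
     RSet ''bx'' (RSub (RArr ''vx'' (NArr ''s'' (NV ''e''))) (RV ''gx'')) ;;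
     RSet ''by'' (RSub (RArr ''vy'' (NArr ''s'' (NV ''e''))) (RV ''gy'')) ;;
     RSet ''wx'' (RSub (RV ''bx'') (RV ''ax'')) ;;
     RSet ''wy'' (RSub (RV ''by'') (RV ''ay'')) ;;
     RSet ''la'' (rclamp (RDiv (rneg (rdot (RV ''ax'') (RV ''ay'') (RV ''wx'') (RV ''wy'')))
       (rdot (RV ''wx'') (RV ''wy'') (RV ''wx'') (RV ''wy'')))) ;;
     RSet ''ka'' (RDiv (RSqrt (RSub (RNum 1) (RMul (RV ''alpha'') (RV ''alpha'')))) (RV ''alpha'')) ;;
     RSet ''cr'' (RSub (RMul (RV ''ax'') (RV ''by'')) (RMul (RV ''ay'') (RV ''bx'')))"

lemma runs_RSet:
  assumes "rval e s = v" "runs N d (rupd x 0 v s) Q"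
  shows "runs N (RSet x e ;; d) s Q"
  using assms by (intro runs_Seq runs_RAssign) simp

lemma runs_temps_prog:
  assumes "reals s ''vx'' (nats s ''e'' 0) - reals s ''gx'' 0 = Re a"
    "reals s ''vy'' (nats s ''e'' 0) - reals s ''gy'' 0 = Im a"
    "reals s ''vx'' (nats s ''s'' (nats s ''e'' 0)) - reals s ''gx'' 0 = Re b"
    "reals s ''vy'' (nats s ''s'' (nats s ''e'' 0)) - reals s ''gy'' 0 = Im b"
    "reals s ''alpha'' 0 = \<alpha>"
  shows "runs N temps_prog s (temps_ok \<alpha> a b)"
  unfolding temps_prog_def
  apply (rule runs_RSet[where v = "Re a"], simp add: assms foot_pos_def inner_complex_def power2_eq_square)
  apply (rule runs_RSet[where v = "Im a"], simp add: assms foot_pos_def inner_complex_def power2_eq_square)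
  apply (rule runs_RSet[where v = "Re b"], simp add: assms foot_pos_def inner_complex_def power2_eq_square)
  apply (rule runs_RSet[where v = "Im b"], simp add: assms foot_pos_def inner_complex_def power2_eq_square)
  apply (rule runs_RSet[where v = "Re (b - a)"], simp add: assms foot_pos_def inner_complex_def power2_eq_square)
  apply (rule runs_RSet[where v = "Im (b - a)"], simp add: assms foot_pos_def inner_complex_def power2_eq_square)
  apply (rule runs_RSet[where v = "foot_pos a (b - a)"], simp add: assms foot_pos_def inner_complex_def power2_eq_square)
  apply (rule runs_RSet[where v = "sqrt (1 - \<alpha>\<^sup>2) / \<alpha>"], simp add: assms foot_pos_def inner_complex_def power2_eq_square)
  apply (rule runs_RAssign)
  apply (simp add: temps_ok_def assms cross_def)
  done

definition foot_prog :: com where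
  "foot_prog =
     (let x = RAdd (RV ''ax'') (RMul (RV ''la'') (RV ''wx'')); y = RAdd (RV ''ay'') (RMul (RV ''la'') (RV ''wy'')) in
      add_con (RDiv (RSqrt (rdot x y x y)) (RV ''alpha'')) (RNum 0) (RNum 0) (RNum 1) (RNum 0) (RNum 0)
        (RNum 0) (RNum 0) (RNum 0) (RNum 0))"

definition left_prog :: com where
  "left_prog =
     add_con (RNum 0) (RSub (RV ''ax'') (RMul (RV ''ka'') (RV ''ay''))) (RAdd (RV ''ay'') (RMul (RV ''ka'') (RV ''ax'')))
       (RNum 1) (RNum 0) (RNum 0) (rneg (RV ''ay'')) (RV ''ax'')
       (RAdd (RMul (RV ''ka'') (RV ''ax'')) (RV ''ay'')) (RSub (RMul (RV ''ka'') (RV ''ay'')) (RV ''ax''))"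

definition right_prog :: com where
  "right_prog =
     add_con (RNum 0) (RAdd (RV ''ax'') (RMul (RV ''ka'') (RV ''ay''))) (RSub (RV ''ay'') (RMul (RV ''ka'') (RV ''ax'')))
       (RNum 1) (RNum 0) (RNum 0) (RV ''ay'') (rneg (RV ''ax''))
       (RSub (RMul (RV ''ka'') (RV ''ax'')) (RV ''ay'')) (RAdd (RMul (RV ''ka'') (RV ''ay'')) (RV ''ax''))"

definition line_prog :: com where
  "line_prog =
     add_con (RNum 1) (RNum 0) (RNum 0) (RNum 0) (RDiv (RV ''wy'') (RV ''cr'')) (RDiv (rneg (RV ''wx'')) (RV ''cr''))
       (rneg (RMul (RV ''cr'') (RV ''ay''))) (RMul (RV ''cr'') (RV ''ax''))
       (RMul (RV ''cr'') (RV ''by'')) (rneg (RMul (RV ''cr'') (RV ''bx'')))"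

definition cons_prog :: com where
  "cons_prog = NSet ''C'' (NConst 0) ;; For ''e'' (NV ''i'')
     (temps_prog ;; foot_prog ;; left_prog ;; right_prog ;; line_prog)"

lemma mods_con_progs [simp]:
  "nmods foot_prog = {''C''}" "nmods left_prog = {''C''}" "nmods right_prog = {''C''}" "nmods line_prog = {''C''}"
  "rmods foot_prog = con_names" "rmods left_prog = con_names" "rmods right_prog = con_names" "rmods line_prog = con_names"
  by (simp_all add: foot_prog_def left_prog_def right_prog_def line_prog_def Let_def)

lemma temps_ok_agree:
  "agree c s s' \<Longrightarrow> rmods c = con_names \<Longrightarrow> temps_ok \<alpha> a b s \<Longrightarrow> temps_ok \<alpha> a b s'"
  by (simp add: temps_ok_def agreeD(2) con_names_def)

lemma runs_con_progs:
  assumes t: "temps_ok \<alpha> a b s"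
  defines "k \<equiv> sqrt (1 - \<alpha>\<^sup>2) / \<alpha>"
  shows "runs N foot_prog s (\<lambda>s'. con_list s' = con_list s @ [foot_con \<alpha> a (b - a)] \<and> temps_ok \<alpha> a b s')"
    "runs N left_prog s (\<lambda>s'. con_list s' = con_list s @ [vertex_con 1 k a] \<and> temps_ok \<alpha> a b s')"
    "runs N right_prog s (\<lambda>s'. con_list s' = con_list s @ [vertex_con (- 1) k a] \<and> temps_ok \<alpha> a b s')"
    "runs N line_prog s (\<lambda>s'. con_list s' = con_list s @ [line_con a b] \<and> temps_ok \<alpha> a b s')"
proof -
  note t' = t[unfolded temps_ok_def, folded k_def]
  have fr: "runs N c s (\<lambda>s'. con_list s' = con_list s @ [x] \<and> temps_ok \<alpha> a b s')"
    if "runs N c s (\<lambda>s'. con_list s' = con_list s @ [x])" "rmods c = con_names" for c x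
    using that(1) by (rule runs_frame) (use temps_ok_agree[OF _ that(2) t] in blast)
  show "runs N foot_prog s (\<lambda>s'. con_list s' = con_list s @ [foot_con \<alpha> a (b - a)] \<and> temps_ok \<alpha> a b s')"
    by (rule fr, unfold foot_prog_def Let_def, rule runs_add_con)
      (simp_all add: con_names_def t' foot_con_def cmod_def power2_eq_square complex_eq_iff)
  show "runs N left_prog s (\<lambda>s'. con_list s' = con_list s @ [vertex_con 1 k a] \<and> temps_ok \<alpha> a b s')"
    by (rule fr, unfold left_prog_def, rule runs_add_con)
      (simp_all add: con_names_def t' vertex_con_def complex_eq_iff)
  show "runs N right_prog s (\<lambda>s'. con_list s' = con_list s @ [vertex_con (- 1) k a] \<and> temps_ok \<alpha> a b s')"
    by (rule fr, unfold right_prog_def, rule runs_add_con)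
      (simp_all add: con_names_def t' vertex_con_def complex_eq_iff)
  show "runs N line_prog s (\<lambda>s'. con_list s' = con_list s @ [line_con a b] \<and> temps_ok \<alpha> a b s')"
    by (rule fr, unfold line_prog_def, rule runs_add_con)
      (simp_all add: con_names_def t' line_con_def complex_eq_iff diff_divide_distrib)
qed

lemma mods_temps_prog [simp]:
  "nmods temps_prog = {}"
  "rmods temps_prog = {''ax'', ''ay'', ''bx'', ''by'', ''wx'', ''wy'', ''la'', ''ka'', ''cr''}"
  by (auto simp: temps_prog_def)

lemma mods_cons_prog [simp]:
  "nmods cons_prog = {''C'', ''e''}"
  "rmods cons_prog = {''ax'', ''ay'', ''bx'', ''by'', ''wx'', ''wy'', ''la'', ''ka'', ''cr''} \<union> con_names"
  by (auto simp: cons_prog_def Let_def)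

lemma con_list_agree:
  assumes "agree c s s'" "''C'' \<notin> nmods c" "rmods c \<inter> con_names = {}"
  shows "con_list s' = con_list s"
proof -
  have "reals s' x = reals s x" if "x \<in> con_names" for x
    using agreeD(2)[OF assms(1), of x] assms(3) that by blast
  then show ?thesis
    using agreeD(1)[OF assms(1,2)] by (simp add: con_list_def con_at_def con_names_def)
qed

definition rel_edge :: "complex list \<Rightarrow> (nat \<Rightarrow> nat) \<Rightarrow> complex \<Rightarrow> nat \<Rightarrow> complex \<times> complex" where
  "rel_edge vs f g i = (vs ! i - g, vs ! f i - g)"

lemma runs_cons_prog:
  assumes n: "nats s ''i'' 0 = length vs" "length vs \<le> N"
    and f: "\<And>i. i < length vs \<Longrightarrow> nats s ''s'' i < length vs"
    and v: "\<And>i. i < length vs \<Longrightarrow> reals s ''vx'' i = Re (vs ! i) \<and> reals s ''vy'' i = Im (vs ! i)"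
    and g: "reals s ''gx'' 0 = Re g" "reals s ''gy'' 0 = Im g" and \<alpha>: "reals s ''alpha'' 0 = \<alpha>"
  shows "runs N cons_prog s (\<lambda>s'. con_list s' =
    concat (map (\<lambda>(a, b). edge_cons \<alpha> a b) (map (rel_edge vs (nats s ''s'') g) [0..<length vs])))"
  unfolding cons_prog_def
proof (rule runs_Seq, rule runs_NAssign, rule runs_For[where n = "length vs" and
      I = "\<lambda>i s'. con_list s' = concat (map (\<lambda>(a, b). edge_cons \<alpha> a b) (map (rel_edge vs (nats s ''s'') g) [0..<i]))"],
    goal_cases)
  case 1
  show ?case by (simp add: con_list_def)
next
  case (2 i s1)
  define a b where "a = vs ! i - g" and "b = vs ! nats s ''s'' i - g"
  have s1: "nats s1 ''s'' = nats s ''s''" "reals s1 ''vx'' = reals s ''vx''" "reals s1 ''vy'' = reals s ''vy''"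
    "reals s1 ''gx'' = reals s ''gx''" "reals s1 ''gy'' = reals s ''gy''" "reals s1 ''alpha'' = reals s ''alpha''"
    using agreeD[OF 2(4)] by (simp_all add: Let_def con_names_def)
  obtain s2 where r2: "reaches N temps_prog s1 s2" and s2: "temps_ok \<alpha> a b s2"
    and ag2: "agree temps_prog s1 s2"
    by (rule runsE[OF runs_temps_prog[of s1 a b \<alpha> N]])
      (use s1 v f g \<alpha> 2 in \<open>auto simp: a_def b_def\<close>)
  have c2: "con_list s2 = con_list s1"
    using ag2 by (intro con_list_agree) (auto simp: con_names_def)
  obtain s3 where r3: "reaches N foot_prog s2 s3" and s3: "temps_ok \<alpha> a b s3"
    and c3: "con_list s3 = con_list s2 @ [foot_con \<alpha> a (b - a)]"
    by (rule runsE[OF runs_con_progs(1)[OF s2, of N]]) auto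
  obtain s4 where r4: "reaches N left_prog s3 s4" and s4: "temps_ok \<alpha> a b s4"
    and c4: "con_list s4 = con_list s3 @ [vertex_con 1 (sqrt (1 - \<alpha>\<^sup>2) / \<alpha>) a]"
    by (rule runsE[OF runs_con_progs(2)[OF s3, of N]]) auto
  obtain s5 where r5: "reaches N right_prog s4 s5" and s5: "temps_ok \<alpha> a b s5"
    and c5: "con_list s5 = con_list s4 @ [vertex_con (- 1) (sqrt (1 - \<alpha>\<^sup>2) / \<alpha>) a]"
    by (rule runsE[OF runs_con_progs(3)[OF s4, of N]]) auto
  have "runs N line_prog s5 (\<lambda>s''. con_list (nupd ''e'' 0 (Suc i) s'') =
      concat (map (\<lambda>(a, b). edge_cons \<alpha> a b) (map (rel_edge vs (nats s ''s'') g) [0..<Suc i])))"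
  proof (rule runs_mono[OF runs_con_progs(4)[OF s5]])
    fix s6 assume s6: "con_list s6 = con_list s5 @ [line_con a b] \<and> temps_ok \<alpha> a b s6"
    have "con_list (nupd ''e'' 0 (Suc i) s6) = con_list s6"
      by (simp add: con_list_def con_at_def)
    also have "\<dots> = con_list s1 @ edge_cons \<alpha> a b"
      using s6 c2 c3 c4 c5 by (simp add: edge_cons_def Let_def)
    finally show "con_list (nupd ''e'' 0 (Suc i) s6) =
        concat (map (\<lambda>(a, b). edge_cons \<alpha> a b) (map (rel_edge vs (nats s ''s'') g) [0..<Suc i]))"
      using 2(2) by (simp add: rel_edge_def a_def b_def)
  qed
  then show ?case using r2 r3 r4 r5 by (blast intro: reaches_Seq)
next
  case (3 i s1)
  then show ?case using agreeD[OF 3(3)] n by (simp add: Let_def)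
next
  case 4
  then show ?case using n by simp
next
  case 5
  then show ?case by (simp add: Let_def)
next
  case (6 s1)
  then show ?case by simp
qed

section \<open>Computing the breakpoints\<close>

definition t_list :: "state \<Rightarrow> real list" where
  "t_list s = map (reals s ''t'') [0..<nats s ''m'' 0]"

definition add_t :: "rexp \<Rightarrow> com" where
  "add_t e = RAssign ''t'' (NV ''m'') e ;; NSet ''m'' (NAdd (NV ''m'') (NConst 1))"

definition lin_prog :: com where
  "lin_prog =
     add_t (RDiv (rneg (RArr ''d2'' (NV ''k''))) (RArr ''d1'' (NV ''k''))) ;;
     add_t (RDiv (rneg (RArr ''e2'' (NV ''k''))) (RArr ''e1'' (NV ''k''))) ;;
     add_t (RDiv (rneg (RArr ''n2'' (NV ''k''))) (RArr ''n1'' (NV ''k''))) ;;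
     add_t (RDiv (rneg (RArr ''m2'' (NV ''k''))) (RArr ''m1'' (NV ''k'')))"

definition quad_prog :: "rexp \<Rightarrow> rexp \<Rightarrow> rexp \<Rightarrow> com" where
  "quad_prog a b c =
     RSet ''q1'' a ;; RSet ''q2'' b ;; RSet ''q3'' c ;;
     RSet ''D'' (RSqrt (RSub (RMul (RV ''q2'') (RV ''q2'')) (RMul (RMul (RNum 4) (RV ''q1'')) (RV ''q3'')))) ;;
     add_t (RDiv (RAdd (rneg (RV ''q2'')) (RV ''D'')) (RMul (RNum 2) (RV ''q1''))) ;;
     add_t (RDiv (RSub (rneg (RV ''q2'')) (RV ''D'')) (RMul (RNum 2) (RV ''q1''))) ;;
     add_t (RDiv (rneg (RV ''q3'')) (RV ''q2''))"

abbreviation rk :: "array_name \<Rightarrow> rexp" where "rk x \<equiv> RArr x (NV ''k'')"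
abbreviation rl :: "array_name \<Rightarrow> rexp" where "rl x \<equiv> RArr x (NV ''l'')"

definition coeff_prog :: com where
  "coeff_prog =
     RSet ''A'' (RSub (RMul (rk ''n0'') (rl ''m0'')) (RMul (rl ''n0'') (rk ''m0''))) ;;
     RSet ''x'' (RSub (RSub (RAdd (RMul (rk ''n0'') (rl ''m1'')) (RMul (rl ''m0'') (rk ''n1'')))
       (RMul (rl ''n0'') (rk ''m1''))) (RMul (rk ''m0'') (rl ''n1''))) ;;
     RSet ''y'' (RSub (RSub (RAdd (RMul (rk ''n0'') (rl ''m2'')) (RMul (rl ''m0'') (rk ''n2'')))
       (RMul (rl ''n0'') (rk ''m2''))) (RMul (rk ''m0'') (rl ''n2'')))"

definition lin_roots_prog :: com where
  "lin_roots_prog =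
     quad_prog (RSub (RMul (RV ''x'') (RV ''x'')) (RMul (RV ''A'') (RV ''A'')))
       (RMul (RMul (RNum 2) (RV ''x'')) (RV ''y''))
       (RSub (RMul (RV ''y'') (RV ''y'')) (RMul (RV ''A'') (RV ''A'')))"

definition quad_roots_prog :: com where
  "quad_roots_prog =
     quad_prog (RAdd (RSub (RMul (rk ''n1'') (rl ''m1'')) (RMul (rl ''n1'') (rk ''m1''))) (RV ''A''))
       (RSub (RSub (RAdd (RMul (rk ''n1'') (rl ''m2'')) (RMul (rk ''n2'') (rl ''m1'')))
         (RMul (rl ''n1'') (rk ''m2''))) (RMul (rl ''n2'') (rk ''m1'')))
       (RAdd (RSub (RMul (rk ''n2'') (rl ''m2'')) (RMul (rl ''n2'') (rk ''m2''))) (RV ''A''))"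

definition pair_prog :: com where
  "pair_prog = lin_prog ;; coeff_prog ;; lin_roots_prog ;; quad_roots_prog"

definition breaks_prog :: com where
  "breaks_prog = NSet ''m'' (NConst 0) ;; For ''k'' (NV ''C'') (For ''l'' (NV ''C'') pair_prog)"

lemma mods_breaks [simp]:
  "nmods (add_t e) = {''m''}" "rmods (add_t e) = {''t''}"
  "nmods lin_prog = {''m''}" "rmods lin_prog = {''t''}"
  "nmods (quad_prog a b c) = {''m''}" "rmods (quad_prog a b c) = {''t'', ''q1'', ''q2'', ''q3'', ''D''}"
  "nmods coeff_prog = {}" "rmods coeff_prog = {''A'', ''x'', ''y''}"
  "nmods lin_roots_prog = {''m''}" "rmods lin_roots_prog = {''t'', ''q1'', ''q2'', ''q3'', ''D''}"
  "nmods quad_roots_prog = {''m''}" "rmods quad_roots_prog = {''t'', ''q1'', ''q2'', ''q3'', ''D''}"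
  "nmods pair_prog = {''m''}" "rmods pair_prog = {''t'', ''q1'', ''q2'', ''q3'', ''D'', ''A'', ''x'', ''y''}"
  "nmods breaks_prog = {''m'', ''k'', ''l''}"
  "rmods breaks_prog = {''t'', ''q1'', ''q2'', ''q3'', ''D'', ''A'', ''x'', ''y''}"
  by (auto simp: add_t_def lin_prog_def quad_prog_def coeff_prog_def lin_roots_prog_def
      quad_roots_prog_def pair_prog_def breaks_prog_def)

lemma runs_add_t:
  assumes "rval e s = v"
  shows "runs N (add_t e) s (\<lambda>s'. t_list s' = t_list s @ [v])"
  unfolding add_t_def by (rule runs_straight)+ (simp add: assms t_list_def)

lemma runs_add_t_Seq:
  assumes "rval e s = v"
    and "\<And>s'. t_list s' = t_list s @ [v] \<Longrightarrow> (\<And>x. x \<noteq> ''m'' \<Longrightarrow> nats s' x = nats s x) \<Longrightarrow>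
      (\<And>x. x \<noteq> ''t'' \<Longrightarrow> reals s' x = reals s x) \<Longrightarrow> runs N d s' Q"
  shows "runs N (add_t e ;; d) s Q"
  by (rule runs_Seq_frame[OF runs_add_t[OF assms(1)]], rule assms(2)) (auto dest: agreeD)

lemma runs_lin_prog:
  defines "c \<equiv> \<lambda>s. con_at s (nats s ''k'' 0)"
  shows "runs N lin_prog s (\<lambda>s'. t_list s' = t_list s @
    [lin_root (d1 (c s)), lin_root (d2 (c s)), lin_root (nv (c s)), lin_root (mv (c s))])"
  unfolding lin_prog_def
  apply (rule runs_add_t_Seq, rule refl)
  apply (rule runs_add_t_Seq, rule refl)
  apply (rule runs_add_t_Seq, rule refl)
  apply (rule runs_mono, rule runs_add_t, rule refl)
  apply (simp add: c_def con_at_def lin_root_def)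
  done

text \<open>\<open>b\<close> and \<open>c\<close> are evaluated after earlier coefficients have been
  stored, hence the updated states in the assumptions.\<close>

lemma runs_quad_prog:
  assumes "rval a s = a'" "rval b (rupd ''q1'' 0 a' s) = b'"
    "rval c (rupd ''q2'' 0 b' (rupd ''q1'' 0 a' s)) = c'"
  shows "runs N (quad_prog a b c) s (\<lambda>s'. t_list s' = t_list s @ quad_roots a' b' c')"
  unfolding quad_prog_def
  apply (rule runs_RSet, rule assms(1))
  apply (rule runs_RSet, rule assms(2))
  apply (rule runs_RSet, rule assms(3))
  apply (rule runs_RSet, rule refl)
  apply (rule runs_add_t_Seq, rule refl)
  apply (rule runs_add_t_Seq, rule refl)
  apply (rule runs_mono, rule runs_add_t, rule refl)
  apply (simp add: quad_roots_def)
  apply (simp add: t_list_def)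
  done

lemma runs_pair_prog:
  "runs N pair_prog s (\<lambda>s'. t_list s' = t_list s @ breaks (con_at s (nats s ''k'' 0)) (con_at s (nats s ''l'' 0)))"
proof -
  define c c' where "c = con_at s (nats s ''k'' 0)" and "c' = con_at s (nats s ''l'' 0)"
  define X Y where "X = Re (cL c c')" and "Y = Im (cL c c')"
  obtain s1 where r1: "reaches N lin_prog s s1" and ag1: "agree lin_prog s s1"
    and t1: "t_list s1 = t_list s @ [lin_root (d1 c), lin_root (d2 c), lin_root (nv c), lin_root (mv c)]"
    unfolding c_def by (rule runsE[OF runs_lin_prog])
  have s1: "nats s1 ''k'' = nats s ''k''" "nats s1 ''l'' = nats s ''l''"
    "x \<noteq> ''t'' \<Longrightarrow> reals s1 x = reals s x" for x
    using agreeD[OF ag1] by auto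
  have "runs N coeff_prog s1 (\<lambda>s2. t_list s2 = t_list s1 \<and>
      reals s2 ''A'' 0 = cA c c' \<and> reals s2 ''x'' 0 = X \<and> reals s2 ''y'' 0 = Y)"
    unfolding coeff_prog_def
    by (rule runs_straight)+
      (simp add: t_list_def s1 cA_def cL_def X_def Y_def c_def c'_def con_at_def)
  then obtain s2 where r2: "reaches N coeff_prog s1 s2" and ag2: "agree coeff_prog s1 s2"
    and s2: "t_list s2 = t_list s1" "reals s2 ''A'' 0 = cA c c'" "reals s2 ''x'' 0 = X" "reals s2 ''y'' 0 = Y"
    by (blast elim: runsE)
  have "runs N lin_roots_prog s2 (\<lambda>s3. t_list s3 = t_list s2 @
      quad_roots (X * X - cA c c' * cA c c') (2 * X * Y) (Y * Y - cA c c' * cA c c'))"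
    unfolding lin_roots_prog_def by (rule runs_quad_prog) (simp_all add: s2)
  then obtain s3 where r3: "reaches N lin_roots_prog s2 s3" and ag3: "agree lin_roots_prog s2 s3"
    and t3: "t_list s3 = t_list s2 @ quad_roots (X * X - cA c c' * cA c c') (2 * X * Y) (Y * Y - cA c c' * cA c c')"
    by (blast elim: runsE)
  have s3: "nats s3 ''k'' = nats s ''k''" "nats s3 ''l'' = nats s ''l''" "reals s3 ''A'' 0 = cA c c'"
    "reals s3 ''n1'' = reals s ''n1''" "reals s3 ''n2'' = reals s ''n2''"
    "reals s3 ''m1'' = reals s ''m1''" "reals s3 ''m2'' = reals s ''m2''"
    using agreeD[OF ag3] agreeD[OF ag2] by (simp_all add: s1 s2)
  have "runs N quad_roots_prog s3 (\<lambda>s4. t_list s4 = t_list s3 @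
      quad_roots (cQ1 c c' + cA c c') (cQ2 c c') (cQ3 c c' + cA c c'))"
    unfolding quad_roots_prog_def
    by (rule runs_quad_prog) (simp_all add: s3, simp_all add: cQ1_def cQ2_def cQ3_def c_def c'_def con_at_def)
  then have "runs N quad_roots_prog s3 (\<lambda>s4. t_list s4 = t_list s @ breaks c c')"
    by (rule runs_mono) (simp add: t1 s2 t3 breaks_def Let_def X_def Y_def)
  then show ?thesis
    unfolding pair_prog_def c_def c'_def using r1 r2 r3 by (blast intro: reaches_Seq)
qed

lemma con_at_agree:
  assumes "agree c s s'" "rmods c \<inter> con_names = {}"
  shows "con_at s' k = con_at s k"
proof -
  have "reals s' x = reals s x" if "x \<in> con_names" for x
    using agreeD(2)[OF assms(1), of x] assms(2) that by blast
  then show ?thesis by (simp add: con_at_def con_names_def)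
qed

text \<open>Four linear roots and twice three quadratic ones; this count enters the loop bound of
  the whole program.\<close>

lemma length_breaks: "length (breaks c c') = 10"
  by (simp add: breaks_def quad_roots_def Let_def)

lemma runs_breaks_prog:
  assumes C: "nats s ''C'' 0 = n" "n \<le> N"
  shows "runs N breaks_prog s (\<lambda>s'. length (t_list s') = 10 * n * n \<and>
    (\<forall>k<n. \<forall>l<n. set (breaks (con_at s k) (con_at s l)) \<subseteq> set (t_list s')))"
  unfolding breaks_prog_def
proof (rule runs_Seq, rule runs_NAssign, rule runs_For[where n = n and
      I = "\<lambda>k s'. length (t_list s') = 10 * n * k \<and>
        (\<forall>k'<k. \<forall>l<n. set (breaks (con_at s k') (con_at s l)) \<subseteq> set (t_list s'))"], goal_cases)
  case 1
  show ?case by (simp add: t_list_def)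
next
  case (2 k s1)
  have con1: "con_at s1 j = con_at s j" for j
    using con_at_agree[OF 2(4), of j] by (simp add: con_names_def con_at_def)
  have C1: "nats s1 ''C'' 0 = n" using agreeD(1)[OF 2(4)] C by simp
  have t: "t_list (nupd x 0 v s') = t_list s'" if "x \<noteq> ''m''" for x v s'
    using that by (simp add: t_list_def)
  show ?case
  proof (rule runs_For[where n = n and
      I = "\<lambda>l s'. length (t_list s') = 10 * n * k + 10 * l \<and>
        (\<forall>k'<k. \<forall>l<n. set (breaks (con_at s k') (con_at s l)) \<subseteq> set (t_list s')) \<and>
        (\<forall>l'<l. set (breaks (con_at s k) (con_at s l')) \<subseteq> set (t_list s'))"], goal_cases)
    case 1
    then show ?case using 2(2) by (simp add: t)
  next
    case (2 l s2)
    have con2: "con_at s2 j = con_at s j" for j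
      using con_at_agree[OF 2(4), of j] con1 by (simp add: con_names_def)
    have k: "nats s2 ''k'' 0 = k" using agreeD(1)[OF 2(4)] \<open>nats s1 ''k'' 0 = k\<close> by simp
    show ?case
    proof (rule runs_mono[OF runs_pair_prog])
      fix s3 assume "t_list s3 = t_list s2 @ breaks (con_at s2 (nats s2 ''k'' 0)) (con_at s2 (nats s2 ''l'' 0))"
      then have t3: "t_list s3 = t_list s2 @ breaks (con_at s k) (con_at s l)"
        using 2 k con2 by simp
      show "length (t_list (nupd ''l'' 0 (Suc l) s3)) = 10 * n * k + 10 * Suc l \<and>
        (\<forall>k'<k. \<forall>la<n. set (breaks (con_at s k') (con_at s la)) \<subseteq> set (t_list (nupd ''l'' 0 (Suc l) s3))) \<and>
        (\<forall>l'<Suc l. set (breaks (con_at s k) (con_at s l')) \<subseteq> set (t_list (nupd ''l'' 0 (Suc l) s3)))"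
        using 2(2) t3 by (auto simp: t length_breaks less_Suc_eq)
    qed
  next
    case (3 l s2)
    then show ?case using agreeD(1)[OF 3(3)] C1 by simp
  next
    case 4
    then show ?case using C by simp
  next
    case 5
    then show ?case by simp
  next
    case (6 s2)
    then show ?case by (auto simp: t less_Suc_eq)
  qed
next
  case (3 k s1)
  then show ?case using agreeD(1)[OF 3(3)] C by simp
next
  case 4
  then show ?case using C by simp
next
  case 5
  then show ?case by simp
next
  case (6 s1)
  then show ?case by simp
qed

section \<open>Computing the directions\<close>

text \<open>One plus the sum of squares exceeds every \<open>\<bar>t\<bar>\<close>, so
  \<open>B\<close> and \<open>- B\<close> can serve as plus and minus infinity in the
  sorting.\<close>

definition bound_prog :: com where
  "bound_prog = RSet ''B'' (RNum 1) ;;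
     For ''k'' (NV ''m'') (RSet ''B'' (RAdd (RV ''B'') (RMul (rk ''t'') (rk ''t''))))"

definition next_prog :: com where
  "next_prog = RSet ''v'' (rneg (RV ''B'')) ;;
     For ''l'' (NV ''m'') (Cond (BAnd (BNot (RLe (RV ''u'') (rl ''t''))) (BNot (RLe (rl ''t'') (RV ''v''))))
       (RSet ''v'' (rl ''t'')) Skip)"

definition append_prog :: com where
  "append_prog = RAssign ''ux'' (NV ''h'') (RV ''v'') ;; RAssign ''uy'' (NV ''h'') (RNum 1) ;;
     NSet ''h'' (NAdd (NV ''h'') (NConst 1)) ;; RSet ''u'' (RV ''v'')"

text \<open>Selection sort that drops duplicates: each round takes the largest cotangent below the
  previous one. Decreasing cotangents mean increasing angles; \<open>(t, 1)\<close> is the vector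
  with cotangent \<open>t\<close> in the upper half-plane, and \<open>(1, 0)\<close> precedes all of
  them.\<close>

definition sort_prog :: com where
  "sort_prog = RSet ''ux'' (RNum 1) ;; RSet ''uy'' (RNum 0) ;; NSet ''h'' (NConst 1) ;;
     RSet ''u'' (RV ''B'') ;;
     For ''k'' (NV ''m'') (next_prog ;; Cond (RLe (RV ''v'') (rneg (RV ''B''))) Skip append_prog)"

text \<open>A cotangent fixes a direction only up to sign; negation supplies the lower half turn.
  The first direction is repeated at index \<open>h + h\<close>, because sector \<open>k\<close>
  also needs direction \<open>k + 1\<close>.\<close>

definition mirror_prog :: com where
  "mirror_prog =
     For ''k'' (NV ''h'')
       (RAssign ''ux'' (NAdd (NV ''h'') (NV ''k'')) (rneg (rk ''ux'')) ;;
        RAssign ''uy'' (NAdd (NV ''h'') (NV ''k'')) (rneg (rk ''uy''))) ;;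
     RAssign ''ux'' (NAdd (NV ''h'') (NV ''h'')) (RNum 1) ;;
     RAssign ''uy'' (NAdd (NV ''h'') (NV ''h'')) (RNum 0)"

lemma mods_dirs [simp]:
  "nmods bound_prog = {''k''}" "rmods bound_prog = {''B''}"
  "nmods next_prog = {''l''}" "rmods next_prog = {''v''}"
  "nmods sort_prog = {''h'', ''k'', ''l''}" "rmods sort_prog = {''ux'', ''uy'', ''u'', ''v''}"
  "nmods mirror_prog = {''k''}" "rmods mirror_prog = {''ux'', ''uy''}"
  by (auto simp: bound_prog_def next_prog_def append_prog_def sort_prog_def mirror_prog_def)

lemma set_t_list: "set (t_list s) = reals s ''t'' ` {..<nats s ''m'' 0}"
  by (auto simp: t_list_def)

lemma runs_bound_prog:
  assumes "length (t_list s) \<le> N"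
  shows "runs N bound_prog s (\<lambda>s'. \<forall>t\<in>set (t_list s). \<bar>t\<bar> < reals s' ''B'' 0)"
  unfolding bound_prog_def
proof (rule runs_Seq, rule runs_RAssign, rule runs_For[where n = "nats s ''m'' 0" and
      I = "\<lambda>j s'. 1 \<le> reals s' ''B'' 0 \<and> (\<forall>i<j. \<bar>reals s ''t'' i\<bar> < reals s' ''B'' 0)"], goal_cases)
  case 1
  show ?case by simp
next
  case (2 j s1)
  have t: "reals s1 ''t'' = reals s ''t''" using agreeD(2)[OF 2(4)] by simp
  have sq: "\<bar>r\<bar> < b + r * r" if "1 \<le> b" for r b :: real
  proof -
    have "0 \<le> (\<bar>r\<bar> - 1)\<^sup>2" by simp
    then have "2 * \<bar>r\<bar> \<le> 1 + r * r" by (simp add: power2_eq_square algebra_simps)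
    then show ?thesis using that by (cases "r = 0") auto
  qed
  have "\<bar>r\<bar> < b + x * x" if "\<bar>r\<bar> < b" for r b x :: real
    using that zero_le_square[of x] by linarith
  then show ?case
    using 2(2,3) sq by (intro runs_RAssign) (auto simp: t less_Suc_eq add_increasing2)
next
  case (3 j s1)
  then show ?case using agreeD(1)[OF 3(3)] by simp
next
  case 4
  show ?case using assms by (simp add: t_list_def)
next
  case 5
  show ?case by simp
next
  case (6 s1)
  then show ?case by (auto simp: set_t_list)
qed

lemma runs_next_prog:
  fixes s :: state
  defines "u \<equiv> reals s ''u'' 0" and "B \<equiv> reals s ''B'' 0"
  assumes N: "length (t_list s) \<le> N"
  shows "runs N next_prog s (\<lambda>s'. reals s' ''v'' 0 = Max (insert (- B) {t \<in> set (t_list s). t < u}))"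
  unfolding next_prog_def
proof (rule runs_Seq, rule runs_RAssign, rule runs_For[where n = "nats s ''m'' 0" and
      I = "\<lambda>j s'. reals s' ''v'' 0 = Max (insert (- B) {t \<in> reals s ''t'' ` {..<j}. t < u})"], goal_cases)
  case 1
  show ?case by (simp add: B_def)
next
  case (2 j s1)
  have s1: "reals s1 ''t'' = reals s ''t''" "reals s1 ''u'' = reals s ''u''" using agreeD(2)[OF 2(4)] by auto
  let ?T = "\<lambda>j. insert (- B) {t \<in> reals s ''t'' ` {..<j}. t < u}"
  define F where "F j = Max (?T j)" for j
  have fin: "finite (?T j)" by simp
  have eq: "?T (Suc j) = (if reals s ''t'' j < u then insert (reals s ''t'' j) (?T j) else ?T j)"
    by (auto simp: lessThan_Suc)
  have "Max (?T (Suc j)) =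
      (if reals s ''t'' j < u \<and> Max (?T j) < reals s ''t'' j then reals s ''t'' j else Max (?T j))"
  proof (cases "reals s ''t'' j < u")
    case True
    have "Max (insert (reals s ''t'' j) (?T j)) = max (reals s ''t'' j) (Max (?T j))"
      using fin by (intro Max_insert) auto
    moreover have "max x M = (if True \<and> M < x then x else M)" for x M :: real
      by (simp add: max_def)
    ultimately show ?thesis unfolding eq using True by (simp only: if_True simp_thms)
  next
    case False
    then show ?thesis unfolding eq by (simp only: if_False simp_thms)
  qed
  then have F: "F (Suc j) = (if reals s ''t'' j < u \<and> F j < reals s ''t'' j then reals s ''t'' j else F j)"
    unfolding F_def .
  have "reals s1 ''v'' 0 = F j" using 2(2) unfolding F_def .
  then show ?case
    unfolding F_def[symmetric] using 2(3)
    by (intro runs_Cond runs_RAssign runs_Skip) (auto simp: s1 u_def[symmetric] F)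
next
  case (3 j s1)
  then show ?case using agreeD(1)[OF 3(3)] by simp
next
  case 4
  show ?case using N by (simp add: t_list_def)
next
  case 5
  show ?case by simp
next
  case (6 s1)
  then show ?case by (simp add: set_t_list)
qed

definition sorted_dirs :: "real set \<Rightarrow> real list \<Rightarrow> state \<Rightarrow> bool" where
  "sorted_dirs T xs s \<longleftrightarrow> nats s ''h'' 0 = Suc (length xs) \<and> reals s ''ux'' 0 = 1 \<and> reals s ''uy'' 0 = 0 \<and>
     (\<forall>i<length xs. reals s ''ux'' (Suc i) = xs ! i \<and> reals s ''uy'' (Suc i) = 1) \<and>
     sorted_wrt (>) xs \<and> set xs \<subseteq> T"

text \<open>The last clause: after \<open>j\<close> rounds either every round has found a new
  cotangent, or none is left.\<close>

definition sort_inv :: "real set \<Rightarrow> nat \<Rightarrow> state \<Rightarrow> bool" where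
  "sort_inv T j s \<longleftrightarrow> (\<exists>xs. sorted_dirs T xs s \<and> (\<forall>x\<in>set xs. reals s ''u'' 0 \<le> x) \<and>
     (\<forall>t\<in>T. t \<notin> set xs \<longrightarrow> t < reals s ''u'' 0) \<and> (length xs = j \<or> set xs = T))"

lemma runs_sort_prog:
  fixes s :: state
  defines "T \<equiv> set (t_list s)" and "B \<equiv> reals s ''B'' 0"
  assumes N: "length (t_list s) \<le> N" and B: "\<forall>t\<in>T. \<bar>t\<bar> < B"
  shows "runs N sort_prog s (\<lambda>s'. \<exists>xs. sorted_dirs T xs s' \<and> set xs = T)"
  unfolding sort_prog_def
proof (rule runs_Seq, rule runs_RAssign, rule runs_Seq, rule runs_RAssign, rule runs_Seq, rule runs_NAssign,
    rule runs_Seq, rule runs_RAssign, rule runs_For[where n = "nats s ''m'' 0" and I = "sort_inv T"], goal_cases)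
  case 1
  show ?case
    unfolding sort_inv_def using B
    by (intro exI[of _ "[]"]) (auto simp: sorted_dirs_def B_def[symmetric] abs_less_iff)
next
  case (2 j s1)
  have s1: "reals s1 ''t'' = reals s ''t''" "nats s1 ''m'' = nats s ''m''" "reals s1 ''B'' 0 = B"
    using agreeD[OF 2(4)] by (auto simp: B_def append_prog_def)
  have t1: "t_list s1 = t_list s" by (simp add: t_list_def s1)
  define u where "u = reals s1 ''u'' 0"
  obtain xs where xs: "sorted_dirs T xs s1" "\<forall>x\<in>set xs. u \<le> x" "\<forall>t\<in>T. t \<notin> set xs \<longrightarrow> t < u"
    "length xs = j \<or> set xs = T"
    using 2(2) unfolding u_def sort_inv_def by blast
  define v where "v = Max (insert (- B) {t \<in> T. t < u})"
  have finT: "finite T" by (simp add: T_def)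
  have vmax: "t \<le> v" if "t \<in> T" "t < u" for t
    unfolding v_def using that finT by (intro Max_ge) auto
  obtain s2 where r2: "reaches N next_prog s1 s2" and ag: "agree next_prog s1 s2" and v2: "reals s2 ''v'' 0 = v"
    using runs_next_prog[of s1 N] N unfolding t1 s1 u_def v_def T_def by (blast elim: runsE)
  have s2: "nats s2 ''h'' = nats s1 ''h''" "reals s2 ''ux'' = reals s1 ''ux''" "reals s2 ''uy'' = reals s1 ''uy''"
    "reals s2 ''u'' 0 = u" "reals s2 ''B'' 0 = B"
    using agreeD[OF ag] s1 by (auto simp: u_def)
  have d2: "sorted_dirs T xs s2" using xs(1) by (simp add: sorted_dirs_def s2)
  have "runs N (Cond (RLe (RV ''v'') (rneg (RV ''B''))) Skip append_prog) s2
    (\<lambda>s''. sort_inv T (Suc j) (nupd ''k'' 0 (Suc j) s''))"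
  proof (rule runs_Cond)
    assume "bval (RLe (RV ''v'') (rneg (RV ''B''))) s2"
    then have vB: "v \<le> - B" by (simp add: v2 s2)
    have "set xs = T"
    proof (rule ccontr)
      assume "set xs \<noteq> T"
      then obtain t where t: "t \<in> T" "t \<notin> set xs" using xs(1) by (auto simp: sorted_dirs_def)
      then have "t \<le> v" using xs(3) by (intro vmax) auto
      then show False using vB B t(1) by (force simp: abs_less_iff)
    qed
    then show "runs N Skip s2 (\<lambda>s''. sort_inv T (Suc j) (nupd ''k'' 0 (Suc j) s''))"
      unfolding sort_inv_def
      using d2 xs(2) by (intro runs_Skip exI[of _ xs]) (auto simp: s2 sorted_dirs_def)
  next
    assume "\<not> bval (RLe (RV ''v'') (rneg (RV ''B''))) s2"
    then have vB: "- B < v" by (simp add: v2 s2)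
    have "v \<in> insert (- B) {t \<in> T. t < u}" unfolding v_def using finT by (intro Max_in) auto
    then have v: "v \<in> T" "v < u" using vB by auto
    have len: "length xs = j" using xs(2,4) v by force
    have h2: "nats s2 ''h'' 0 = Suc (length xs)" using d2 by (simp add: sorted_dirs_def)
    have mono: "\<forall>x\<in>set xs. v < x" using xs(2) v(2) by force
    have less: "\<forall>t\<in>T. t \<notin> set (xs @ [v]) \<longrightarrow> t < v" using xs(3) vmax by force
    show "runs N append_prog s2 (\<lambda>s''. sort_inv T (Suc j) (nupd ''k'' 0 (Suc j) s''))"
      unfolding append_prog_def sort_inv_def
    proof ((rule runs_straight)+, intro exI[of _ "xs @ [v]"] conjI, goal_cases)
      case 1
      show ?case
        using d2 v(1) mono
        by (auto simp: sorted_dirs_def sorted_wrt_append h2 v2 nth_append less_Suc_eq)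
    next
      case 2
      show ?case using mono by (auto simp: v2 h2 s2)
    next
      case 3
      show ?case using less by (simp add: v2)
    next
      case 4
      show ?case using len by simp
    qed
  qed
  then show ?case using r2 by (blast intro: reaches_Seq)
next
  case (3 j s1)
  then show ?case using agreeD(1)[OF 3(3)] by (simp add: append_prog_def)
next
  case 4
  show ?case using N by (simp add: t_list_def)
next
  case 5
  show ?case by (simp add: append_prog_def)
next
  case (6 s1)
  then obtain xs where xs: "sorted_dirs T xs s1" "length xs = nats s ''m'' 0 \<or> set xs = T"
    unfolding sort_inv_def by blast
  have "set xs = T"
  proof (rule ccontr)
    assume n: "set xs \<noteq> T"
    \<comment> \<open>A new cotangent in each round would give as many distinct ones as the unsorted
      list has entries, which exhausts \<open>T\<close>.\<close>
    then have "length xs = length (t_list s)" using xs(2) by (simp add: t_list_def)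
    moreover have "distinct xs"
      using xs(1) unfolding sorted_dirs_def sorted_wrt_iff_nth_less distinct_conv_nth
      by (metis less_irrefl nat_neq_iff)
    moreover have "set xs \<subseteq> T" using xs(1) by (simp add: sorted_dirs_def)
    moreover have "card T \<le> length (t_list s)" unfolding T_def by (rule card_length)
    ultimately have "set xs = T"
      using distinct_card[of xs] finite_set[of "t_list s"] by (intro card_seteq) (auto simp: T_def)
    then show False using n by simp
  qed
  then show ?case using xs(1) by blast
qed

lemma runs_mirror_prog:
  assumes h: "nats s ''h'' 0 = h" "h \<le> N"
  shows "runs N mirror_prog s (\<lambda>s'.
    (\<forall>i<h. reals s' ''ux'' i = reals s ''ux'' i \<and> reals s' ''uy'' i = reals s ''uy'' i \<and>
       reals s' ''ux'' (h + i) = - reals s ''ux'' i \<and> reals s' ''uy'' (h + i) = - reals s ''uy'' i) \<and>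
    reals s' ''ux'' (h + h) = 1 \<and> reals s' ''uy'' (h + h) = 0)"
  unfolding mirror_prog_def
proof (rule runs_Seq, rule runs_For[where n = h and
      I = "\<lambda>j s'. (\<forall>i<h. reals s' ''ux'' i = reals s ''ux'' i \<and> reals s' ''uy'' i = reals s ''uy'' i) \<and>
        (\<forall>i<j. reals s' ''ux'' (h + i) = - reals s ''ux'' i \<and> reals s' ''uy'' (h + i) = - reals s ''uy'' i)"],
    goal_cases)
  case 1
  show ?case by simp
next
  case (2 j s1)
  have "nats s1 ''h'' 0 = h" using agreeD(1)[OF 2(4)] h by simp
  then show ?case
    using 2(1-3) by (intro runs_straight) (auto simp: less_Suc_eq)
next
  case (3 j s1)
  then show ?case using agreeD(1)[OF 3(3)] h by simp
next
  case 4
  show ?case using h by simp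
next
  case 5
  show ?case by simp
next
  case (6 s1)
  have "nats s1 ''h'' 0 = h" using agreeD(1)[OF 6(2)] h by simp
  then show ?case using 6(1) by (intro runs_straight) auto
qed

section \<open>Computing the boundary pieces\<close>

definition rnum :: "nexp \<Rightarrow> rexp \<Rightarrow> rexp \<Rightarrow> rexp" where
  "rnum i x y = RAdd (RArr ''n0'' i) (rdot (RArr ''n1'' i) (RArr ''n2'' i) x y)"

definition rden :: "nexp \<Rightarrow> rexp \<Rightarrow> rexp \<Rightarrow> rexp" where
  "rden i x y = RAdd (RArr ''m0'' i) (rdot (RArr ''m1'' i) (RArr ''m2'' i) x y)"

definition rrad :: "nexp \<Rightarrow> rexp \<Rightarrow> rexp \<Rightarrow> rexp" where
  "rrad i x y = RDiv (rnum i x y) (rden i x y)"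

definition bactive :: "nexp \<Rightarrow> rexp \<Rightarrow> rexp \<Rightarrow> bexp" where
  "bactive i x y =
     BAnd (RLe (RNum 0) (rdot (RArr ''d1'' i) (RArr ''d2'' i) x y))
       (BAnd (RLe (RNum 0) (rdot (RArr ''e1'' i) (RArr ''e2'' i) x y))
         (BAnd (RLe (RNum 0) (rnum i x y)) (BNot (RLe (rden i x y) (RNum 0)))))"

lemma rval_radius [simp]:
  "rval (rrad i x y) s = radius (con_at s (nval i s)) (Complex (rval x s) (rval y s))"
  by (simp add: rrad_def rnum_def rden_def radius_def numer_def denom_def con_at_def inner_complex_def)

lemma bval_active [simp]:
  "bval (bactive i x y) s \<longleftrightarrow> active (con_at s (nval i s)) (Complex (rval x s) (rval y s))"
  by (simp add: bactive_def rnum_def rden_def active_def numer_def denom_def con_at_def inner_complex_def not_le)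

text \<open>The search starts from constraint 0 without testing it; that is the foot constraint of
  the first edge, active in every direction.\<close>

definition best_prog :: com where
  "best_prog = NSet ''o'' (NConst 0) ;; RSet ''v'' (rrad (NConst 0) (RV ''wx'') (RV ''wy'')) ;;
     For ''l'' (NV ''C'')
       (Cond (BAnd (bactive (NV ''l'') (RV ''wx'') (RV ''wy''))
          (BNot (RLe (RV ''v'') (rrad (NV ''l'') (RV ''wx'') (RV ''wy'')))))
         (NSet ''o'' (NV ''l'') ;; RSet ''v'' (rrad (NV ''l'') (RV ''wx'') (RV ''wy''))) Skip)"

text \<open>\<open>sx\<close>, \<open>sy\<close> receive the start direction of the sector and
  \<open>wx\<close>, \<open>wy\<close> a direction inside it. Both are normalized, since the
  formulas for the radius presuppose unit vectors.\<close>

definition unit_prog :: com where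
  "unit_prog =
     RSet ''sx'' (rk ''ux'') ;; RSet ''sy'' (rk ''uy'') ;;
     RSet ''wx'' (RAdd (rk ''ux'') (RArr ''ux'' (NAdd (NV ''k'') (NConst 1)))) ;;
     RSet ''wy'' (RAdd (rk ''uy'') (RArr ''uy'' (NAdd (NV ''k'') (NConst 1)))) ;;
     RSet ''r'' (RSqrt (rdot (RV ''sx'') (RV ''sy'') (RV ''sx'') (RV ''sy''))) ;;
     RSet ''sx'' (RDiv (RV ''sx'') (RV ''r'')) ;; RSet ''sy'' (RDiv (RV ''sy'') (RV ''r'')) ;;
     RSet ''r'' (RSqrt (rdot (RV ''wx'') (RV ''wy'') (RV ''wx'') (RV ''wy''))) ;;
     RSet ''wx'' (RDiv (RV ''wx'') (RV ''r'')) ;; RSet ''wy'' (RDiv (RV ''wy'') (RV ''r''))"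

definition out_prog :: com where
  "out_prog =
     RSet ''r'' (rrad (NV ''o'') (RV ''sx'') (RV ''sy'')) ;;
     RAssign ''px'' (NV ''k'') (RAdd (RV ''gx'') (RMul (RV ''r'') (RV ''sx''))) ;;
     RAssign ''py'' (NV ''k'') (RAdd (RV ''gy'') (RMul (RV ''r'') (RV ''sy''))) ;;
     RAssign ''cx'' (NV ''k'') (RAdd (RV ''gx'') (RDiv (RArr ''n1'' (NV ''o'')) (RNum 2))) ;;
     RAssign ''cy'' (NV ''k'') (RAdd (RV ''gy'') (RDiv (RArr ''n2'' (NV ''o'')) (RNum 2))) ;;
     Cond (RLe (RArr ''m0'' (NV ''o'')) (RNum 0))
       (NAssign ''kind'' (NV ''k'') (NConst 0)) (NAssign ''kind'' (NV ''k'') (NConst 1))"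

definition pieces_prog :: com where
  "pieces_prog = For ''k'' (NAdd (NV ''h'') (NV ''h'')) (unit_prog ;; best_prog ;; out_prog)"

text \<open>\<open>v\<close> still holds the minimal radius found in the last sector. It is positive
  if \<open>g\<close> is off the boundary; otherwise some foot constraint has radius 0 and the
  region is a single point.\<close>

definition final_prog :: com where
  "final_prog = Cond (RLe (RV ''v'') (RNum 0))
     (NSet ''pieces'' (NConst 0) ;; RSet ''px'' (RV ''gx'') ;; RSet ''py'' (RV ''gy''))
     (NSet ''pieces'' (NAdd (NV ''h'') (NV ''h'')))"

lemma mods_pieces [simp]:
  "nmods best_prog = {''o'', ''l''}" "rmods best_prog = {''v''}"
  "nmods unit_prog = {}" "rmods unit_prog = {''sx'', ''sy'', ''wx'', ''wy'', ''r''}"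
  "nmods out_prog = {''kind''}" "rmods out_prog = {''r'', ''px'', ''py'', ''cx'', ''cy''}"
  "nmods pieces_prog = {''k'', ''o'', ''l'', ''kind''}"
  "rmods pieces_prog = {''v'', ''sx'', ''sy'', ''wx'', ''wy'', ''r'', ''px'', ''py'', ''cx'', ''cy''}"
  by (auto simp: best_prog_def unit_prog_def out_prog_def pieces_prog_def)

lemma con_at_nupd [simp]: "con_at (nupd x i v s) = con_at s"
  by (simp add: con_at_def fun_eq_iff)

definition minimal :: "con list \<Rightarrow> con \<Rightarrow> complex \<Rightarrow> bool" where
  "minimal cl c u \<longleftrightarrow> c \<in> set cl \<and> active c u \<and> (\<forall>c'\<in>set cl. active c' u \<longrightarrow> radius c u \<le> radius c' u)"

lemma set_con_list: "set (con_list s) = con_at s ` {..<nats s ''C'' 0}"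
  by (auto simp: con_list_def)

lemma runs_best_prog:
  fixes s :: state
  defines "w \<equiv> Complex (reals s ''wx'' 0) (reals s ''wy'' 0)"
  assumes C: "0 < nats s ''C'' 0" "nats s ''C'' 0 \<le> N" and act: "active (con_at s 0) w"
  shows "runs N best_prog s (\<lambda>s'. minimal (con_list s) (con_at s (nats s' ''o'' 0)) w \<and>
    reals s' ''v'' 0 = radius (con_at s (nats s' ''o'' 0)) w)"
  unfolding best_prog_def
proof (rule runs_Seq, rule runs_NAssign, rule runs_Seq, rule runs_RAssign, rule runs_For[where n = "nats s ''C'' 0" and
      I = "\<lambda>j s'. nats s' ''o'' 0 < nats s ''C'' 0 \<and> active (con_at s (nats s' ''o'' 0)) w \<and>
        reals s' ''v'' 0 = radius (con_at s (nats s' ''o'' 0)) w \<and>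
        (\<forall>l<j. active (con_at s l) w \<longrightarrow> reals s' ''v'' 0 \<le> radius (con_at s l) w)"], goal_cases)
  case 1
  show ?case using C act by (simp add: w_def con_at_def)
next
  case (2 j s1)
  have con1: "con_at s1 i = con_at s i" for i
    using agreeD(2)[OF 2(4)] by (simp add: con_at_def)
  have w1: "Complex (reals s1 ''wx'' 0) (reals s1 ''wy'' 0) = w"
    using agreeD(2)[OF 2(4)] by (simp add: w_def)
  show ?case
    using 2(1-3)
    by (intro runs_Cond runs_straight) (auto simp: con1 w1 less_Suc_eq)
next
  case (3 j s1)
  then show ?case using agreeD(1)[OF 3(3)] by simp
next
  case 4
  show ?case using C by simp
next
  case 5
  show ?case by simp
next
  case (6 s1)
  then show ?case by (auto simp: minimal_def set_con_list)
qed

definition dir :: "state \<Rightarrow> nat \<Rightarrow> complex" where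
  "dir s k = Complex (reals s ''ux'' k) (reals s ''uy'' k)"

lemma sgn_Complex: "Complex (Re z / norm z) (Im z / norm z) = sgn z"
  by (simp add: complex_eq_iff sgn_div_norm divide_inverse mult.commute)

lemma runs_unit_prog:
  assumes "nats s ''k'' 0 = k"
  shows "runs N unit_prog s (\<lambda>s'.
    Complex (reals s' ''sx'' 0) (reals s' ''sy'' 0) = sgn (dir s k) \<and>
    Complex (reals s' ''wx'' 0) (reals s' ''wy'' 0) = sgn (dir s k + dir s (Suc k)))"
proof -
  define u w where "u = dir s k" and "w = dir s k + dir s (Suc k)"
  show ?thesis
    unfolding unit_prog_def w_def[symmetric] unfolding u_def[symmetric]
    apply (rule runs_RSet[where v = "Re u"], simp add: assms u_def dir_def)
    apply (rule runs_RSet[where v = "Im u"], simp add: assms u_def dir_def)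
    apply (rule runs_RSet[where v = "Re w"], simp add: assms w_def dir_def)
    apply (rule runs_RSet[where v = "Im w"], simp add: assms w_def dir_def)
    apply (rule runs_RSet[where v = "norm u"], simp add: cmod_def power2_eq_square)
    apply (rule runs_RSet[where v = "Re u / norm u"], simp)
    apply (rule runs_RSet[where v = "Im u / norm u"], simp)
    apply (rule runs_RSet[where v = "norm w"], simp add: cmod_def power2_eq_square)
    apply (rule runs_RSet[where v = "Re w / norm w"], simp)
    apply (rule runs_RAssign)
    apply (simp add: sgn_Complex)
    done
qed

lemma runs_out_prog:
  fixes s :: state
  defines "u \<equiv> Complex (reals s ''sx'' 0) (reals s ''sy'' 0)" and "c \<equiv> con_at s (nats s ''o'' 0)"
  assumes k: "nats s ''k'' 0 = k" and g: "reals s ''gx'' 0 = Re g" "reals s ''gy'' 0 = Im g"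
  shows "runs N out_prog s (\<lambda>s'. output_start s' k = g + radius c u *\<^sub>R u \<and> output_shape s' k = shape_of g c \<and>
    (\<forall>j. j \<noteq> k \<longrightarrow> output_start s' j = output_start s j \<and> output_shape s' j = output_shape s j))"
proof -
  have c: "reals s ''n1'' (nats s ''o'' 0) = Re (nv c)" "reals s ''n2'' (nats s ''o'' 0) = Im (nv c)"
    "reals s ''m0'' (nats s ''o'' 0) = m0 c"
    by (simp_all add: c_def con_at_def)
  have u: "reals s ''sx'' 0 = Re u" "reals s ''sy'' 0 = Im u" by (simp_all add: u_def)
  show ?thesis
    unfolding out_prog_def
    by (rule runs_RSet[where v = "radius c u"], simp add: c_def u_def)
      (intro runs_straight runs_Cond,
       auto simp: k g c u output_start_def output_shape_def shape_of_def Let_def complex_eq_iff)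
qed

definition piece_ok :: "state \<Rightarrow> complex \<Rightarrow> state \<Rightarrow> nat \<Rightarrow> bool" where
  "piece_ok s g s' k \<longleftrightarrow> (\<exists>c. minimal (con_list s) c (sgn (dir s k + dir s (Suc k))) \<and>
     output_start s' k = g + radius c (sgn (dir s k)) *\<^sub>R sgn (dir s k) \<and> output_shape s' k = shape_of g c)"

definition last_ok :: "state \<Rightarrow> state \<Rightarrow> nat \<Rightarrow> bool" where
  "last_ok s s' n \<longleftrightarrow> (\<exists>k<n. \<exists>c. minimal (con_list s) c (sgn (dir s k + dir s (Suc k))) \<and>
     reals s' ''v'' 0 = radius c (sgn (dir s k + dir s (Suc k))))"

lemma runs_pieces_prog:
  assumes h: "nats s ''h'' 0 = h" "0 < h" "h + h \<le> N"
    and C: "0 < nats s ''C'' 0" "nats s ''C'' 0 \<le> N" and act: "\<And>u. active (con_at s 0) u"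
    and g: "reals s ''gx'' 0 = Re g" "reals s ''gy'' 0 = Im g"
  shows "runs N pieces_prog s (\<lambda>s'. (\<forall>k<h + h. piece_ok s g s' k) \<and> last_ok s s' (h + h))"
  unfolding pieces_prog_def
proof (rule runs_For[where n = "h + h" and
      I = "\<lambda>j s'. (\<forall>k<j. piece_ok s g s' k) \<and> (0 < j \<longrightarrow> last_ok s s' j)"], goal_cases)
  case 1
  show ?case by simp
next
  case (2 k s1)
  define u w where "u = sgn (dir s k)" and "w = sgn (dir s k + dir s (Suc k))"
  have s1: "dir s1 i = dir s i" "con_at s1 i = con_at s i" "nats s1 ''C'' 0 = nats s ''C'' 0"
    "reals s1 ''gx'' 0 = Re g" "reals s1 ''gy'' 0 = Im g" for i
    using agreeD[OF 2(4)] g by (simp_all add: dir_def con_at_def)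
  have k: "nats s1 ''k'' 0 = k" using 2 by simp
  obtain s2 where r2: "reaches N unit_prog s1 s2" and ag2: "agree unit_prog s1 s2"
    and u2: "Complex (reals s2 ''sx'' 0) (reals s2 ''sy'' 0) = u"
    and w2: "Complex (reals s2 ''wx'' 0) (reals s2 ''wy'' 0) = w"
    by (rule runsE[OF runs_unit_prog[OF k, of N]]) (auto simp: u_def w_def s1)
  have out2: "output_start s2 = output_start s1" "output_shape s2 = output_shape s1"
    using agreeD[OF ag2]
    by (simp_all add: output_start_def output_shape_def fun_eq_iff Let_def cong: if_cong)
  have s2: "con_at s2 i = con_at s i" "nats s2 ''C'' 0 = nats s ''C'' 0" "nats s2 ''k'' 0 = k"
    "reals s2 ''gx'' 0 = Re g" "reals s2 ''gy'' 0 = Im g" for i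
    using agreeD[OF ag2] s1 k by (simp_all add: con_at_def)
  have cl: "con_list s2 = con_list s" by (simp add: con_list_def s2)
  obtain s3 c where r3: "reaches N best_prog s2 s3" and ag3: "agree best_prog s2 s3"
    and c: "c = con_at s (nats s3 ''o'' 0)" and best: "minimal (con_list s) c w" "reals s3 ''v'' 0 = radius c w"
  proof (rule runsE[OF runs_best_prog[of s2 N]])
    show "0 < nats s2 ''C'' 0" "nats s2 ''C'' 0 \<le> N" using C by (simp_all add: s2)
    show "active (con_at s2 0) (Complex (reals s2 ''wx'' 0) (reals s2 ''wy'' 0))" using act by (simp add: s2)
  qed (simp add: cl w2 s2)
  have out3: "output_start s3 = output_start s1" "output_shape s3 = output_shape s1"
    unfolding out2[symmetric] using agreeD[OF ag3]
    by (simp_all add: output_start_def output_shape_def fun_eq_iff Let_def cong: if_cong)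
  have con3: "con_at s3 i = con_at s i" for i
    using agreeD[OF ag3] s2(1)[of i] by (simp add: con_at_def)
  have s3: "nats s3 ''k'' 0 = k" "reals s3 ''gx'' 0 = Re g" "reals s3 ''gy'' 0 = Im g"
    "Complex (reals s3 ''sx'' 0) (reals s3 ''sy'' 0) = u"
    using agreeD[OF ag3] s2 u2 by simp_all
  have "runs N out_prog s3 (\<lambda>s4. (\<forall>i<Suc k. piece_ok s g (nupd ''k'' 0 (Suc k) s4) i) \<and>
    (0 < Suc k \<longrightarrow> last_ok s (nupd ''k'' 0 (Suc k) s4) (Suc k)))"
  proof (rule runs_frame[OF runs_out_prog[OF s3(1-3)]])
    fix s4 assume o: "output_start s4 k = g + radius (con_at s3 (nats s3 ''o'' 0)) (Complex (reals s3 ''sx'' 0) (reals s3 ''sy'' 0)) *\<^sub>R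
        Complex (reals s3 ''sx'' 0) (reals s3 ''sy'' 0) \<and>
      output_shape s4 k = shape_of g (con_at s3 (nats s3 ''o'' 0)) \<and>
      (\<forall>j. j \<noteq> k \<longrightarrow> output_start s4 j = output_start s3 j \<and> output_shape s4 j = output_shape s3 j)"
      and ag: "agree out_prog s3 s4"
    define s5 where "s5 = nupd ''k'' 0 (Suc k) s4"
    have s5: "output_start s5 = output_start s4" "output_shape s5 = output_shape s4"
      by (simp_all add: s5_def output_start_def output_shape_def fun_eq_iff Let_def cong: if_cong)
    have v5: "reals s5 ''v'' 0 = radius c w"
      using agreeD(2)[OF ag] best(2) by (simp add: s5_def)
    have now: "output_start s5 k = g + radius c u *\<^sub>R u" "output_shape s5 k = shape_of g c"
      using o by (simp_all add: s3 con3 s5 c)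
    have old: "output_start s5 j = output_start s1 j" "output_shape s5 j = output_shape s1 j" if "j < k" for j
      using o that by (simp_all add: out3 s5)
    have "piece_ok s g s5 i" if "i < Suc k" for i
    proof (cases "i = k")
      case True
      then show ?thesis using now best(1) unfolding u_def w_def piece_ok_def by blast
    next
      case False
      then have "i < k" using that by simp
      then show ?thesis using 2(2) old by (simp add: piece_ok_def)
    qed
    moreover have "last_ok s s5 (Suc k)"
      using best(1) v5 unfolding w_def last_ok_def by blast
    ultimately show "(\<forall>i<Suc k. piece_ok s g (nupd ''k'' 0 (Suc k) s4) i) \<and>
        (0 < Suc k \<longrightarrow> last_ok s (nupd ''k'' 0 (Suc k) s4) (Suc k))"
      unfolding s5_def by blast
  qed
  then show ?case using r2 r3 by (blast intro: reaches_Seq)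
next
  case (3 k s1)
  then show ?case using agreeD(1)[OF 3(3)] h by simp
next
  case 4
  show ?case using h by simp
next
  case 5
  show ?case by simp
next
  case (6 s1)
  then show ?case using h by simp
qed

section \<open>Correctness of the algorithm\<close>

text \<open>The angles of the computed directions, for the decreasing list \<open>xs\<close> of cotangents.\<close>

definition half_angle :: "real list \<Rightarrow> nat \<Rightarrow> real" where
  "half_angle xs k = (case k of 0 \<Rightarrow> 0 | Suc i \<Rightarrow> if i < length xs then pi / 2 - arctan (xs ! i) else pi)"

definition angle :: "real list \<Rightarrow> nat \<Rightarrow> real" where
  "angle xs k = (if k < Suc (length xs) then half_angle xs k else pi + half_angle xs (k - Suc (length xs)))"

lemma half_angle_mono:
  assumes "sorted_wrt (>) xs" "i < j" "j \<le> Suc (length xs)"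
  shows "half_angle xs i < half_angle xs j"
proof -
  have b: "0 < pi / 2 - arctan t" "pi / 2 - arctan t < pi" for t
    using arctan_bounded[of t] by auto
  have "xs ! q < xs ! p" if "p < q" "q < length xs" for p q
    using assms(1) that by (simp add: sorted_wrt_iff_nth_less)
  then show ?thesis
    using assms(2,3) b by (auto simp: half_angle_def arctan_less_iff split: nat.splits)
qed

lemma half_angle_bounds:
  assumes "sorted_wrt (>) xs" "j \<le> Suc (length xs)"
  shows "0 \<le> half_angle xs j" "half_angle xs j \<le> pi"
  using half_angle_mono[OF assms(1), of 0 j] half_angle_mono[OF assms(1), of j "Suc (length xs)"] assms(2)
  by (cases "j = 0"; cases "j = Suc (length xs)"; auto simp: half_angle_def)+

text \<open>An angle whose cotangent is listed equals \<open>pi / 2 - arctan\<close> of it, hence is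
  itself one of the half angles; none of these lies strictly between two consecutive ones.\<close>

lemma half_angle_gap:
  assumes xs: "sorted_wrt (>) xs" and j: "j \<le> length xs"
    and \<theta>: "half_angle xs j < \<theta>" "\<theta> < half_angle xs (Suc j)"
  shows "sin \<theta> \<noteq> 0" "cos \<theta> / sin \<theta> \<notin> set xs"
proof -
  have "0 < \<theta>" "\<theta> < pi"
    using half_angle_bounds[OF xs, of j] half_angle_bounds[OF xs, of "Suc j"] j \<theta> by auto
  then show "sin \<theta> \<noteq> 0" using sin_gt_zero[of \<theta>] by auto
  show "cos \<theta> / sin \<theta> \<notin> set xs"
  proof
    assume "cos \<theta> / sin \<theta> \<in> set xs"
    then obtain i where i: "i < length xs" "xs ! i = cos \<theta> / sin \<theta>" by (auto simp: in_set_conv_nth)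
    have "tan (pi / 2 - \<theta>) = cos \<theta> / sin \<theta>"
      by (simp add: tan_def sin_diff cos_diff)
    then have "arctan (xs ! i) = pi / 2 - \<theta>"
      using i(2) arctan_tan[of "pi / 2 - \<theta>"] \<open>0 < \<theta>\<close> \<open>\<theta> < pi\<close> by simp
    then have e: "half_angle xs (Suc i) = \<theta>" using i by (simp add: half_angle_def)
    have "\<not> Suc i \<le> j" using half_angle_mono[OF xs, of "Suc i" j] j e \<theta> by (cases "Suc i = j") auto
    moreover have "\<not> Suc j \<le> Suc i"
      using half_angle_mono[OF xs, of "Suc j" "Suc i"] i e \<theta> by (cases "i = j") auto
    ultimately show False by simp
  qed
qed

text \<open>At least one cotangent cuts each half turn, so no sector spans an angle of
  \<open>pi\<close>. Adding \<open>pi\<close> leaves cotangents unchanged, so the second half turn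
  inherits the gaps of the first.\<close>

lemma angle_steps:
  assumes xs: "sorted_wrt (>) xs" "xs \<noteq> []" and k: "k < Suc (length xs) + Suc (length xs)"
  shows "angle xs k < angle xs (Suc k)" "angle xs (Suc k) < angle xs k + pi"
    "gap (set xs) (angle xs k) (angle xs (Suc k))"
proof -
  define n where "n = length xs"
  have n: "0 < n" using xs by (simp add: n_def)
  \<comment> \<open>The end of the first half turn is the start of the second, so both fit the form
    \<open>c + half_angle\<close>.\<close>
  have end_eq: "half_angle xs (Suc n) = pi" "half_angle xs 0 = 0" by (simp_all add: half_angle_def n_def)
  obtain j c where jc: "j \<le> n" "angle xs k = c + half_angle xs j" "angle xs (Suc k) = c + half_angle xs (Suc j)"
    "c = 0 \<or> c = pi"
  proof (cases "k < Suc n")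
    case True
    then show ?thesis
      using that[of k 0] end_eq by (cases "k = n") (auto simp: angle_def n_def[symmetric])
  next
    case False
    then have "Suc k - Suc n = Suc (k - Suc n)" by simp
    then show ?thesis
      using that[of "k - Suc n" pi] False k by (auto simp: angle_def n_def[symmetric])
  qed
  have lt: "half_angle xs j < half_angle xs (Suc j)"
    using half_angle_mono[OF xs(1), of j "Suc j"] jc(1) by (simp add: n_def)
  then show "angle xs k < angle xs (Suc k)" using jc by simp
  have "half_angle xs (Suc j) - half_angle xs j < pi"
  proof (cases "j = 0")
    case True
    have "half_angle xs (Suc 0) < pi"
      using half_angle_mono[OF xs(1), of 1 "Suc n"] n end_eq by (simp add: n_def)
    then show ?thesis using True end_eq by simp
  next
    case False
    then have "0 < half_angle xs j"
      using half_angle_mono[OF xs(1), of 0 j] jc(1) end_eq by (simp add: n_def)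
    moreover have "half_angle xs (Suc j) \<le> pi"
      using half_angle_bounds[OF xs(1), of "Suc j"] jc(1) by (simp add: n_def)
    ultimately show ?thesis by simp
  qed
  then show "angle xs (Suc k) < angle xs k + pi" using jc by simp
  show "gap (set xs) (angle xs k) (angle xs (Suc k))"
    unfolding gap_def
  proof (intro allI impI)
    fix \<theta> assume t: "angle xs k < \<theta> \<and> \<theta> < angle xs (Suc k)"
    have "sin (\<theta> - c) \<noteq> 0" "cos (\<theta> - c) / sin (\<theta> - c) \<notin> set xs"
      using half_angle_gap[OF xs(1), of j "\<theta> - c"] jc t by (auto simp: n_def)
    then show "sin \<theta> \<noteq> 0 \<and> cos \<theta> / sin \<theta> \<notin> set xs"
      using jc(4) by (auto simp: sin_diff cos_diff)
  qed
qed

lemma dir_polar: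
  assumes d: "sorted_dirs T xs s"
    and m: "\<forall>i<Suc (length xs). reals s' ''ux'' i = reals s ''ux'' i \<and> reals s' ''uy'' i = reals s ''uy'' i \<and>
      reals s' ''ux'' (Suc (length xs) + i) = - reals s ''ux'' i \<and>
      reals s' ''uy'' (Suc (length xs) + i) = - reals s ''uy'' i"
    and e: "reals s' ''ux'' (Suc (length xs) + Suc (length xs)) = 1"
      "reals s' ''uy'' (Suc (length xs) + Suc (length xs)) = 0"
    and k: "k \<le> Suc (length xs) + Suc (length xs)"
  shows "\<exists>r>0. dir s' k = r *\<^sub>R cis (angle xs k)"
proof -
  let ?h = "Suc (length xs)"
  have half: "\<exists>r>0. dir s i = r *\<^sub>R cis (half_angle xs i)" if "i < ?h" for i
  proof (cases i)
    case 0
    then show ?thesis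
      using d by (intro exI[of _ 1]) (simp add: dir_def sorted_dirs_def half_angle_def complex_eq_iff)
  next
    case (Suc j)
    then have j: "j < length xs" using that by simp
    have "cis (half_angle xs i) = Complex (sin (arctan (xs ! j))) (cos (arctan (xs ! j)))"
      using j Suc by (simp add: half_angle_def complex_eq_iff sin_diff cos_diff)
    \<comment> \<open>The root of this number is the length of the vector \<open>(t, 1)\<close> with
      \<open>t = xs ! j\<close>.\<close>
    moreover have "0 < 1 + (xs ! j)\<^sup>2" by (simp add: add_pos_nonneg)
    then have "0 < sqrt (1 + (xs ! j)\<^sup>2)" by simp
    ultimately show ?thesis
      using d j Suc
      by (intro exI[of _ "sqrt (1 + (xs ! j)\<^sup>2)"])
        (simp add: dir_def sorted_dirs_def complex_eq_iff sin_arctan cos_arctan)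
  qed
  consider "k < ?h" | i where "k = ?h + i" "i < ?h" | "k = ?h + ?h" using k
    by (metis add_le_cancel_left le_add_diff_inverse less_le_not_le linorder_le_less_linear linorder_not_less order_le_less)
  then show ?thesis
  proof cases
    case 1
    then show ?thesis using half[OF 1] m by (simp add: angle_def dir_def)
  next
    case 2
    obtain r where "r > 0" "dir s i = r *\<^sub>R cis (half_angle xs i)" using half[OF 2(2)] by auto
    moreover have "dir s' k = - dir s i" using m 2 by (simp add: dir_def complex_eq_iff)
    moreover have "cis (angle xs k) = - cis (half_angle xs i)"
      using 2 by (simp add: angle_def complex_eq_iff)
    ultimately show ?thesis by (intro exI[of _ r]) simp
  next
    case 3
    have "angle xs k = 2 * pi" using 3 by (simp add: angle_def half_angle_def)
    then show ?thesis using e 3 by (intro exI[of _ 1]) (simp add: dir_def complex_eq_iff)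
  qed
qed

section \<open>The whole program and its running time\<close>

definition main_prog :: com where
  "main_prog = succ_prog ;; cons_prog ;; breaks_prog ;; bound_prog ;; sort_prog ;; mirror_prog ;;
     pieces_prog ;; final_prog"

context robust_region
begin

text \<open>The sum of neighbouring directions is the sample direction that
  \<open>describes_V\<close> asks for. There the minimal constraint has radius \<open>R\<close>,
  which is positive; the second claim serves the final test.\<close>

lemma describes_output:
  assumes xs: "sorted_wrt (>) xs" "xs \<noteq> []"
    and T: "\<And>c c'. c \<in> set cons \<Longrightarrow> c' \<in> set cons \<Longrightarrow> set (breaks c c') \<subseteq> set xs"
    and K: "K = Suc (length xs) + Suc (length xs)"
    and D: "\<And>k. k \<le> K \<Longrightarrow> \<exists>r>0. D k = r *\<^sub>R cis (angle xs k)"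
    and out: "\<And>k. k < K \<Longrightarrow> \<exists>c. minimal cons c (sgn (D k + D (Suc k))) \<and>
      st k = g + radius c (sgn (D k)) *\<^sub>R sgn (D k) \<and> sh k = shape_of g c"
  shows "describes (Boundary (map (\<lambda>k. (st k, sh k)) [0..<K])) ((+) g ` V)"
    and "\<And>c k. k < K \<Longrightarrow> minimal cons c (sgn (D k + D (Suc k))) \<Longrightarrow> 0 < radius c (sgn (D k + D (Suc k)))"
proof -
  have sgnD: "sgn (D k) = cis (angle xs k)" if "k \<le> K" for k
    using D[OF that] by (auto simp: sgn_scaleR sgn_div_norm)
  have mid: "\<exists>m. angle xs k < m \<and> m < angle xs (Suc k) \<and> sgn (D k + D (Suc k)) = cis m" if "k < K" for k
  proof -
    have "k \<le> K" "Suc k \<le> K" using that by simp_all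
    then obtain p q where pq: "0 < p" "D k = p *\<^sub>R cis (angle xs k)" "0 < q" "D (Suc k) = q *\<^sub>R cis (angle xs (Suc k))"
      using D by blast
    have st: "angle xs k < angle xs (Suc k)" "angle xs (Suc k) < angle xs k + pi"
      using angle_steps(1,2)[OF xs, of k] that K by auto
    obtain r m where "0 < r" "angle xs k < m" "m < angle xs (Suc k)"
      "p *\<^sub>R cis (angle xs k) + q *\<^sub>R cis (angle xs (Suc k)) = r *\<^sub>R cis m"
      using polar_between[OF pq(1,3) st] .
    then show ?thesis using pq by (intro exI[of _ m]) (simp add: sgn_scaleR sgn_div_norm)
  qed
  obtain c where c: "\<And>k. k < K \<Longrightarrow> minimal cons (c k) (sgn (D k + D (Suc k))) \<and>
      st k = g + radius (c k) (sgn (D k)) *\<^sub>R sgn (D k) \<and> sh k = shape_of g (c k)"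
    using out by metis
  have "describes (Boundary (map (\<lambda>k. (g + radius (c k) (cis (angle xs k)) *\<^sub>R cis (angle xs k), shape_of g (c k))) [0..<K]))
    ((+) g ` V)"
  proof (rule describes_V[where T = "set xs"])
    show "2 \<le> K" using K by simp
    show "angle xs i < angle xs (Suc i) \<and> angle xs (Suc i) < angle xs i + pi \<and> gap (set xs) (angle xs i) (angle xs (Suc i))"
      if "i < K" for i using angle_steps[OF xs, of i] that K by blast
    show "angle xs K = angle xs 0 + 2 * pi" by (simp add: K angle_def half_angle_def)
    show "set (breaks c c') \<subseteq> set xs" if "c \<in> set cons" "c' \<in> set cons" for c c' using T that by blast
    show "c i \<in> set cons \<and> (\<exists>m. angle xs i < m \<and> m < angle xs (Suc i) \<and> active (c i) (cis m) \<and>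
        (\<forall>c'\<in>set cons. active c' (cis m) \<longrightarrow> radius (c i) (cis m) \<le> radius c' (cis m)))" if "i < K" for i
      using c[OF that] mid[OF that] by (auto simp: minimal_def)
  qed
  moreover have "map (\<lambda>k. (st k, sh k)) [0..<K] =
      map (\<lambda>k. (g + radius (c k) (cis (angle xs k)) *\<^sub>R cis (angle xs k), shape_of g (c k))) [0..<K]"
    using c sgnD by (intro map_cong) auto
  ultimately show "describes (Boundary (map (\<lambda>k. (st k, sh k)) [0..<K])) ((+) g ` V)" by simp
  fix c k assume k: "k < K" and m: "minimal cons c (sgn (D k + D (Suc k)))"
  obtain t where t: "sgn (D k + D (Suc k)) = cis t" using mid[OF k] by blast
  have "R t = radius c (cis t)"
    using m unfolding minimal_def t by (intro R_eq_iff_minimal) auto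
  then show "0 < radius c (sgn (D k + D (Suc k)))" using R_pos[of t] t by simp
qed

end

lemma length_le_concat: "(\<And>h. h \<in> set hs \<Longrightarrow> h \<noteq> []) \<Longrightarrow> length hs \<le> length (concat hs)"
proof (induction hs)
  case (Cons h hs)
  have "0 < length h" using Cons.prems[of h] by simp
  moreover have "length hs \<le> length (concat hs)" using Cons.prems by (intro Cons.IH) auto
  ultimately show ?case unfolding concat.simps length_append list.size by linarith
qed simp

lemma member_le_concat: "h \<in> set hs \<Longrightarrow> length h \<le> length (concat hs)"
  by (induction hs) auto

lemma edge_chain:
  assumes "(a, b) \<in> set (zip h (rotate1 h))"
  shows "\<exists>c. (b, c) \<in> set (zip h (rotate1 h))"
proof -
  have "b \<in> set h" using set_zip_rightD[OF assms] by simp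
  then obtain i where "i < length h" "h ! i = b" by (auto simp: in_set_conv_nth)
  then show ?thesis by (auto simp: in_set_conv_nth intro!: exI[of _ "rotate1 h ! i"] exI[of _ i])
qed

lemma closed_segment_diff: "closed_segment (a - g) (b - g) = (\<lambda>x. x - g) ` closed_segment a b"
  for a b g :: complex
  using closed_segment_translation[of "- g" a b] by simp

text \<open>\<open>N\<close> is the bound on the longest loop: \<open>n\<close> edges give
  \<open>4 * n\<close> constraints, their ordered pairs \<open>10 * (4 * n) * (4 * n)\<close>
  breakpoints, and one more direction with all the opposite ones makes
  \<open>2 * (160 * n * n + 1)\<close> sectors.\<close>

theorem runs_main_prog:
  assumes dom: "polygonal_domain P" and \<alpha>: "0 < \<alpha>" "\<alpha> \<le> 1" and g: "g \<in> region P"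
    and N: "N = 2 + 320 * num_vertices P * num_vertices P"
  shows "runs N main_prog (input_state P \<alpha> g) (\<lambda>s. describes (computed s) (Vis (region P) \<alpha> g))"
proof -
  interpret polygonal P by unfold_locales (rule dom)
  define hs vs n where "hs = outer P # holes P" and "vs = vertices P" and "n = length vs"
  have vs: "vs = concat hs" by (simp add: vs_def hs_def vertices_def)
  have nn: "num_vertices P = n" by (simp add: num_vertices_def n_def vs_def)
  have ne: "h \<noteq> []" if "h \<in> set hs" for h using curve_ne that by (simp add: hs_def)
  have lens: "length hs \<le> n" "\<And>h. h \<in> set hs \<Longrightarrow> length h \<le> n"
    using length_le_concat[of hs] ne member_le_concat[of _ hs] by (auto simp: n_def vs)
  have n0: "0 < n" using lens(1) by (simp add: hs_def)
  then have "n \<le> n * n" by simp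
  moreover have N': "N = 2 + 320 * (n * n)" by (simp add: N nn)
  ultimately have nN: "n \<le> N" "4 * n \<le> N" "160 * (n * n) \<le> N" by linarith+
  define s0 where "s0 = input_state P \<alpha> g"
  have in0: "nats s0 ''curves'' 0 = length hs" "\<And>c. c < length hs \<Longrightarrow> nats s0 ''lengths'' c = length (hs ! c)"
    "\<And>i. i < n \<Longrightarrow> reals s0 ''vx'' i = Re (vs ! i) \<and> reals s0 ''vy'' i = Im (vs ! i)"
    "reals s0 ''gx'' 0 = Re g" "reals s0 ''gy'' 0 = Im g" "reals s0 ''alpha'' 0 = \<alpha>"
    by (simp_all add: s0_def input_state_def nth0_def hs_def n_def vs_def del: map_map list.map)
  have Vis_iff: "p \<in> Vis (region P) \<alpha> g \<longleftrightarrow>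
      (\<forall>x\<in>boundary P. \<forall>y\<in>closed_segment g p. \<alpha> * norm (p - y) \<le> norm (x - y))" for p
    by (rule in_Vis_iff[OF closed_region_P frontier_region boundary_not_interior g \<alpha>(1)])
  obtain s1 where r1: "reaches N succ_prog s0 s1" and ag1: "agree succ_prog s0 s1"
    and s1: "nats s1 ''i'' 0 = length (concat hs)"
      "\<forall>c<length hs. \<forall>j<length (hs ! c). succ_ok hs (nats s1 ''s'') c j"
  proof (rule runsE[OF runs_succ_prog[OF in0(1,2), of N]])
    show "length hs \<le> N" using lens nN by linarith
    show "length h \<le> N" if "h \<in> set hs" for h using lens(2)[OF that] nN by linarith
  qed auto
  define f where "f = nats s1 ''s''"
  define es where "es = map (rel_edge vs f g) [0..<n]"
  have in1: "reals s1 = reals s0" using agreeD(2)[OF ag1] by (simp add: fun_eq_iff)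
  have edges: "(\<lambda>p. (vs ! p, vs ! f p)) ` {..<n} = (\<Union>h\<in>set hs. set (zip h (rotate1 h)))"
    unfolding vs n_def f_def using s1 by (intro cyclic_edges) auto
  have set_es: "set es = (\<lambda>(a, b). (a - g, b - g)) ` (\<Union>h\<in>set hs. set (zip h (rotate1 h)))"
    unfolding edges[symmetric] by (auto simp: es_def rel_edge_def image_image)
  have f: "f i < n" if i: "i < n" for i
  proof -
    obtain c j where cj: "c < length hs" "j < length (hs ! c)" "i = offset hs c + j"
      using offset_surj[of i hs "length hs"] i by (auto simp: offset_def n_def vs)
    define j' where "j' = (if Suc j < length (hs ! c) then Suc j else 0)"
    have "j' < length (hs ! c)"
      using le_less_trans[OF le0 cj(2)] by (simp add: j'_def)
    then have "offset hs c + j' < n"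
      using offset_less[OF cj(1) order_refl] by (simp add: offset_def n_def vs)
    moreover have "f i = offset hs c + j'"
      using s1 cj unfolding f_def succ_ok_def j'_def by blast
    ultimately show ?thesis by simp
  qed
  define cs where "cs = concat (map (\<lambda>(a, b). edge_cons \<alpha> a b) es)"
  have len_cs: "length cs = 4 * n"
    by (simp add: cs_def es_def edge_cons_def Let_def length_concat rel_edge_def o_def split_def sum_list_triv)
  have cs0: "active (cs ! 0) u" for u
    using n0 \<alpha> by (cases "[0..<n]")
      (auto simp: cs_def es_def edge_cons_def Let_def rel_edge_def foot_con_def con_simps)
  obtain s2 where r2: "reaches N cons_prog s1 s2" and ag2: "agree cons_prog s1 s2"
    and cs2: "con_list s2 = cs"
  proof (rule runsE[OF runs_cons_prog[of s1 vs N g \<alpha>]])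
    show "nats s1 ''i'' 0 = length vs" using s1 by (simp add: vs)
    show "length vs \<le> N" using nN by (simp add: n_def)
    show "nats s1 ''s'' i < length vs" if "i < length vs" for i using f that by (simp add: f_def n_def)
    show "reals s1 ''vx'' i = Re (vs ! i) \<and> reals s1 ''vy'' i = Im (vs ! i)" if "i < length vs" for i
      using in0(3) that by (simp add: in1 n_def)
    show "reals s1 ''gx'' 0 = Re g" "reals s1 ''gy'' 0 = Im g" "reals s1 ''alpha'' 0 = \<alpha>"
      using in0 by (simp_all add: in1)
  qed (simp add: cs_def es_def f_def n_def)
  have C2: "nats s2 ''C'' 0 = 4 * n" using arg_cong[OF cs2, of length] by (simp add: con_list_def len_cs)
  have con2: "con_at s2 k = cs ! k" if "k < 4 * n" for k
    using that arg_cong[OF cs2, of "\<lambda>l. l ! k"] by (simp add: con_list_def C2)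
  have g2: "reals s2 ''gx'' 0 = Re g" "reals s2 ''gy'' 0 = Im g"
    using agreeD(2)[OF ag2] in0 in1 by (simp_all add: con_names_def)
  obtain s3 where r3: "reaches N breaks_prog s2 s3" and ag3: "agree breaks_prog s2 s3"
    and s3: "length (t_list s3) = 10 * (4 * n) * (4 * n)"
      "\<forall>k<4 * n. \<forall>l<4 * n. set (breaks (con_at s2 k) (con_at s2 l)) \<subseteq> set (t_list s3)"
    by (rule runsE[OF runs_breaks_prog[OF C2 nN(2)]]) auto
  define T where "T = set (t_list s3)"
  have len3: "length (t_list s3) = 160 * (n * n)" using s3 by simp
  have T: "set (breaks c c') \<subseteq> T" if "c \<in> set cs" "c' \<in> set cs" for c c'
    using that s3 con2 unfolding in_set_conv_nth len_cs T_def by metis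
  have Tne: "T \<noteq> {}" using len3 n0 by (auto simp: T_def)
  have len3N: "length (t_list s3) \<le> N" using len3 nN by simp
  obtain s4 where r4: "reaches N bound_prog s3 s4" and ag4: "agree bound_prog s3 s4"
    and s4: "\<forall>t\<in>set (t_list s3). \<bar>t\<bar> < reals s4 ''B'' 0"
    by (rule runsE[OF runs_bound_prog[OF len3N]])
  have t4: "t_list s4 = t_list s3" using agreeD[OF ag4] by (simp add: t_list_def)
  obtain s5 xs where r5: "reaches N sort_prog s4 s5" and ag5: "agree sort_prog s4 s5"
    and xs: "sorted_dirs T xs s5" "set xs = T"
    by (rule runsE[OF runs_sort_prog[of s4 N]]) (use len3N s4 in \<open>auto simp: t4 T_def\<close>)
  define h where "h = Suc (length xs)"
  have h5: "nats s5 ''h'' 0 = h" and sorted: "sorted_wrt (>) xs"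
    using xs(1) by (simp_all add: sorted_dirs_def h_def)
  have "distinct xs"
    using sorted unfolding sorted_wrt_iff_nth_less distinct_conv_nth by (metis less_irrefl nat_neq_iff)
  then have "length xs \<le> 160 * (n * n)"
    using distinct_card[of xs] card_length[of "t_list s3"] len3 xs(2) by (simp add: T_def)
  then have hN: "h + h \<le> N" by (simp add: h_def N')
  obtain s6 where r6: "reaches N mirror_prog s5 s6" and ag6: "agree mirror_prog s5 s6"
    and s6: "\<forall>i<h. reals s6 ''ux'' i = reals s5 ''ux'' i \<and> reals s6 ''uy'' i = reals s5 ''uy'' i \<and>
        reals s6 ''ux'' (h + i) = - reals s5 ''ux'' i \<and> reals s6 ''uy'' (h + i) = - reals s5 ''uy'' i"
      "reals s6 ''ux'' (h + h) = 1" "reals s6 ''uy'' (h + h) = 0"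
    by (rule runsE[OF runs_mirror_prog[OF h5, of N]]) (use hN in auto)
  have con6: "con_at s6 k = con_at s2 k" for k
    using agreeD(2)[OF ag3] agreeD(2)[OF ag4] agreeD(2)[OF ag5] agreeD(2)[OF ag6]
    by (simp add: con_at_def)
  have n6: "nats s6 ''C'' 0 = 4 * n" "nats s6 ''h'' 0 = h"
    "reals s6 ''gx'' 0 = Re g" "reals s6 ''gy'' 0 = Im g"
    using agreeD[OF ag3] agreeD[OF ag4] agreeD[OF ag5] agreeD[OF ag6] C2 h5 g2 by simp_all
  have cs6: "con_list s6 = cs"
    unfolding cs2[symmetric] by (simp add: con_list_def n6 C2 con6)
  have act6: "active (con_at s6 0) u" for u using cs0 con2[of 0] n0 by (simp add: con6)
  have D: "\<exists>r>0. dir s6 k = r *\<^sub>R cis (angle xs k)" if "k \<le> h + h" for k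
    by (rule dir_polar[OF xs(1)]) (use s6 that in \<open>simp_all add: h_def\<close>)
  obtain s7 k7 c7 where r7: "reaches N pieces_prog s6 s7" and ag7: "agree pieces_prog s6 s7"
    and pieces: "\<And>k. k < h + h \<Longrightarrow> \<exists>c. minimal cs c (sgn (dir s6 k + dir s6 (Suc k))) \<and>
      output_start s7 k = g + radius c (sgn (dir s6 k)) *\<^sub>R sgn (dir s6 k) \<and> output_shape s7 k = shape_of g c"
    and last: "k7 < h + h" "minimal cs c7 (sgn (dir s6 k7 + dir s6 (Suc k7)))"
      "reals s7 ''v'' 0 = radius c7 (sgn (dir s6 k7 + dir s6 (Suc k7)))"
  proof (rule runsE[OF runs_pieces_prog[OF n6(2) _ hN _ _ act6 n6(3,4)]])
    show "0 < h" by (simp add: h_def)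
    show "0 < nats s6 ''C'' 0" using n0 by (simp add: n6)
    show "nats s6 ''C'' 0 \<le> N" using nN by (simp add: n6)
  qed (auto simp: cs6 piece_ok_def last_ok_def)
  have n7: "nats s7 ''h'' 0 = h" "reals s7 ''gx'' 0 = Re g" "reals s7 ''gy'' 0 = Im g"
    using agreeD[OF ag7] n6 by simp_all
  have bdry: "boundary P = (\<Union>h\<in>set hs. \<Union>(a, b)\<in>set (zip h (rotate1 h)). closed_segment a b)"
    unfolding boundary_segments hs_def ..
  have "runs N final_prog s7 (\<lambda>s. describes (computed s) (Vis (region P) \<alpha> g))"
  proof (cases "g \<in> boundary P")
    case True
    have Vg: "Vis (region P) \<alpha> g = {g}"
    proof (intro equalityI subsetI)
      fix p assume "p \<in> Vis (region P) \<alpha> g"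
      \<comment> \<open>The condition for \<open>x = y = g\<close>: the guarding disk must be a
        point.\<close>
      then have "\<alpha> * norm (p - g) \<le> norm (g - g)" using True unfolding Vis_iff by blast
      then show "p \<in> {g}" using \<alpha>(1) by (simp add: mult_le_0_iff)
    qed (auto simp: Vis_iff)
    obtain a b where ab: "(a, b) \<in> (\<Union>h\<in>set hs. set (zip h (rotate1 h)))" "g \<in> closed_segment a b"
      using True by (auto simp: bdry)
    \<comment> \<open>The edge through \<open>g\<close> has its foot at \<open>g\<close>, so its
      foot constraint bounds the radius by 0 in every direction.\<close>
    define c0 where "c0 = foot_con \<alpha> (a - g) (b - g - (a - g))"
    have "c0 \<in> set cs"
      using ab(1) by (auto simp: c0_def cs_def set_es edge_cons_def Let_def intro!: bexI[of _ "(a, b)"])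
    moreover have "active c0 u" for u
      using \<alpha>(1) by (simp add: c0_def foot_con_def con_simps)
    moreover have "radius c0 u \<le> 0" for u
    proof -
      have "0 \<in> closed_segment (a - g) (b - g)"
        unfolding closed_segment_diff using ab(2) by force
      from foot_closest[OF this] show ?thesis
        by (simp add: c0_def foot_con_def con_simps)
    qed
    ultimately have "reals s7 ''v'' 0 \<le> 0"
      using last(2,3) unfolding minimal_def by (metis order_trans)
    then show ?thesis
      unfolding final_prog_def Vg
      by (intro runs_Cond runs_straight)
        (auto simp: computed_def output_start_def n7 complex_eq_iff)
  next
    case False
    interpret robust_region es \<alpha>
    proof
      show "es \<noteq> []" using n0 by (simp add: es_def)
      show "\<exists>c. (b, c) \<in> set es" if ab: "(a, b) \<in> set es" for a b
      proof -
        obtain a' b' h where ab': "h \<in> set hs" "(a', b') \<in> set (zip h (rotate1 h))" "a = a' - g" "b = b' - g"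
          using ab by (auto simp: set_es)
        obtain c where "(b', c) \<in> set (zip h (rotate1 h))" using edge_chain[OF ab'(2)] ..
        then have "(b, c - g) \<in> set es" using ab' by (force simp: set_es)
        then show ?thesis ..
      qed
      show "0 \<notin> closed_segment a b" if "(a, b) \<in> set es" for a b
      proof
        assume "0 \<in> closed_segment a b"
        moreover obtain a' b' h where ab': "h \<in> set hs" "(a', b') \<in> set (zip h (rotate1 h))" "a = a' - g" "b = b' - g"
          using \<open>(a, b) \<in> set es\<close> by (auto simp: set_es)
        ultimately have "g \<in> closed_segment a' b'" by (auto simp: closed_segment_diff)
        then show False using False ab' by (auto simp: bdry)
      qed
    qed (use \<alpha> in auto)
    have cons: "cons = cs" by (simp add: cons_def cs_def)
    have E: "E = (\<lambda>x. x - g) ` boundary P"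
    proof -
      have "E = (\<Union>e\<in>(\<Union>h\<in>set hs. set (zip h (rotate1 h))). closed_segment (fst e - g) (snd e - g))"
        unfolding E_def set_es by (simp add: split_def)
      also have "\<dots> = (\<lambda>x. x - g) ` boundary P"
        unfolding closed_segment_diff bdry by (force simp: split_def)
      finally show ?thesis .
    qed
    have "Vis (region P) \<alpha> g = (+) g ` V"
    proof -
      have "p \<in> Vis (region P) \<alpha> g \<longleftrightarrow> p - g \<in> V" for p
      proof -
        have "closed_segment 0 (p - g) = (\<lambda>x. x - g) ` closed_segment g p"
          using closed_segment_diff[of g g p] by simp
        then show ?thesis by (simp add: Vis_iff V_def E)
      qed
      then show ?thesis by (force simp: image_iff)
    qed
    moreover have xs_ne: "xs \<noteq> []" using Tne xs(2) by auto
    note out = describes_output[OF sorted xs_ne T[folded cons, folded xs(2)] _ D,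
      where K = "h + h" and st = "output_start s7" and sh = "output_shape s7" and g = g]
    have "describes (Boundary (map (\<lambda>k. (output_start s7 k, output_shape s7 k)) [0..<h + h])) ((+) g ` V)"
      by (rule out(1)) (use pieces in \<open>auto simp: h_def cons\<close>)
    moreover have "0 < reals s7 ''v'' 0"
      unfolding last(3) by (rule out(2)) (use pieces last in \<open>auto simp: h_def cons\<close>)
    ultimately show ?thesis
      unfolding final_prog_def
      by (intro runs_Cond runs_straight)
        (auto simp: computed_def output_start_def output_shape_def n7 h_def cong: if_cong)
  qed
  then show ?thesis
    unfolding main_prog_def s0_def[symmetric]
    using r1 r2 r3 r4 r5 r6 r7 by (blast intro: reaches_Seq)
qed

theorem lemma8:
  shows "\<exists>(prog :: com) (bound :: nat poly).
    \<forall>(P :: polydom) (\<alpha> :: real) (g :: complex).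
      polygonal_domain P \<and>
      0 < \<alpha> \<and> \<alpha> \<le> sin (smallest_angle P / 2) \<and>
      g \<in> region P \<longrightarrow>
      (\<exists>t s. exec prog (input_state P \<alpha> g) t s \<and>
             t \<le> poly bound (num_vertices P) \<and>
             describes (computed s) (Vis (region P) \<alpha> g))"
proof -
  obtain p :: "nat poly" where p: "\<And>N. time_bound N main_prog = poly p N"
    using time_bound_poly by blast
  \<comment> \<open>\<open>[:2, 0, 320:]\<close> is the loop bound as a polynomial in the number of
    vertices.\<close>
  have "\<exists>t s. exec main_prog (input_state P \<alpha> g) t s \<and> t \<le> poly (pcompose p [:2, 0, 320:]) (num_vertices P) \<and>
      describes (computed s) (Vis (region P) \<alpha> g)"
    if "polygonal_domain P \<and> 0 < \<alpha> \<and> \<alpha> \<le> sin (smallest_angle P / 2) \<and> g \<in> region P" for P \<alpha> g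
  proof -
    have "\<alpha> \<le> 1" using that sin_le_one[of "smallest_angle P / 2"] by linarith
    then have "runs (2 + 320 * num_vertices P * num_vertices P) main_prog (input_state P \<alpha> g)
        (\<lambda>s. describes (computed s) (Vis (region P) \<alpha> g))"
      using that by (intro runs_main_prog) auto
    then show ?thesis
      unfolding runs_def p by (simp add: poly_pcompose mult.commute mult.left_commute)
  qed
  then show ?thesis by blast
qed

end
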